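(* For every $f\in L^1(\mathbb H^d)$, the Fourier transform $\widehat f_{\mathbb H}:\widetilde{\mathbb H}^d\to\mathbb C$ extends continuously to the whole metric space $(\widehat{\mathbb H}^d,\widehat d)$. Denoting this extension still by $\widehat f_{\mathbb H}$ (or $\mathcal F_{\mathbb H}f$), the linear map $\mathcal F_{\mathbb H}:f\mapsto\widehat f_{\mathbb H}$ is continuous from $L^1(\mathbb H^d)$ to the space $\mathcal C_0(\widehat{\mathbb H}^d)$ of continuous functions on $\widehat{\mathbb H}^d$ tending to $0$ at infinity (with the supremum norm). Moreover, for all $(\dot x,k)\in\widehat{\mathbb H}^d_0$, $$\mathcal F_{\mathbb H}f(\dot x,k)=\int_{\mathbb H^d}\overline{\mathcal K_d(\dot x,k,Y)}\,f(Y,s)\,dY\,ds,$$ where $\mathcal K_d(\dot x,k,Y)=\prod_{j=1}^d\mathcal K(\dot x_j,k_j,Y_j)$ with $Y_j=(y_j,\eta_j)$, and for $\dot x\in\mathbb R$, $k\in\mathbb Z$, $(y,\eta)\in\mathbb R^2$, $$\mathcal K(\dot x,k,y,\eta)=\frac1{2\pi}\int_{-\pi}^{\pi}e^{i\left(2|\dot x|^{1/2}(y\sin z+\eta\,\mathrm{sgn}(\dot x)\cos z)+kz\right)}\,dz.$$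
   Context: Let $d\ge1$. The Heisenberg group $\mathbb H^d$ is $T^\star\mathbb R^d\times\mathbb R\cong\mathbb R^{2d+1}$, with elements $w=(Y,s)=(y,\eta,s)$ and Haar measure equal to Lebesgue measure; $L^1(\mathbb H^d)=L^1(\mathbb R^{2d+1})$. Hermite functions: for $n\in\mathbb N^d$ ($\mathbb N$ includes $0$), $H_n=(2^{|n|}n!)^{-1/2}\prod_{j=1}^d C_j^{n_j}H_0$, where $(C_ju)(x)=-\partial_ju(x)+x_ju(x)$ and $H_0(x)=\pi^{-d/4}e^{-|x|^2/2}$; $(H_n)_{n\in\mathbb N^d}$ is an orthonormal basis of $L^2(\mathbb R^d)$. For $\lambda\in\mathbb R\setminus\{0\}$, $H_{n,\lambda}(x)=|\lambda|^{d/4}H_n(|\lambda|^{1/2}x)$. Let $\widetilde{\mathbb H}^d=\mathbb N^d\times\mathbb N^d\times(\mathbb R\setminus\{0\})$, with elements $\widehat w=(n,m,\lambda)$. For $f\in L^1(\mathbb H^d)$, its Fourier transform is the function on $\widetilde{\mathbb H}^d$ $$\widehat f_{\mathbb H}(\widehat w)=\mathcal F_{\mathbb H}f(\widehat w)=\int_{\mathbb H^d}\overline{e^{is\lambda}\mathcal W(\widehat w,Y)}\,f(Y,s)\,dY\,ds,\quad \mathcal W(\widehat w,Y)=\int_{\mathbb R^d}e^{2i\lambda\langle\eta,z\rangle}H_{n,\lambda}(y+z)H_{m,\lambda}(-y+z)\,dz.$$ Let $\widehat{\mathbb H}^d_0=\big((\mathbb R_-)^d\cup(\mathbb R_+)^d\big)\times\mathbb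 Z^d$ (with $\mathbb R_\pm$ containing $0$) and let $\widehat{\mathbb H}^d=\widetilde{\mathbb H}^d\cup\widehat{\mathbb H}^d_0$ (disjoint union) carry the distance $\widehat d$ given, with $|\cdot|_1$ the $\ell^1$ norm, by $\widehat d((n,m,\lambda),(n',m',\lambda'))=|\lambda(n+m)-\lambda'(n'+m')|_1+|(m-n)-(m'-n')|_1+|\lambda-\lambda'|$, $\widehat d((n,m,\lambda),(\dot x,k))=\widehat d((\dot x,k),(n,m,\lambda))=|\lambda(n+m)-\dot x|_1+|m-n-k|_1+|\lambda|$, $\widehat d((\dot x,k),(\dot x',k'))=|\dot x-\dot x'|_1+|k-k'|_1$. This metric space is the completion of $\widetilde{\mathbb H}^d$, and its closed bounded subsets are compact. *)

theory Defs
  imports "HOL-Analysis.Analysis"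
begin

text \<open>The dimension \<open>d \<ge> 1\<close> is the cardinality of the index type \<open>'d\<close>. A point is \<open>((y, \<eta>), s)\<close>.\<close>

type_synonym 'd heis = "((real ^ 'd) \<times> (real ^ 'd)) \<times> real"

text \<open>The library has no type of classes modulo null sets, so \<open>L\<^sup>1\<close> is rendered as the space of
  integrable functions with its seminorm.\<close>

definition L1_heis :: "('d::finite heis \<Rightarrow> complex) set" where
  "L1_heis = {f. integrable lebesgue f}"

definition L1_norm :: "('d::finite heis \<Rightarrow> complex) \<Rightarrow> real" where
  "L1_norm f = (LINT w|lebesgue. norm (f w))"

definition creation :: "'d::finite \<Rightarrow> (real ^ 'd \<Rightarrow> real) \<Rightarrow> real ^ 'd \<Rightarrow> real" where
  "creation j u x = - deriv (\<lambda>t. u (x + t *\<^sub>R axis j 1)) 0 + x $ j * u x"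

definition hermite0 :: "real ^ 'd::finite \<Rightarrow> real" where
  "hermite0 x = pi powr (- real CARD('d) / 4) * exp (- (norm x)\<^sup>2 / 2)"

text \<open>The fold is the product of the operators \<open>C\<^sub>j ^ n\<^sub>j\<close> applied to \<open>H\<^sub>0\<close>. It does not depend on the
  order of the indices, although the operators \<open>creation j\<close> do not commute on arbitrary
  (non-smooth) functions; see \<open>creation_fold\<close> below.\<close>

definition hermite :: "nat ^ 'd::finite \<Rightarrow> real ^ 'd \<Rightarrow> real" where
  "hermite n x =
     Finite_Set.fold (\<lambda>j. creation j ^^ (n $ j)) hermite0 UNIV x
       / sqrt (2 ^ (\<Sum>j\<in>UNIV. n $ j) * (\<Prod>j\<in>UNIV. fact (n $ j)))"

definition hermite_scaled :: "nat ^ 'd::finite \<Rightarrow> real \<Rightarrow> real ^ 'd \<Rightarrow> real" where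
  "hermite_scaled n l x = \<bar>l\<bar> powr (real CARD('d) / 4) * hermite n (\<bar>l\<bar> powr (1 / 2) *\<^sub>R x)"

definition creation1 :: "(real \<Rightarrow> real) \<Rightarrow> real \<Rightarrow> real" where
  "creation1 u t = - deriv u t + t * u t"

definition hermite1 :: "nat \<Rightarrow> real \<Rightarrow> real" where
  "hermite1 k = (creation1 ^^ k) (\<lambda>t. exp (- t\<^sup>2 / 2))"

lemma hermite1_poly: "\<exists>p. hermite1 k = (\<lambda>t. poly p t * exp (- t\<^sup>2 / 2))"
proof (induction k)
  case 0
  show ?case by (rule exI[of _ 1]) (simp add: hermite1_def)
next
  case (Suc k)
  then obtain p where p: "hermite1 k = (\<lambda>t. poly p t * exp (- t\<^sup>2 / 2))" by blast
  have d: "deriv (\<lambda>t. poly p t * exp (- t\<^sup>2 / 2)) t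
      = poly (pderiv p) t * exp (- t\<^sup>2 / 2) - t * poly p t * exp (- t\<^sup>2 / 2)" for t
    by (rule DERIV_imp_deriv) (auto intro!: derivative_eq_intros simp: algebra_simps)
  have "hermite1 (Suc k) = creation1 (hermite1 k)"
    by (simp add: hermite1_def)
  also have "\<dots> = (\<lambda>t. poly (- pderiv p + [:0, 2:] * p) t * exp (- t\<^sup>2 / 2))"
    unfolding p creation1_def d by (simp add: fun_eq_iff algebra_simps)
  finally show ?case by blast
qed

lemma hermite1_has_deriv: "(hermite1 k has_real_derivative deriv (hermite1 k) t) (at t)"
proof -
  obtain p where p: "hermite1 k = (\<lambda>t. poly p t * exp (- t\<^sup>2 / 2))"
    using hermite1_poly by blast
  have "hermite1 k field_differentiable at t"
    unfolding p field_differentiable_def by (rule exI) (auto intro!: derivative_eq_intros)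
  then show ?thesis
    by (rule field_differentiable_derivI)
qed

lemma creation_prod:
  fixes a :: "'d::finite \<Rightarrow> nat"
  shows "creation j (\<lambda>x. c * (\<Prod>i\<in>UNIV. hermite1 (a i) (x $ i)))
    = (\<lambda>x. c * (\<Prod>i\<in>UNIV. hermite1 ((a(j := Suc (a j))) i) (x $ i)))"
proof
  fix x :: "real ^ 'd"
  let ?R = "\<Prod>i\<in>UNIV - {j}. hermite1 (a i) (x $ i)"
  have split: "(\<Prod>i\<in>UNIV. g i) = g j * (\<Prod>i\<in>UNIV - {j}. g i)" for g :: "'d \<Rightarrow> real"
    by (simp add: prod.remove)
  have line: "(\<lambda>t. c * (\<Prod>i\<in>UNIV. hermite1 (a i) ((x + t *\<^sub>R axis j 1) $ i)))
      = (\<lambda>t. c * (hermite1 (a j) (x $ j + t) * ?R))"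
    by (rule ext, subst split) (auto simp: axis_def intro!: prod.cong)
  have "((\<lambda>t. hermite1 (a j) (x $ j + t)) has_real_derivative deriv (hermite1 (a j)) (x $ j)) (at 0)"
    using hermite1_has_deriv[of "a j" "x $ j"] DERIV_shift[of "hermite1 (a j)" _ 0 "x $ j"]
    by (simp add: add.commute)
  then have "((\<lambda>t. c * (hermite1 (a j) (x $ j + t) * ?R)) has_real_derivative
      c * (deriv (hermite1 (a j)) (x $ j) * ?R)) (at 0)"
    by (intro DERIV_cmult DERIV_cmult_right)
  then have d: "deriv (\<lambda>t. c * (hermite1 (a j) (x $ j + t) * ?R)) 0
      = c * (deriv (hermite1 (a j)) (x $ j) * ?R)"
    by (rule DERIV_imp_deriv)
  have R: "(\<Prod>i\<in>UNIV - {j}. hermite1 ((a(j := Suc (a j))) i) (x $ i)) = ?R"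
    by (rule prod.cong) auto
  have S: "hermite1 (Suc (a j)) (x $ j)
      = - deriv (hermite1 (a j)) (x $ j) + x $ j * hermite1 (a j) (x $ j)"
    by (simp add: hermite1_def creation1_def)
  show "creation j (\<lambda>x. c * (\<Prod>i\<in>UNIV. hermite1 (a i) (x $ i))) x
    = c * (\<Prod>i\<in>UNIV. hermite1 ((a(j := Suc (a j))) i) (x $ i))"
    unfolding creation_def line d split[of "\<lambda>i. hermite1 ((a(j := Suc (a j))) i) (x $ i)"] R
      split[of "\<lambda>i. hermite1 (a i) (x $ i)"]
    by (simp add: S algebra_simps)
qed

lemma creation_power_prod:
  "(creation j ^^ k) (\<lambda>x. c * (\<Prod>i\<in>UNIV. hermite1 (a i) (x $ i)))
    = (\<lambda>x. c * (\<Prod>i\<in>UNIV. hermite1 ((a(j := a j + k)) i) (x $ i)))"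
  by (induction k) (simp_all only: funpow.simps creation_prod o_apply fun_upd_same fun_upd_upd
      add_Suc_right, simp_all)

lemma hermite0_prod:
  "hermite0 = (\<lambda>x::real ^ 'd::finite. pi powr (- real CARD('d) / 4) * (\<Prod>i\<in>UNIV. hermite1 0 (x $ i)))"
proof
  fix x :: "real ^ 'd"
  have "(norm x)\<^sup>2 = (\<Sum>i\<in>UNIV. (x $ i)\<^sup>2)"
    by (simp add: norm_vec_def L2_set_def sum_nonneg)
  then show "hermite0 x = pi powr (- real CARD('d) / 4) * (\<Prod>i\<in>UNIV. hermite1 0 (x $ i))"
    by (simp add: hermite0_def hermite1_def exp_sum[symmetric] sum_negf sum_divide_distrib)
qed

lemma creation_fold:
  fixes n :: "nat ^ 'd::finite"
  shows "Finite_Set.fold (\<lambda>j. creation j ^^ (n $ j)) hermite0 UNIV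
    = (\<lambda>x. pi powr (- real CARD('d) / 4) * (\<Prod>i\<in>UNIV. hermite1 (n $ i) (x $ i)))"
proof -
  let ?P = "\<lambda>A x. pi powr (- real CARD('d) / 4)
      * (\<Prod>i\<in>UNIV. hermite1 ((\<lambda>i. if i \<in> A then n $ i else 0) i) (x $ i))"
  have unique: "u = ?P A" if "fold_graph (\<lambda>j. creation j ^^ (n $ j)) hermite0 A u" for A u
    using that
  proof induction
    case emptyI
    show ?case by (simp add: hermite0_prod)
  next
    case (insertI j A u)
    have upd: "(\<lambda>i. if i \<in> A then n $ i else 0)
        (j := (if j \<in> A then n $ j else 0) + n $ j) = (\<lambda>i. if i \<in> insert j A then n $ i else 0)"
      using insertI.hyps by auto
    show ?case
      unfolding insertI.IH creation_power_prod upd ..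
  qed
  have "\<exists>u. fold_graph (\<lambda>j. creation j ^^ (n $ j)) hermite0 UNIV u"
    by (rule finite_imp_fold_graph) simp
  then obtain u where u: "fold_graph (\<lambda>j. creation j ^^ (n $ j)) hermite0 UNIV u" ..
  then have "fold_graph (\<lambda>j. creation j ^^ (n $ j)) hermite0 UNIV (?P UNIV)"
    using unique[OF u] by simp
  with unique have "(THE u. fold_graph (\<lambda>j. creation j ^^ (n $ j)) hermite0 UNIV u) = ?P UNIV"
    by (intro the_equality[where P = "fold_graph (\<lambda>j. creation j ^^ (n $ j)) hermite0 UNIV"])
  then have "Finite_Set.fold (\<lambda>j. creation j ^^ (n $ j)) hermite0 UNIV = ?P UNIV"
    by (simp add: Finite_Set.fold_def)
  then show ?thesis by simp
qed

type_synonym 'd freq = "(nat ^ 'd) \<times> (nat ^ 'd) \<times> real"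

type_synonym 'd freq0 = "(real ^ 'd) \<times> (int ^ 'd)"

definition tilde_H :: "'d::finite freq set" where
  "tilde_H = {(n, m, l). l \<noteq> 0}"

definition hat_H0 :: "'d::finite freq0 set" where
  "hat_H0 = {(x, k). (\<forall>j. x $ j \<le> 0) \<or> (\<forall>j. 0 \<le> x $ j)}"

fun wigner :: "'d::finite freq \<Rightarrow> (real ^ 'd) \<times> (real ^ 'd) \<Rightarrow> complex" where
  "wigner (n, m, l) (y, \<eta>) =
     (LINT z|lebesgue. cis (2 * l * (\<eta> \<bullet> z))
        * of_real (hermite_scaled n l (y + z)) * of_real (hermite_scaled m l (- y + z)))"

fun fourier_heis :: "('d::finite heis \<Rightarrow> complex) \<Rightarrow> 'd freq \<Rightarrow> complex" where
  "fourier_heis f (n, m, l) =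
     (LINT (Y, s)|lebesgue. cnj (cis (s * l) * wigner (n, m, l) Y) * f (Y, s))"

definition vec_nat :: "nat ^ 'd \<Rightarrow> real ^ 'd" where
  "vec_nat n = (\<chi> j. real (n $ j))"

definition vec_int :: "int ^ 'd \<Rightarrow> real ^ 'd" where
  "vec_int k = (\<chi> j. real_of_int (k $ j))"

definition norm_l1 :: "real ^ 'd::finite \<Rightarrow> real" where
  "norm_l1 x = (\<Sum>j\<in>UNIV. \<bar>x $ j\<bar>)"

fun hat_dist :: "'d::finite freq + 'd freq0 \<Rightarrow> 'd freq + 'd freq0 \<Rightarrow> real" where
  "hat_dist (Inl (n, m, l)) (Inl (n', m', l')) =
     norm_l1 (l *\<^sub>R vec_nat (n + m) - l' *\<^sub>R vec_nat (n' + m'))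
     + norm_l1 ((vec_nat m - vec_nat n) - (vec_nat m' - vec_nat n')) + \<bar>l - l'\<bar>"
| "hat_dist (Inl (n, m, l)) (Inr (x, k)) =
     norm_l1 (l *\<^sub>R vec_nat (n + m) - x) + norm_l1 (vec_nat m - vec_nat n - vec_int k) + \<bar>l\<bar>"
| "hat_dist (Inr (x, k)) (Inl (n, m, l)) =
     norm_l1 (l *\<^sub>R vec_nat (n + m) - x) + norm_l1 (vec_nat m - vec_nat n - vec_int k) + \<bar>l\<bar>"
| "hat_dist (Inr (x, k)) (Inr (x', k')) =
     norm_l1 (x - x') + norm_l1 (vec_int k - vec_int k')"

typedef (overloaded) ('d::finite) hat_H = "tilde_H <+> hat_H0 :: ('d freq + 'd freq0) set"
proof
  show "Inr (0, 0) \<in> tilde_H <+> hat_H0"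
    by (auto simp: hat_H0_def)
qed

definition reg :: "'d::finite freq \<Rightarrow> 'd hat_H" where
  "reg w = Abs_hat_H (Inl w)"

definition bdry :: "'d::finite freq0 \<Rightarrow> 'd hat_H" where
  "bdry w = Abs_hat_H (Inr w)"

text \<open>For the metric axioms: \<open>hat_dist\<close> is the \<open>\<ell>\<^sup>1\<close> distance pulled back along this map.\<close>

fun hat_embed :: "'d::finite freq + 'd freq0 \<Rightarrow> (real ^ 'd) \<times> (real ^ 'd) \<times> real" where
  "hat_embed (Inl (n, m, l)) = (l *\<^sub>R vec_nat (n + m), vec_nat m - vec_nat n, l)"
| "hat_embed (Inr (x, k)) = (x, vec_int k, 0)"

lemma hat_dist_embed:
  "hat_dist p q =
     norm_l1 (fst (hat_embed p) - fst (hat_embed q))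
     + norm_l1 (fst (snd (hat_embed p)) - fst (snd (hat_embed q)))
     + \<bar>snd (snd (hat_embed p)) - snd (snd (hat_embed q))\<bar>"
  by (cases "(p, q)" rule: hat_dist.cases) (auto simp: norm_l1_def abs_minus_commute)

lemma norm_l1_nonneg: "0 \<le> norm_l1 x"
  by (simp add: norm_l1_def sum_nonneg)

lemma norm_l1_eq_0_iff: "norm_l1 x = 0 \<longleftrightarrow> x = 0"
  by (simp add: norm_l1_def sum_nonneg_eq_0_iff vec_eq_iff)

lemma norm_l1_triangle: "norm_l1 (x - y) \<le> norm_l1 (x - z) + norm_l1 (y - z)"
  unfolding norm_l1_def sum.distrib[symmetric] by (rule sum_mono) auto

lemma hat_embed_inj:
  assumes "p \<in> tilde_H <+> hat_H0" "q \<in> tilde_H <+> hat_H0" "hat_embed p = hat_embed q"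
  shows "p = q"
proof (cases "(p, q)" rule: hat_dist.cases)
  case (1 n m l n' m' l')
  have l: "l = l'" "l \<noteq> 0"
    using assms 1 by (auto simp: tilde_H_def)
  have "n $ j = n' $ j \<and> m $ j = m' $ j" for j
  proof -
    have "l * (real (n $ j) + real (m $ j)) = l * (real (n' $ j) + real (m' $ j))"
      using assms(3) 1 l by (auto simp: vec_nat_def vec_eq_iff)
    moreover have "real (m $ j) - real (n $ j) = real (m' $ j) - real (n' $ j)"
      using assms(3) 1 l by (auto simp: vec_nat_def vec_eq_iff)
    ultimately show ?thesis using l by auto
  qed
  with 1 l show ?thesis by (simp add: vec_eq_iff)
qed (use assms in \<open>auto simp: tilde_H_def vec_int_def vec_eq_iff\<close>)

instantiation hat_H :: (finite) metric_space
begin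

definition dist_hat_H :: "'a hat_H \<Rightarrow> 'a hat_H \<Rightarrow> real" where
  "dist_hat_H p q = hat_dist (Rep_hat_H p) (Rep_hat_H q)"

definition uniformity_hat_H :: "('a hat_H \<times> 'a hat_H) filter" where
  "uniformity_hat_H = (INF e\<in>{0 <..}. principal {(p, q). dist p q < e})"

definition open_hat_H :: "'a hat_H set \<Rightarrow> bool" where
  "open_hat_H U = (\<forall>p\<in>U. eventually (\<lambda>(p', q). p' = p \<longrightarrow> q \<in> U) uniformity)"

instance
proof
  fix p q r :: "'a hat_H"
  show "dist p q = 0 \<longleftrightarrow> p = q"
  proof
    assume "dist p q = 0"
    then have "hat_embed (Rep_hat_H p) = hat_embed (Rep_hat_H q)"
      by (auto simp: dist_hat_H_def hat_dist_embed norm_l1_nonneg add_nonneg_eq_0_iff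
          norm_l1_eq_0_iff prod_eq_iff)
    then show "p = q"
      using hat_embed_inj Rep_hat_H Rep_hat_H_inject by blast
  next
    assume "p = q"
    then show "dist p q = 0"
      by (simp add: dist_hat_H_def hat_dist_embed norm_l1_eq_0_iff)
  qed
  show "dist p q \<le> dist p r + dist q r"
    unfolding dist_hat_H_def hat_dist_embed
    by (smt (verit) norm_l1_triangle)
qed (simp_all add: uniformity_hat_H_def open_hat_H_def)

end

definition C0 :: "('a::topological_space \<Rightarrow> complex) set" where
  "C0 = {F. continuous_on UNIV F \<and> (\<forall>\<epsilon>>0. \<exists>K. compact K \<and> (\<forall>w. w \<notin> K \<longrightarrow> norm (F w) < \<epsilon>))}"

text \<open>Only meaningful for bounded functions, in particular on \<open>C0\<close>.\<close>

definition sup_norm :: "('a \<Rightarrow> complex) \<Rightarrow> real" where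
  "sup_norm F = (SUP w. norm (F w))"

definition continuous_extension :: "('d::finite heis \<Rightarrow> complex) \<Rightarrow> ('d hat_H \<Rightarrow> complex) \<Rightarrow> bool" where
  "continuous_extension f F \<longleftrightarrow>
     continuous_on UNIV F \<and> (\<forall>w\<in>tilde_H. F (reg w) = fourier_heis f w)"

definition fourier_ext :: "('d::finite heis \<Rightarrow> complex) \<Rightarrow> 'd hat_H \<Rightarrow> complex" where
  "fourier_ext f = (THE F. continuous_extension f F)"

definition kernel1 :: "real \<Rightarrow> int \<Rightarrow> real \<Rightarrow> real \<Rightarrow> complex" where
  "kernel1 x k y \<eta> =
     1 / (2 * pi) * (LINT z:{-pi..pi}|lebesgue.
       cis (2 * \<bar>x\<bar> powr (1 / 2) * (y * sin z + \<eta> * sgn x * cos z) + of_int k * z))"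

fun heis_kernel :: "'d::finite freq0 \<Rightarrow> (real ^ 'd) \<times> (real ^ 'd) \<Rightarrow> complex" where
  "heis_kernel (x, k) (y, \<eta>) = (\<Prod>j\<in>UNIV. kernel1 (x $ j) (k $ j) (y $ j) (\<eta> $ j))"

end

theory Submission
  imports Defs "HOL-Probability.Probability"
begin

text \<open>After the rescaling \<open>p = \<bar>\<lambda>\<bar>\<^sup>1\<^sup>/\<^sup>2 y\<close>, \<open>q = sgn \<lambda> \<bar>\<lambda>\<bar>\<^sup>1\<^sup>/\<^sup>2 \<eta>\<close> the function \<open>\<W>\<close> is a product of
  one-variable matrix coefficients \<open>wig1 n m p q\<close>, in which \<open>\<lambda>\<close> no longer occurs. The creation and
  annihilation operators, together with one integration by parts, give two ladder relations
  (\<open>wig1_Suc_left\<close>, \<open>wig1_Suc_right\<close>) between neighbouring indices. They determine all \<open>wig1 n m\<close> from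
  the Gaussian \<open>wig1 0 0\<close>, and they carry the whole proof.

  \<^emph>\<open>Continuity up to the boundary.\<close> Along a ray \<open>t (y, \<eta>)\<close> the derivative of \<open>wig1 n m\<close> is a
  combination of \<open>wig1 (n - 1) m\<close> and \<open>wig1 (n + 1) m\<close> with coefficients proportional to
  \<open>(2n\<bar>\<lambda>\<bar>)\<^sup>1\<^sup>/\<^sup>2\<close> and \<open>((2n + 2)\<bar>\<lambda>\<bar>)\<^sup>1\<^sup>/\<^sup>2\<close>. Since
  \<open>2n\<bar>\<lambda>\<bar> = \<bar>\<lambda>\<bar>(n + m) - \<bar>\<lambda>\<bar>(m - n)\<close>, the Taylor coefficients at the origin are continuous functions of
  \<open>r = \<bar>\<lambda>\<bar>(n + m)\<close> and \<open>\<mu> = \<bar>\<lambda>\<bar>\<close> for fixed \<open>k = m - n\<close>, also at \<open>\<mu> = 0\<close>. As all matrix coefficients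
  are bounded by 1, they are represented by their Taylor series \<open>phi\<close> (\<open>wig1_eq_phi\<close>), whose terms
  have a summable bound that is locally uniform in these parameters (\<open>tendsto_phi\<close>). At \<open>\<mu> = 0\<close> the same coefficients are obtained by expanding the
  exponential in the definition of \<open>\<K>\<close>, because multiplication by \<open>cis (\<plusminus> z)\<close> shifts the Fourier
  index \<open>k\<close> (\<open>kernel1_eq_phi\<close>). So \<open>\<W>\<close> and \<open>\<K>\<close> form one function that is bounded by 1 and
  continuous on the completed frequency space, and dominated convergence makes the transform of an
  integrable function continuous (\<open>continuous_hat_transform\<close>).

  \<^emph>\<open>Decay.\<close> Solved for one index, the derivative formula \<open>wig1_has_vector_derivative\<close> expresses \<open>(\<bar>\<lambda>\<bar> n)\<^sup>1\<^sup>/\<^sup>2 \<W>\<close> and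
  \<open>(\<bar>\<lambda>\<bar> m)\<^sup>1\<^sup>/\<^sup>2 \<W>\<close> through first derivatives of bounded functions and, locally in \<open>(y, \<eta>)\<close>, terms of size \<open>\<bar>\<lambda>\<bar>\<close>, and
  \<open>(n - m) \<W>\<close> through the rotation field \<open>\<eta> \<partial>\<^sub>y - y \<partial>\<^sub>\<eta>\<close> applied to \<open>\<W>\<close>. Integrated over a rectangle the
  derivatives leave boundary terms, so the transform of the indicator of a box decays in
  \<open>\<lambda>(n + m)\<close> and in \<open>m - n\<close>; integration in \<open>s\<close> gives decay in \<open>\<lambda>\<close> (\<open>vanishes_cbox\<close>). Indicators of
  boxes span a dense subspace of \<open>L\<^sup>1\<close> and the transform is bounded by the \<open>L\<^sup>1\<close> norm, so the decay
  holds for every integrable function (\<open>vanishes_integrable\<close>).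

  \<^emph>\<open>The frequency space.\<close> The isometric image of the frequency space under \<open>hat_embed\<close> is closed,
  so closed balls are compact (\<open>compact_cball_hat_H\<close>), and the regular points are dense
  (\<open>reg_dense\<close>). Density gives uniqueness of the extension and transfers the decay to the boundary
  points.\<close>

section \<open>Hermite functions of one variable\<close>

lemma hermite1_Suc: "hermite1 (Suc n) t = - deriv (hermite1 n) t + t * hermite1 n t"
  by (simp add: hermite1_def creation1_def)

text \<open>The induction step is the commutation of \<open>d/dt + t\<close> with the creation operator: their commutator
  is twice the identity, and each creation operator contributes once.\<close>
lemma hermite1_annihilation:
  "deriv (hermite1 n) t + t * hermite1 n t = 2 * real n * hermite1 (n - 1) t"
proof (induction n arbitrary: t)
  case 0
  have "(hermite1 0 has_real_derivative - t * hermite1 0 t) (at t)"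
    unfolding hermite1_def by (auto intro!: derivative_eq_intros)
  then show ?case by (simp add: DERIV_imp_deriv)
next
  case (Suc n)
  have d: "deriv (hermite1 n) u = 2 * real n * hermite1 (n - 1) u - u * hermite1 n u" for u
    using Suc.IH[of u] by simp
  have eq: "hermite1 (Suc n) = (\<lambda>u. 2 * u * hermite1 n u - 2 * real n * hermite1 (n - 1) u)"
    by (simp add: fun_eq_iff hermite1_Suc d)
  have "(hermite1 (Suc n) has_real_derivative
      2 * hermite1 n t + 2 * t * deriv (hermite1 n) t - 2 * real n * deriv (hermite1 (n - 1)) t) (at t)"
    unfolding eq by (auto intro!: derivative_eq_intros hermite1_has_deriv)
  then have D: "deriv (hermite1 (Suc n)) t =
      2 * hermite1 n t + 2 * t * deriv (hermite1 n) t - 2 * real n * deriv (hermite1 (n - 1)) t"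
    by (rule DERIV_imp_deriv)
  have S: "real n * hermite1 n t = real n * (- deriv (hermite1 (n - 1)) t + t * hermite1 (n - 1) t)"
    by (cases n) (simp_all add: hermite1_Suc)
  have "deriv (hermite1 (Suc n)) t + t * hermite1 (Suc n) t
      = 2 * hermite1 n t + 2 * (real n * hermite1 n t)"
    unfolding D S by (simp add: hermite1_Suc d algebra_simps)
  then show ?case by (simp add: algebra_simps)
qed

definition hermite_unit :: "nat \<Rightarrow> real \<Rightarrow> real" where
  "hermite_unit n t = hermite1 n t / sqrt (2 ^ n * fact n * sqrt pi)"

lemma sqrt_fact_Suc:
  "sqrt (2 ^ Suc n * fact (Suc n) * c) = sqrt (2 * (real n + 1)) * sqrt (2 ^ n * fact n * c)"
  by (simp flip: real_sqrt_mult add: algebra_simps)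

lemma hermite_unit_has_deriv:
  "(hermite_unit n has_real_derivative
     sqrt (2 * n) * hermite_unit (n - 1) t - t * hermite_unit n t) (at t)"
proof -
  have "(hermite_unit n has_real_derivative deriv (hermite1 n) t / sqrt (2 ^ n * fact n * sqrt pi)) (at t)"
    unfolding hermite_unit_def[abs_def] by (intro DERIV_cdivide hermite1_has_deriv)
  moreover have "deriv (hermite1 n) t = 2 * real n * hermite1 (n - 1) t - t * hermite1 n t"
    using hermite1_annihilation[of n t] by simp
  moreover have "2 * real n * hermite1 (n - 1) t / sqrt (2 ^ n * fact n * sqrt pi)
      = sqrt (2 * n) * hermite_unit (n - 1) t"
  proof (cases n)
    case (Suc k)
    have cancel: "s * s * x / (s * c) = s * (x / c)" if "s \<noteq> 0" for s x c :: real
      using that by simp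
    define s where "s = sqrt (2 * (real k + 1))"
    have "2 * real (Suc k) = s * s" "sqrt (2 * real (Suc k)) = s" "s \<noteq> 0"
      by (simp_all add: s_def algebra_simps)
    then show ?thesis
      unfolding Suc hermite_unit_def sqrt_fact_Suc s_def[symmetric] by (simp add: cancel)
  qed simp
  ultimately show ?thesis
    by (simp add: hermite_unit_def diff_divide_distrib)
qed

lemma hermite_unit_Suc:
  "sqrt (2 * (real n + 1)) * hermite_unit (Suc n) t
     = 2 * t * hermite_unit n t - sqrt (2 * n) * hermite_unit (n - 1) t"
proof -
  let ?c = "sqrt (2 ^ n * fact n * sqrt pi)"
  have "(hermite_unit n has_real_derivative deriv (hermite1 n) t / ?c) (at t)"
    unfolding hermite_unit_def[abs_def] by (intro DERIV_cdivide hermite1_has_deriv)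
  then have d: "deriv (hermite1 n) t / ?c = sqrt (2 * n) * hermite_unit (n - 1) t - t * hermite_unit n t"
    using hermite_unit_has_deriv DERIV_unique by blast
  have "sqrt (2 * (real n + 1)) * hermite_unit (Suc n) t = hermite1 (Suc n) t / ?c"
    unfolding hermite_unit_def[of "Suc n"] sqrt_fact_Suc by simp
  also have "\<dots> = - (deriv (hermite1 n) t / ?c) + t * hermite_unit n t"
    by (simp add: hermite1_Suc hermite_unit_def add_divide_distrib diff_divide_distrib)
  finally show ?thesis unfolding d by simp
qed

lemma continuous_hermite_unit [continuous_intros]:
  "continuous_on A f \<Longrightarrow> continuous_on A (\<lambda>x. hermite_unit n (f x))"
  by (rule continuous_on_compose2[of UNIV "hermite_unit n"])
    (auto intro!: continuous_at_imp_continuous_on DERIV_isCont hermite_unit_has_deriv)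

lemma hermite_unit_measurable [measurable]: "hermite_unit n \<in> borel_measurable borel"
  by (intro borel_measurable_continuous_onI continuous_intros)

text \<open>Integrability and decay at infinity are thereby reduced to the moments of the normal
  distribution.\<close>
lemma hermite_unit_sum_monomials:
  obtains c N where "hermite_unit n = (\<lambda>t. \<Sum>i\<le>N. c i * (std_normal_density t * t ^ i))"
proof -
  obtain p where p: "hermite1 n = (\<lambda>t. poly p t * exp (- t\<^sup>2 / 2))"
    using hermite1_poly by blast
  let ?C = "sqrt (2 * pi) / sqrt (2 ^ n * fact n * sqrt pi)"
  have "hermite_unit n = (\<lambda>t. \<Sum>i\<le>degree p. (?C * coeff p i) * (std_normal_density t * t ^ i))"
    unfolding hermite_unit_def[abs_def] p poly_altdef std_normal_density_def
    by (auto simp: fun_eq_iff sum_distrib_right sum_divide_distrib intro!: sum.cong)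
  then show thesis by (rule that)
qed

lemma integrable_hermite_unit: "integrable lborel (hermite_unit n)"
proof -
  obtain c N where "hermite_unit n = (\<lambda>t. \<Sum>i\<le>N. c i * (std_normal_density t * t ^ i))"
    by (rule hermite_unit_sum_monomials)
  then show ?thesis
    by (simp only:) (intro Bochner_Integration.integrable_sum integrable_mult_right integrable_std_normal_moment)
qed

lemma hermite_unit_tendsto_0:
  "(hermite_unit n \<longlongrightarrow> 0) at_top" "(hermite_unit n \<longlongrightarrow> 0) at_bot"
proof -
  obtain c N where h: "hermite_unit n = (\<lambda>t. \<Sum>i\<le>N. c i * (std_normal_density t * t ^ i))"
    by (rule hermite_unit_sum_monomials)
  have "((\<lambda>t. std_normal_density t * t ^ i) \<longlongrightarrow> 0) at_top"
    "((\<lambda>t. std_normal_density t * t ^ i) \<longlongrightarrow> 0) at_bot" for i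
    unfolding std_normal_density_def by real_asymp+
  then show "(hermite_unit n \<longlongrightarrow> 0) at_top" "(hermite_unit n \<longlongrightarrow> 0) at_bot"
    unfolding h by (auto intro!: tendsto_null_sum tendsto_mult_right_zero)
qed

lemma bounded_hermite_unit: "\<exists>B. \<forall>t. \<bar>hermite_unit n t\<bar> \<le> B"
proof -
  have "eventually (\<lambda>t. \<bar>hermite_unit n t\<bar> < 1) at_top" "eventually (\<lambda>t. \<bar>hermite_unit n t\<bar> < 1) at_bot"
    using hermite_unit_tendsto_0[of n] by (auto dest!: tendstoD[where e=1])
  then obtain a b where ab: "\<And>t. t \<ge> b \<Longrightarrow> \<bar>hermite_unit n t\<bar> < 1" "\<And>t. t \<le> a \<Longrightarrow> \<bar>hermite_unit n t\<bar> < 1"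
    by (auto simp: eventually_at_top_linorder eventually_at_bot_linorder)
  have "bounded (hermite_unit n ` {a..b})"
    by (intro compact_imp_bounded compact_continuous_image continuous_intros) auto
  then obtain B where B: "\<forall>t\<in>{a..b}. \<bar>hermite_unit n t\<bar> \<le> B"
    unfolding bounded_iff by auto
  have "\<bar>hermite_unit n t\<bar> \<le> max 1 B" for t
    using ab(1)[of t] ab(2)[of t] B[rule_format, of t] by (cases "t \<le> a"; cases "t \<ge> b") auto
  then show ?thesis by blast
qed

section \<open>Matrix coefficients of one variable\<close>

text \<open>One factor of \<open>\<W>\<close> in the rescaled variables; it is the matrix coefficient of the Weyl operator
  \<open>exp (2 p d/dz + 2 i q z)\<close> between the Hermite functions of degrees \<open>n\<close> and \<open>m\<close>.\<close>
definition wig1 :: "nat \<Rightarrow> nat \<Rightarrow> real \<Rightarrow> real \<Rightarrow> complex" where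
  "wig1 n m p q = (LINT z|lborel. cis (2 * q * z) * of_real (hermite_unit n (p + z) * hermite_unit m (z - p)))"

lemma integrable_hermite_unit_shift: "integrable lborel (\<lambda>z. hermite_unit n (p + z))"
  using lborel_integrable_real_affine[OF integrable_hermite_unit, of 1 n p] by simp

lemma integrable_hermite_unit_prod:
  "integrable lborel (\<lambda>z. hermite_unit n (p + z) * hermite_unit m (z - p))"
proof -
  obtain B where B: "\<And>t. \<bar>hermite_unit m t\<bar> \<le> B" using bounded_hermite_unit by blast
  have "integrable lborel (\<lambda>z. B * hermite_unit n (p + z))"
    by (intro integrable_mult_right integrable_hermite_unit_shift)
  then show ?thesis
  proof (rule Bochner_Integration.integrable_bound)
    show "AE z in lborel. norm (hermite_unit n (p + z) * hermite_unit m (z - p)) \<le> norm (B * hermite_unit n (p + z))"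
    proof (rule AE_I2)
      fix z
      have "\<bar>hermite_unit m (z - p)\<bar> \<le> \<bar>B\<bar>" using B[of "z - p"] by linarith
      then show "norm (hermite_unit n (p + z) * hermite_unit m (z - p)) \<le> norm (B * hermite_unit n (p + z))"
        by (simp add: abs_mult mult.commute mult_right_mono)
    qed
  qed simp
qed

lemma cis_measurable [measurable]: "cis \<in> borel_measurable borel"
  by (intro borel_measurable_continuous_onI continuous_intros)

lemma integrable_wig1:
  "integrable lborel (\<lambda>z. cis (2 * q * z) * complex_of_real (hermite_unit n (p + z) * hermite_unit m (z - p)))"
proof (rule Bochner_Integration.integrable_bound[OF integrable_hermite_unit_prod[of n p m]])
qed (auto simp: norm_mult)

lemma integral_total_derivative_eq_0:
  fixes F f :: "real \<Rightarrow> complex"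
  assumes "\<And>x. (F has_vector_derivative f x) (at x)" "\<And>x. isCont f x" "integrable lborel f"
    "(F \<longlongrightarrow> 0) at_top" "(F \<longlongrightarrow> 0) at_bot"
  shows "(LINT z|lborel. f z) = 0"
proof -
  have "(LBINT x=-\<infinity>..\<infinity>. f x) = 0 - 0"
  proof (rule interval_integral_FTC_integrable)
    show "set_integrable lborel (einterval (-\<infinity>) \<infinity>) f"
      using assms(3) by (simp add: set_integrable_def)
    show "((F \<circ> real_of_ereal) \<longlongrightarrow> 0) (at_right (- \<infinity>))"
      using assms(5) by (simp add: at_right_MInf filterlim_filtermap comp_def)
    show "((F \<circ> real_of_ereal) \<longlongrightarrow> 0) (at_left \<infinity>)"
      using assms(4) by (simp add: at_left_PInf filterlim_filtermap comp_def)
  qed (use assms in auto)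
  then show ?thesis
    by (simp add: interval_lebesgue_integral_def set_lebesgue_integral_def)
qed

lemma wig1_has_integral:
  "has_bochner_integral lborel
     (\<lambda>z. cis (2 * q * z) * complex_of_real (hermite_unit n (p + z) * hermite_unit m (z - p))) (wig1 n m p q)"
  unfolding wig1_def by (intro has_bochner_integral_integrable integrable_wig1)

text \<open>The two Hermite functions are evaluated at points whose difference is \<open>2 p\<close>, and the three-term
  recurrence expresses multiplication by each of these points.\<close>
lemma wig1_position_relation:
  "4 * of_real p * wig1 n m p q =
     of_real (sqrt (2 * (real n + 1))) * wig1 (Suc n) m p q + of_real (sqrt (2 * n)) * wig1 (n - 1) m p q
     - of_real (sqrt (2 * (real m + 1))) * wig1 n (Suc m) p q - of_real (sqrt (2 * m)) * wig1 n (m - 1) p q"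
    (is "_ = ?R")
proof -
  let ?e = "\<lambda>n m z. cis (2 * q * z) * complex_of_real (hermite_unit n (p + z) * hermite_unit m (z - p))"
  have "has_bochner_integral lborel (\<lambda>z. of_real (sqrt (2 * (real n + 1))) * ?e (Suc n) m z
      + of_real (sqrt (2 * n)) * ?e (n - 1) m z
      - of_real (sqrt (2 * (real m + 1))) * ?e n (Suc m) z - of_real (sqrt (2 * m)) * ?e n (m - 1) z) ?R"
    by (intro has_bochner_integral_add has_bochner_integral_diff has_bochner_integral_mult_right
        wig1_has_integral)
  moreover have "of_real (sqrt (2 * (real n + 1))) * ?e (Suc n) m z
      + of_real (sqrt (2 * n)) * ?e (n - 1) m z
      - of_real (sqrt (2 * (real m + 1))) * ?e n (Suc m) z - of_real (sqrt (2 * m)) * ?e n (m - 1) z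
      = 4 * of_real p * ?e n m z" for z
  proof -
    have 1: "sqrt (2 * n) * hermite_unit (n - 1) (p + z) =
        2 * (p + z) * hermite_unit n (p + z) - sqrt (2 * (real n + 1)) * hermite_unit (Suc n) (p + z)"
      unfolding hermite_unit_Suc by simp
    have 2: "sqrt (2 * m) * hermite_unit (m - 1) (z - p) =
        2 * (z - p) * hermite_unit m (z - p) - sqrt (2 * (real m + 1)) * hermite_unit (Suc m) (z - p)"
      unfolding hermite_unit_Suc by simp
    have "sqrt (2 * (real n + 1)) * (hermite_unit (Suc n) (p + z) * hermite_unit m (z - p))
      + (sqrt (2 * n) * hermite_unit (n - 1) (p + z)) * hermite_unit m (z - p)
      - sqrt (2 * (real m + 1)) * (hermite_unit n (p + z) * hermite_unit (Suc m) (z - p))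
      - hermite_unit n (p + z) * (sqrt (2 * m) * hermite_unit (m - 1) (z - p))
      = 4 * p * (hermite_unit n (p + z) * hermite_unit m (z - p))"
      unfolding 1 2 by (simp add: algebra_simps)
    from arg_cong[OF this, of "\<lambda>x. cis (2 * q * z) * complex_of_real x"]
    show ?thesis by (simp add: algebra_simps del: of_real_mult of_real_sqrt) (simp add: algebra_simps)
  qed
  ultimately have "has_bochner_integral lborel (\<lambda>z. 4 * of_real p * ?e n m z) ?R"
    by simp
  moreover have "has_bochner_integral lborel (\<lambda>z. 4 * of_real p * ?e n m z) (4 * of_real p * wig1 n m p q)"
    by (intro has_bochner_integral_mult_right wig1_has_integral)
  ultimately show ?thesis
    by (rule has_bochner_integral_eq[symmetric])
qed

text \<open>The integral of the total \<open>z\<close>-derivative of the integrand vanishes, and the derivative of a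
  Hermite function is half the difference of its two neighbours, weighted as in the three-term recurrence.\<close>
lemma wig1_momentum_relation:
  "4 * \<i> * of_real q * wig1 n m p q =
     of_real (sqrt (2 * (real n + 1))) * wig1 (Suc n) m p q - of_real (sqrt (2 * n)) * wig1 (n - 1) m p q
     + of_real (sqrt (2 * (real m + 1))) * wig1 n (Suc m) p q - of_real (sqrt (2 * m)) * wig1 n (m - 1) p q"
proof -
  let ?e = "\<lambda>n m z. cis (2 * q * z) * complex_of_real (hermite_unit n (p + z) * hermite_unit m (z - p))"
  define f where "f = (\<lambda>z. 4 * \<i> * of_real q * ?e n m z
      - of_real (sqrt (2 * (real n + 1))) * ?e (Suc n) m z + of_real (sqrt (2 * n)) * ?e (n - 1) m z
      - of_real (sqrt (2 * (real m + 1))) * ?e n (Suc m) z + of_real (sqrt (2 * m)) * ?e n (m - 1) z)"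
  define I where "I = 4 * \<i> * of_real q * wig1 n m p q
     - of_real (sqrt (2 * (real n + 1))) * wig1 (Suc n) m p q + of_real (sqrt (2 * n)) * wig1 (n - 1) m p q
     - of_real (sqrt (2 * (real m + 1))) * wig1 n (Suc m) p q + of_real (sqrt (2 * m)) * wig1 n (m - 1) p q"
  have I: "has_bochner_integral lborel f I"
    unfolding f_def I_def
    by (intro has_bochner_integral_add has_bochner_integral_diff has_bochner_integral_mult_right
        wig1_has_integral)
  have cont: "isCont f z" for z
    unfolding f_def
    by (rule continuous_on_interior[of UNIV]) (auto intro!: continuous_intros)
  have deriv: "((\<lambda>z. 2 * ?e n m z) has_vector_derivative f z) (at z)" for z
  proof -
    have cis: "((\<lambda>z. cis (2 * q * z)) has_vector_derivative 2 * of_real q * \<i> * cis (2 * q * z)) (at z)"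
    proof -
      have "((\<lambda>w. exp (\<i> * (2 * of_real q * w))) has_field_derivative
          2 * of_real q * \<i> * exp (\<i> * (2 * of_real q * of_real z))) (at (of_real z))"
        by (auto intro!: derivative_eq_intros)
      from has_vector_derivative_real_field[OF this] show ?thesis
        by (simp add: cis_conv_exp)
    qed
    have prod: "((\<lambda>z. hermite_unit n (p + z) * hermite_unit m (z - p)) has_real_derivative
       (sqrt (2 * n) * hermite_unit (n - 1) (p + z) - (p + z) * hermite_unit n (p + z)) * hermite_unit m (z - p)
       + hermite_unit n (p + z) * (sqrt (2 * m) * hermite_unit (m - 1) (z - p) - (z - p) * hermite_unit m (z - p))) (at z)"
      (is "(_ has_real_derivative ?d) _")
      by (auto intro!: derivative_eq_intros DERIV_chain'[OF _ hermite_unit_has_deriv])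
    have 1: "2 * ((p + z) * hermite_unit n (p + z)) = sqrt (2 * n) * hermite_unit (n - 1) (p + z)
         + sqrt (2 * (real n + 1)) * hermite_unit (Suc n) (p + z)"
      unfolding hermite_unit_Suc by simp
    have 2: "2 * ((z - p) * hermite_unit m (z - p)) = sqrt (2 * m) * hermite_unit (m - 1) (z - p)
         + sqrt (2 * (real m + 1)) * hermite_unit (Suc m) (z - p)"
      unfolding hermite_unit_Suc by simp
    have "2 * ?d = (2 * (sqrt (2 * n) * hermite_unit (n - 1) (p + z)) - 2 * ((p + z) * hermite_unit n (p + z))) * hermite_unit m (z - p)
       + hermite_unit n (p + z) * (2 * (sqrt (2 * m) * hermite_unit (m - 1) (z - p)) - 2 * ((z - p) * hermite_unit m (z - p)))"
      by (simp add: algebra_simps)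
    also have "\<dots> = sqrt (2 * n) * (hermite_unit (n - 1) (p + z) * hermite_unit m (z - p))
        - sqrt (2 * (real n + 1)) * (hermite_unit (Suc n) (p + z) * hermite_unit m (z - p))
        + sqrt (2 * m) * (hermite_unit n (p + z) * hermite_unit (m - 1) (z - p))
        - sqrt (2 * (real m + 1)) * (hermite_unit n (p + z) * hermite_unit (Suc m) (z - p))"
      unfolding 1 2 by (simp add: algebra_simps)
    finally have d2: "of_real (2 * ?d) = complex_of_real (
        sqrt (2 * n) * (hermite_unit (n - 1) (p + z) * hermite_unit m (z - p))
        - sqrt (2 * (real n + 1)) * (hermite_unit (Suc n) (p + z) * hermite_unit m (z - p))
        + sqrt (2 * m) * (hermite_unit n (p + z) * hermite_unit (m - 1) (z - p))
        - sqrt (2 * (real m + 1)) * (hermite_unit n (p + z) * hermite_unit (Suc m) (z - p)))"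
      by simp
    have "f z = 2 * (2 * of_real q * \<i> * cis (2 * q * z) * of_real (hermite_unit n (p + z) * hermite_unit m (z - p)))
       + cis (2 * q * z) * of_real (2 * ?d)"
      unfolding f_def d2 by (simp add: algebra_simps)
    moreover have "2 * A + c * of_real (2 * x) = 2 * (A + c * complex_of_real x)" for A c :: complex and x :: real
      by (simp add: algebra_simps)
    ultimately have d: "f z = 2 * (2 * of_real q * \<i> * cis (2 * q * z) * of_real (hermite_unit n (p + z) * hermite_unit m (z - p))
       + cis (2 * q * z) * of_real ?d)"
      by (simp only:)
    have "((\<lambda>z. complex_of_real (hermite_unit n (p + z) * hermite_unit m (z - p))) has_vector_derivative of_real ?d) (at z)"
      using prod has_vector_derivative_of_real has_real_derivative_iff_has_vector_derivative by blast
    from has_vector_derivative_mult[OF cis this]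
    have "((\<lambda>z. 2 * ?e n m z) has_vector_derivative 2 * (cis (2 * q * z) * of_real ?d + 2 * of_real q * \<i> * cis (2 * q * z) * of_real (hermite_unit n (p + z) * hermite_unit m (z - p)))) (at z)"
      by (rule has_vector_derivative_mult_right)
    then show ?thesis unfolding d by (simp only: add.commute)
  qed
  obtain B where B: "\<And>t. \<bar>hermite_unit m t\<bar> \<le> B" using bounded_hermite_unit by blast
  have lim: "((\<lambda>z. 2 * ?e n m z) \<longlongrightarrow> 0) F" if "((\<lambda>z. hermite_unit n (p + z)) \<longlongrightarrow> 0) F" for F
  proof (rule Lim_null_comparison)
    show "((\<lambda>z. 2 * (norm (hermite_unit n (p + z)) * B)) \<longlongrightarrow> 0) F"
      by (intro tendsto_mult_right_zero tendsto_mult_left_zero tendsto_norm_zero that)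
    show "\<forall>\<^sub>F z in F. norm (2 * ?e n m z) \<le> 2 * (norm (hermite_unit n (p + z)) * B)"
      by (intro always_eventually allI) (auto simp: norm_mult abs_mult intro!: mult_left_mono B)
  qed
  have "(LINT z|lborel. f z) = 0"
  proof (rule integral_total_derivative_eq_0[OF deriv cont])
    show "integrable lborel f" using I by (simp add: has_bochner_integral_iff)
    show "((\<lambda>z. 2 * ?e n m z) \<longlongrightarrow> 0) at_top"
      by (intro lim filterlim_compose[OF hermite_unit_tendsto_0(1)]) real_asymp
    show "((\<lambda>z. 2 * ?e n m z) \<longlongrightarrow> 0) at_bot"
      by (intro lim filterlim_compose[OF hermite_unit_tendsto_0(2)]) real_asymp
  qed
  then have "I = 0" using I by (simp add: has_bochner_integral_iff)
  then show ?thesis unfolding I_def by (simp add: algebra_simps)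
qed

text \<open>In the sum of the position and momentum relations the terms with \<open>Suc m\<close> and \<open>n - 1\<close> cancel, and
  in their difference those with \<open>Suc n\<close> and \<open>m - 1\<close>; what is left depends on \<open>p\<close> and \<open>q\<close> only through
  \<open>p + i q\<close> or its conjugate.\<close>
lemma wig1_Suc_left:
  "of_real (sqrt (2 * (real n + 1))) * wig1 (Suc n) m p q
     = 2 * Complex p q * wig1 n m p q + of_real (sqrt (2 * m)) * wig1 n (m - 1) p q"
proof -
  have "2 * (of_real (sqrt (2 * (real n + 1))) * wig1 (Suc n) m p q)
     = 2 * (2 * (of_real p + \<i> * of_real q) * wig1 n m p q + of_real (sqrt (2 * m)) * wig1 n (m - 1) p q)"
    using wig1_position_relation[of p n m q] wig1_momentum_relation[of q n m p]
    by (simp only: algebra_simps mult_2) algebra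
  then show ?thesis unfolding Complex_eq by (simp only: mult_cancel_left) simp
qed

lemma wig1_Suc_right:
  "of_real (sqrt (2 * (real m + 1))) * wig1 n (Suc m) p q
     = - 2 * cnj (Complex p q) * wig1 n m p q + of_real (sqrt (2 * n)) * wig1 (n - 1) m p q"
proof -
  have "2 * (of_real (sqrt (2 * (real m + 1))) * wig1 n (Suc m) p q)
     = 2 * (- 2 * (of_real p - \<i> * of_real q) * wig1 n m p q + of_real (sqrt (2 * n)) * wig1 (n - 1) m p q)"
    using wig1_position_relation[of p n m q] wig1_momentum_relation[of q n m p]
    by (simp only: algebra_simps mult_2) algebra
  moreover have "cnj (Complex p q) = of_real p - \<i> * of_real q"
    by (simp add: complex_eq_iff)
  ultimately show ?thesis by (simp only: mult_cancel_left) simp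
qed

text \<open>A factor \<open>exp (- p\<^sup>2)\<close> splits off, and what remains is the characteristic function of the normal
  distribution at \<open>2 q / 2\<^sup>1\<^sup>/\<^sup>2\<close>.\<close>
lemma wig1_0_0: "wig1 0 0 p q = of_real (exp (- (cmod (Complex p q))\<^sup>2))"
proof -
  let ?g = "\<lambda>z. cis (2 * q * z) * complex_of_real (exp (- z\<^sup>2))"
  have prod: "hermite_unit 0 (p + z) * hermite_unit 0 (z - p) = exp (- p\<^sup>2) / sqrt pi * exp (- z\<^sup>2)" for z
  proof -
    have "sqrt (sqrt pi) * sqrt (sqrt pi) = sqrt pi" by simp
    moreover have "- (p + z)\<^sup>2 / 2 + - (z - p)\<^sup>2 / 2 = - p\<^sup>2 + - z\<^sup>2"
      by (simp add: power2_eq_square field_simps)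
    ultimately show ?thesis
      unfolding hermite_unit_def hermite1_def by (simp add: mult_exp_exp)
  qed
  have "of_real (exp (- (2 * q / sqrt 2)\<^sup>2 / 2)) = char std_normal_distribution (2 * q / sqrt 2)"
    by (simp add: char_std_normal_distribution)
  also have "\<dots> = (LINT x|lborel. std_normal_density x *\<^sub>R cis (2 * q / sqrt 2 * x))"
    unfolding char_def by (subst integral_density) (auto simp: cis_conv_exp)
  also have "\<dots> = sqrt 2 *\<^sub>R (LINT x|lborel. std_normal_density (sqrt 2 * x) *\<^sub>R cis (2 * q / sqrt 2 * (sqrt 2 * x)))"
    using lborel_integral_real_affine[of "sqrt 2" "\<lambda>x. std_normal_density x *\<^sub>R cis (2 * q / sqrt 2 * x)" 0] by simp
  also have "(\<lambda>x. std_normal_density (sqrt 2 * x) *\<^sub>R cis (2 * q / sqrt 2 * (sqrt 2 * x))) = (\<lambda>x. of_real (1 / sqrt (2 * pi)) * ?g x)"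
    by (auto simp: std_normal_density_def fun_eq_iff scaleR_conv_of_real power_mult_distrib mult.assoc)
  finally have "of_real (exp (- q\<^sup>2)) = of_real (sqrt 2 * (1 / sqrt (2 * pi))) * (LINT x|lborel. ?g x)"
    by (simp add: scaleR_conv_of_real power_divide power_mult_distrib)
  also have "sqrt 2 * (1 / sqrt (2 * pi)) = 1 / sqrt pi"
    by (simp add: real_sqrt_mult)
  finally have g: "of_real (1 / sqrt pi) * (LINT x|lborel. ?g x) = of_real (exp (- q\<^sup>2))" ..
  have "wig1 0 0 p q = (LINT z|lborel. of_real (exp (- p\<^sup>2) / sqrt pi) * ?g z)"
    unfolding wig1_def prod by (simp add: algebra_simps)
  also have "\<dots> = of_real (exp (- p\<^sup>2)) * (of_real (1 / sqrt pi) * (LINT x|lborel. ?g x))"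
    by simp
  also have "\<dots> = of_real (exp (- (p\<^sup>2 + q\<^sup>2)))"
    unfolding g by (simp add: mult_exp_exp flip: of_real_mult)
  finally show ?thesis by (simp add: cmod_power2)
qed

text \<open>The factor in the action of the annihilation operator \<open>d/dz + z\<close> on the \<open>k\<close>-th normalized Hermite
  function.\<close>
definition ladder :: "nat \<Rightarrow> complex" where
  "ladder k = of_real (sqrt (2 * real k))"

lemma ladder_0 [simp]: "ladder 0 = 0"
  and ladder_eq_0_iff [simp]: "ladder k = 0 \<longleftrightarrow> k = 0"
  and cnj_ladder [simp]: "cnj (ladder k) = ladder k"
  by (auto simp: ladder_def)

lemma ladder_square: "ladder k * ladder k = 2 * of_nat k"
proof -
  have "ladder k * ladder k = of_real (sqrt (2 * real k) * sqrt (2 * real k))"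
    unfolding ladder_def of_real_mult ..
  also have "\<dots> = of_real (2 * real k)"
    by (subst real_sqrt_mult_self) simp
  finally show ?thesis by simp
qed

lemma ladder_Suc: "ladder (Suc k) = of_real (sqrt (2 * (real k + 1)))"
  by (simp add: ladder_def algebra_simps)

lemma wig1_raise_left:
  "ladder (Suc n) * wig1 (Suc n) m p q
     = 2 * Complex p q * wig1 n m p q + ladder m * wig1 n (m - 1) p q"
  unfolding ladder_Suc wig1_Suc_left by (simp add: ladder_def)

lemma wig1_raise_right:
  "ladder (Suc m) * wig1 n (Suc m) p q
     = - 2 * cnj (Complex p q) * wig1 n m p q + ladder n * wig1 (n - 1) m p q"
  unfolding ladder_Suc wig1_Suc_right by (simp add: ladder_def)

lemma wig1_lower_left:
  "ladder n * (2 * Complex p q * wig1 (n - 1) m p q + ladder m * wig1 (n - 1) (m - 1) p q)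
     = 2 * of_nat n * wig1 n m p q"
proof (cases n)
  case (Suc k)
  then have "ladder n * (2 * Complex p q * wig1 (n - 1) m p q + ladder m * wig1 (n - 1) (m - 1) p q)
      = (ladder n * ladder n) * wig1 n m p q"
    using wig1_raise_left[of k m p q] by (simp add: mult.assoc)
  then show ?thesis unfolding ladder_square .
qed simp

lemma wig1_lower_right:
  "ladder m * (- 2 * cnj (Complex p q) * wig1 n (m - 1) p q + ladder n * wig1 (n - 1) (m - 1) p q)
     = 2 * of_nat m * wig1 n m p q"
proof (cases m)
  case (Suc k)
  then have "ladder m * (- 2 * cnj (Complex p q) * wig1 n (m - 1) p q + ladder n * wig1 (n - 1) (m - 1) p q)
      = (ladder m * ladder m) * wig1 n m p q"
    using wig1_raise_right[of k n p q] by (simp add: mult.assoc)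
  then show ?thesis unfolding ladder_square .
qed simp

lemma wig1_Suc_left_eq:
  "wig1 (Suc n) m p q
     = (2 * Complex p q * wig1 n m p q + ladder m * wig1 n (m - 1) p q) / ladder (Suc n)"
  using wig1_raise_left[of n m p q] by (simp add: field_simps)

lemma wig1_0_Suc_eq:
  "wig1 0 (Suc m) p q = - 2 * cnj (Complex p q) * wig1 0 m p q / ladder (Suc m)"
  using wig1_raise_right[of m 0 p q] by (simp add: field_simps)

text \<open>Differentiation under the integral is avoided: the formula holds for the Gaussian \<open>wig1 0 0\<close>, and
  both ladder relations propagate it to higher indices.\<close>
lemma wig1_has_vector_derivative:
  fixes p q a b :: real
  defines "P \<equiv> \<lambda>t. p + t * a" and "Q \<equiv> \<lambda>t. q + t * b"
  shows "((\<lambda>t. wig1 n m (P t) (Q t)) has_vector_derivative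
     ladder n * Complex a b * wig1 (n - 1) m (P t) (Q t)
     - ladder m * cnj (Complex a b) * wig1 n (m - 1) (P t) (Q t)
     - 2 * of_real (P t * a + Q t * b) * wig1 n m (P t) (Q t)) (at t)"
proof -
  have zeta: "((\<lambda>t. Complex (P t) (Q t)) has_vector_derivative Complex a b) (at t)" for t
  proof -
    have "((\<lambda>t. of_real (P t) + \<i> * of_real (Q t)) has_vector_derivative of_real a + \<i> * of_real b) (at t)"
      unfolding P_def Q_def by (auto intro!: derivative_eq_intros)
    then show ?thesis by (simp add: Complex_eq)
  qed
  have cnj_zeta: "((\<lambda>t. cnj (Complex (P t) (Q t))) has_vector_derivative cnj (Complex a b)) (at t)" for t
    by (intro has_vector_derivative_cnj zeta)
  let ?D = "\<lambda>n m t. ladder n * Complex a b * wig1 (n - 1) m (P t) (Q t)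
     - ladder m * cnj (Complex a b) * wig1 n (m - 1) (P t) (Q t)
     - 2 * of_real (P t * a + Q t * b) * wig1 n m (P t) (Q t)"
  show ?thesis
  proof (induction n arbitrary: m t)
    case 0
    show ?case
    proof (induction m arbitrary: t)
      case 0
      have "((\<lambda>t. exp (- ((P t)\<^sup>2 + (Q t)\<^sup>2))) has_real_derivative
          - (2 * (P t * a + Q t * b)) * exp (- ((P t)\<^sup>2 + (Q t)\<^sup>2))) (at t)"
        unfolding P_def Q_def
        by (auto intro!: derivative_eq_intros simp: power2_eq_square algebra_simps)
      then have "((\<lambda>t. complex_of_real (exp (- ((P t)\<^sup>2 + (Q t)\<^sup>2)))) has_vector_derivative
          of_real (- (2 * (P t * a + Q t * b)) * exp (- ((P t)\<^sup>2 + (Q t)\<^sup>2)))) (at t)"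
        using has_vector_derivative_of_real has_real_derivative_iff_has_vector_derivative by blast
      moreover have "?D 0 0 t = of_real (- (2 * (P t * a + Q t * b)) * exp (- ((P t)\<^sup>2 + (Q t)\<^sup>2)))"
        by (simp add: wig1_0_0 cmod_power2 algebra_simps)
      ultimately show ?case by (simp only: wig1_0_0 cmod_power2 complex.sel)
    next
      case (Suc m)
      have low: "ladder m * (- 2 * cnj (Complex (P t) (Q t)) * wig1 0 (m - 1) (P t) (Q t))
          = 2 * of_nat m * wig1 0 m (P t) (Q t)"
        using wig1_lower_right[of m "P t" "Q t" 0] by simp
      have "((\<lambda>t. - 2 * (cnj (Complex (P t) (Q t)) * wig1 0 m (P t) (Q t)) / ladder (Suc m)) has_vector_derivative
         - 2 * (cnj (Complex (P t) (Q t)) * ?D 0 m t + cnj (Complex a b) * wig1 0 m (P t) (Q t)) / ladder (Suc m)) (at t)"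
        by (intro has_vector_derivative_divide has_vector_derivative_mult_right
            has_vector_derivative_mult[OF cnj_zeta] Suc.IH)
      moreover have "- 2 * (cnj (Complex (P t) (Q t)) * ?D 0 m t + cnj (Complex a b) * wig1 0 m (P t) (Q t)) / ladder (Suc m)
         = ?D 0 (Suc m) t"
      proof -
        have "- 2 * (cnj (Complex (P t) (Q t)) * ?D 0 m t + cnj (Complex a b) * wig1 0 m (P t) (Q t))
          = - cnj (Complex a b) * (ladder m * (- 2 * cnj (Complex (P t) (Q t)) * wig1 0 (m - 1) (P t) (Q t)))
            - 2 * cnj (Complex a b) * wig1 0 m (P t) (Q t)
            - 2 * of_real (P t * a + Q t * b) * (- 2 * cnj (Complex (P t) (Q t)) * wig1 0 m (P t) (Q t))"
          by (simp add: algebra_simps)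
        also have "\<dots> = - cnj (Complex a b) * (2 * of_nat (Suc m)) * wig1 0 m (P t) (Q t)
           - 2 * of_real (P t * a + Q t * b) * (ladder (Suc m) * wig1 0 (Suc m) (P t) (Q t))"
          unfolding low using wig1_raise_right[of m 0 "P t" "Q t"] by (simp add: algebra_simps)
        also have "\<dots> = ladder (Suc m) * ?D 0 (Suc m) t"
          unfolding ladder_square[symmetric] by (simp add: algebra_simps)
        finally show ?thesis by simp
      qed
      ultimately show ?case by (simp add: wig1_0_Suc_eq mult.assoc)
    qed
  next
    case (Suc n)
    have "((\<lambda>t. (2 * (Complex (P t) (Q t) * wig1 n m (P t) (Q t)) + ladder m * wig1 n (m - 1) (P t) (Q t)) / ladder (Suc n)) has_vector_derivative
       (2 * (Complex (P t) (Q t) * ?D n m t + Complex a b * wig1 n m (P t) (Q t)) + ladder m * ?D n (m - 1) t) / ladder (Suc n)) (at t)"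
      by (intro has_vector_derivative_divide has_vector_derivative_add has_vector_derivative_mult_right
            has_vector_derivative_mult[OF zeta] Suc.IH)
    moreover have "(2 * (Complex (P t) (Q t) * ?D n m t + Complex a b * wig1 n m (P t) (Q t)) + ladder m * ?D n (m - 1) t) / ladder (Suc n)
        = ?D (Suc n) m t"
    proof -
      have "2 * (Complex (P t) (Q t) * ?D n m t + Complex a b * wig1 n m (P t) (Q t)) + ladder m * ?D n (m - 1) t
        = Complex a b * (ladder n * (2 * Complex (P t) (Q t) * wig1 (n - 1) m (P t) (Q t) + ladder m * wig1 (n - 1) (m - 1) (P t) (Q t)))
          + 2 * Complex a b * wig1 n m (P t) (Q t)
          - ladder m * cnj (Complex a b) * (2 * Complex (P t) (Q t) * wig1 n (m - 1) (P t) (Q t) + ladder (m - 1) * wig1 n (m - 1 - 1) (P t) (Q t))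
          - 2 * of_real (P t * a + Q t * b) * (2 * Complex (P t) (Q t) * wig1 n m (P t) (Q t) + ladder m * wig1 n (m - 1) (P t) (Q t))"
        by (simp add: algebra_simps)
      also have "\<dots> = Complex a b * (2 * of_nat (Suc n)) * wig1 n m (P t) (Q t)
          - ladder m * cnj (Complex a b) * (ladder (Suc n) * wig1 (Suc n) (m - 1) (P t) (Q t))
          - 2 * of_real (P t * a + Q t * b) * (ladder (Suc n) * wig1 (Suc n) m (P t) (Q t))"
        unfolding wig1_lower_left unfolding wig1_raise_left[symmetric] by (simp add: algebra_simps)
      also have "\<dots> = ladder (Suc n) * ?D (Suc n) m t"
        unfolding ladder_square[symmetric] by (simp add: algebra_simps)
      finally show ?thesis by simp
    qed
    ultimately show ?case by (simp add: wig1_Suc_left_eq mult.assoc)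
  qed
qed

lemma continuous_on_wig1 [continuous_intros]:
  assumes "continuous_on A f" "continuous_on A g"
  shows "continuous_on A (\<lambda>x. wig1 n m (f x) (g x))"
proof (induction n arbitrary: m)
  case 0
  show ?case
  proof (induction m)
    case 0
    show ?case unfolding wig1_0_0 cmod_power2 complex.sel by (intro continuous_intros assms)
  next
    case (Suc m)
    then show ?case
      unfolding wig1_0_Suc_eq Complex_eq by (intro continuous_intros assms) auto
  qed
next
  case (Suc n)
  then show ?case
    unfolding wig1_Suc_left_eq Complex_eq by (intro continuous_intros assms) auto
qed

text \<open>Orthonormality of the Hermite functions, read off from the ladder relations at the origin.\<close>
lemma wig1_at_0: "wig1 n m 0 0 = (if n = m then 1 else 0)"
proof (induction n arbitrary: m)
  case 0
  show ?case
    by (cases m) (simp_all add: wig1_0_0 wig1_0_Suc_eq flip: zero_complex.code)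
next
  case (Suc n)
  then show ?case
    by (cases m) (auto simp: wig1_Suc_left_eq simp flip: zero_complex.code)
qed

lemma hermite_unit_norm: "has_bochner_integral lborel (\<lambda>z. (hermite_unit n z)\<^sup>2) 1"
proof -
  have "integrable lborel (\<lambda>z. (hermite_unit n z)\<^sup>2)"
    using integrable_hermite_unit_prod[of n 0 n] by (simp add: power2_eq_square)
  moreover have "complex_of_real (LINT z|lborel. (hermite_unit n z)\<^sup>2) = 1"
    using wig1_at_0[of n n] by (simp add: wig1_def power2_eq_square flip: integral_complex_of_real of_real_mult)
  ultimately show ?thesis
    by (metis has_bochner_integral_iff of_real_eq_1_iff)
qed

text \<open>The product of the two Hermite functions is at most half the sum of their squares, and each
  square has integral 1.\<close>
lemma norm_wig1_le_1: "norm (wig1 n m p q) \<le> 1"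
proof -
  have n: "has_bochner_integral lborel (\<lambda>z. (hermite_unit n (p + z))\<^sup>2) 1"
    using lborel_has_bochner_integral_real_affine_iff[of 1 "\<lambda>z. (hermite_unit n z)\<^sup>2" 1 p] hermite_unit_norm[of n] by simp
  have m: "has_bochner_integral lborel (\<lambda>z. (hermite_unit m (z - p))\<^sup>2) 1"
    using lborel_has_bochner_integral_real_affine_iff[of 1 "\<lambda>z. (hermite_unit m z)\<^sup>2" 1 "- p"] hermite_unit_norm[of m] by simp
  have nm: "has_bochner_integral lborel (\<lambda>z. ((hermite_unit n (p + z))\<^sup>2 + (hermite_unit m (z - p))\<^sup>2) / 2) ((1 + 1) / 2)"
    by (intro has_bochner_integral_divide has_bochner_integral_add n m) 
  have "norm (wig1 n m p q) \<le> (LINT z|lborel. ((hermite_unit n (p + z))\<^sup>2 + (hermite_unit m (z - p))\<^sup>2) / 2)"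
    unfolding wig1_def
  proof (rule order_trans[OF integral_norm_bound integral_mono])
    show "integrable lborel (\<lambda>z. ((hermite_unit n (p + z))\<^sup>2 + (hermite_unit m (z - p))\<^sup>2) / 2)"
      using nm by (simp add: has_bochner_integral_iff)
    fix z
    have "2 * (\<bar>hermite_unit n (p + z)\<bar> * \<bar>hermite_unit m (z - p)\<bar>) \<le> (hermite_unit n (p + z))\<^sup>2 + (hermite_unit m (z - p))\<^sup>2"
      using sum_squares_bound[of "\<bar>hermite_unit n (p + z)\<bar>" "\<bar>hermite_unit m (z - p)\<bar>"] by simp
    then show "norm (cis (2 * q * z) * complex_of_real (hermite_unit n (p + z) * hermite_unit m (z - p)))
      \<le> ((hermite_unit n (p + z))\<^sup>2 + (hermite_unit m (z - p))\<^sup>2) / 2"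
      by (simp add: norm_mult abs_mult)
  qed (rule integrable_norm[OF integrable_wig1])
  also have "\<dots> = 1" using nm by (simp add: has_bochner_integral_iff)
  finally show ?thesis .
qed

section \<open>The Taylor expansion along rays and the limiting kernel\<close>

lemma complex_Taylor_sums:
  fixes U :: "nat \<Rightarrow> real \<Rightarrow> complex"
  assumes deriv: "\<And>j t. (U j has_vector_derivative U (Suc j) t) (at t)"
    and bound: "\<And>j t. norm (U j t) \<le> M j"
    and lim: "(\<lambda>j. M j / fact j) \<longlonglongrightarrow> 0"
  shows "(\<lambda>j. U j 0 / fact j) sums U 0 1"
proof -
  have real_sums: "(\<lambda>j. V j 0 / fact j) sums V 0 1"
    if "\<And>j t. (V j has_real_derivative V (Suc j) t) (at t)" "\<And>j t. \<bar>V j t\<bar> \<le> M j"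
    for V :: "nat \<Rightarrow> real \<Rightarrow> real"
  proof -
    have "\<bar>(\<Sum>j<n. V j 0 / fact j) - V 0 1\<bar> \<le> M n / fact n" for n
    proof -
      have "\<forall>m x. (V m has_real_derivative V (Suc m) x) (at x)" using that(1) by simp
      from Maclaurin_all_le[OF refl this, of 1 n]
      obtain t where "V 0 1 = (\<Sum>m<n. (V m 0 / fact m) * 1 ^ m) + (V n t / fact n) * 1 ^ n"
        by blast
      then have "\<bar>(\<Sum>j<n. V j 0 / fact j) - V 0 1\<bar> = \<bar>V n t\<bar> / fact n" by simp
      also have "\<dots> \<le> M n / fact n" by (intro divide_right_mono that(2)) simp
      finally show ?thesis .
    qed
    then have "(\<lambda>n. (\<Sum>j<n. V j 0 / fact j) - V 0 1) \<longlonglongrightarrow> 0"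
      by (intro Lim_null_comparison[OF _ lim] always_eventually allI) simp
    then show ?thesis unfolding sums_def by (simp add: LIM_zero_iff)
  qed
  have "(\<lambda>j. Re (U j 0) / fact j) sums Re (U 0 1)"
    by (rule real_sums[of "\<lambda>j t. Re (U j t)"])
      (use deriv bound abs_Re_le_cmod order_trans has_vector_derivative_complex_iff in \<open>blast+\<close>)
  moreover have "(\<lambda>j. Im (U j 0) / fact j) sums Im (U 0 1)"
    by (rule real_sums[of "\<lambda>j t. Im (U j t)"])
      (use deriv bound abs_Im_le_cmod order_trans has_vector_derivative_complex_iff in \<open>blast+\<close>)
  moreover have "fact j = complex_of_real (fact j)" for j by simp
  ultimately show ?thesis
    unfolding sums_complex_iff by (simp only: Re_divide_of_real Im_divide_of_real)
qed

lemma power_div_fact_le_exp: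
  fixes x :: real
  assumes "0 \<le> x"
  shows "x ^ n / fact n \<le> exp x"
proof -
  have "(\<Sum>i\<in>{n}. inverse (fact i) * x ^ i) \<le> (\<Sum>i. inverse (fact i) * x ^ i)"
    using assms by (intro sum_le_suminf summable_exp) auto
  then show ?thesis by (simp add: exp_def divide_inverse mult.commute scaleR_conv_of_real)
qed

text \<open>Taylor coefficients of order \<open>j\<close> pick up \<open>j\<close> square roots of numbers growing linearly in \<open>j\<close>. After
  squaring, one factorial absorbs \<open>j\<^sup>j \<le> e\<^sup>j j!\<close>, the other makes the powers summable with a constant
  that depends only on \<open>A\<^sup>2 (S + c)\<close>; inserting \<open>4\<^sup>j\<close> before the last estimate yields the geometric
  factor.\<close>
lemma taylor_majorant:
  fixes A S c :: real
  assumes "0 \<le> A" "0 \<le> S" "0 \<le> c"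
  shows "(A * sqrt (S + c * j)) ^ j / fact j \<le> exp (2 * exp 1 * A\<^sup>2 * (S + c)) / 2 ^ j"
proof (cases "j = 0")
  case True
  then show ?thesis using assms by simp
next
  case False
  define X where "X = A\<^sup>2 * (S + c)"
  have X: "0 \<le> X" using assms by (simp add: X_def)
  show ?thesis
  proof (rule power2_le_imp_le)
    have "S + c * j \<le> (S + c) * j"
      using False assms mult_left_mono[of 1 "real j" S] by (simp add: distrib_right)
    then have "A\<^sup>2 * (S + c * j) \<le> X * j"
      unfolding X_def mult.assoc by (intro mult_left_mono) auto
    have "((A * sqrt (S + c * j)) ^ j / fact j)\<^sup>2 = ((A * sqrt (S + c * j))\<^sup>2) ^ j / (fact j * fact j)"
      by (simp add: power_divide power2_eq_square power_mult_distrib)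
    also have "(A * sqrt (S + c * j))\<^sup>2 = A\<^sup>2 * (S + c * j)"
      using assms by (simp add: power_mult_distrib)
    also have "(A\<^sup>2 * (S + c * j)) ^ j / (fact j * fact j) \<le> (X * j) ^ j / (fact j * fact j)"
      using assms \<open>A\<^sup>2 * (S + c * j) \<le> X * j\<close> by (intro divide_right_mono power_mono) auto
    also have "\<dots> = X ^ j / fact j * (real j ^ j / fact j)"
      by (simp add: power_mult_distrib)
    also have "\<dots> \<le> X ^ j / fact j * exp (real j)"
      using X by (intro mult_left_mono power_div_fact_le_exp) auto
    also have "\<dots> = (4 * exp 1 * X) ^ j / fact j / 4 ^ j"
      by (simp add: power_mult_distrib exp_of_nat_mult[of j 1, simplified])
    also have "\<dots> \<le> exp (4 * exp 1 * X) / 4 ^ j"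
      using X by (intro divide_right_mono power_div_fact_le_exp) auto
    also have "\<dots> = (exp (2 * exp 1 * A\<^sup>2 * (S + c)) / 2 ^ j)\<^sup>2"
    proof -
      have "(2 ^ j)\<^sup>2 = (4 :: real) ^ j" by (simp add: power2_eq_square flip: power_mult_distrib)
      moreover have "(exp (2 * exp 1 * A\<^sup>2 * (S + c)))\<^sup>2 = exp (4 * exp 1 * X)"
        by (simp add: X_def power2_eq_square mult_exp_exp algebra_simps)
      ultimately show ?thesis by (simp add: power_divide)
    qed
    finally show "((A * sqrt (S + c * j)) ^ j / fact j)\<^sup>2 \<le> (exp (2 * exp 1 * A\<^sup>2 * (S + c)) / 2 ^ j)\<^sup>2" .
  qed simp
qed

lemma taylor_majorant_tendsto_0:
  fixes A S c :: real
  assumes "0 \<le> A" "0 \<le> S" "0 \<le> c"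
  shows "(\<lambda>j. (A * sqrt (S + c * j)) ^ j / fact j) \<longlonglongrightarrow> 0"
proof (rule Lim_null_comparison)
  show "\<forall>\<^sub>F j in sequentially. norm ((A * sqrt (S + c * j)) ^ j / fact j) \<le> exp (2 * exp 1 * A\<^sup>2 * (S + c)) / 2 ^ j"
    using assms taylor_majorant[OF assms] by (intro always_eventually) simp
  show "(\<lambda>j. exp (2 * exp 1 * A\<^sup>2 * (S + c)) / 2 ^ j) \<longlonglongrightarrow> 0"
    by real_asymp
qed

text \<open>The \<open>j\<close>-th derivative at \<open>t = 0\<close> of \<open>wig1 n m\<close> along the ray \<open>t \<mu>\<^sup>1\<^sup>/\<^sup>2 \<zeta>\<close>, written in the parameters
  \<open>r = \<mu> (n + m)\<close> and \<open>k = m - n\<close>: then \<open>r - \<mu> k = 2 \<mu> n\<close>, and lowering \<open>n\<close> replaces \<open>(r, k)\<close> by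
  \<open>(r - \<mu>, k + 1)\<close>. In this form the recursion makes sense for real \<open>r\<close> and for \<open>\<mu> = 0\<close>.\<close>
primrec tcoef :: "nat \<Rightarrow> complex \<Rightarrow> real \<Rightarrow> real \<Rightarrow> int \<Rightarrow> complex" where
  "tcoef 0 \<zeta> r \<mu> k = (if k = 0 then 1 else 0)"
| "tcoef (Suc j) \<zeta> r \<mu> k =
     \<zeta> * of_real (sqrt (r - \<mu> * of_int k)) * tcoef j \<zeta> (r - \<mu>) \<mu> (k + 1)
     - cnj \<zeta> * of_real (sqrt (r - \<mu> * of_int k + 2 * \<mu>)) * tcoef j \<zeta> (r + \<mu>) \<mu> (k - 1)"

text \<open>The common extension of the matrix coefficients (\<open>\<mu> > 0\<close>, \<open>r = \<mu> (n + m)\<close>, \<open>k = m - n\<close>) and of the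
  limiting kernel (\<open>\<mu> = 0\<close>).\<close>
definition phi :: "complex \<Rightarrow> real \<Rightarrow> real \<Rightarrow> int \<Rightarrow> complex" where
  "phi \<zeta> r \<mu> k = (\<Sum>j. tcoef j \<zeta> r \<mu> k / fact j)"

primrec ray_deriv :: "nat \<Rightarrow> nat \<Rightarrow> complex \<Rightarrow> nat \<Rightarrow> real \<Rightarrow> complex" where
  "ray_deriv 0 m \<omega> n t = wig1 n m (t * Re \<omega>) (t * Im \<omega>)"
| "ray_deriv (Suc j) m \<omega> n t =
     \<omega> * ladder n * ray_deriv j m \<omega> (n - 1) t - cnj \<omega> * ladder (Suc n) * ray_deriv j m \<omega> (Suc n) t"

text \<open>Only the first derivative needs an argument: along a ray through the origin the terms with index
  \<open>m - 1\<close> and with the factor \<open>2 t \<bar>\<omega>\<bar>\<^sup>2\<close> combine, by the ladder relation, into the one with \<open>Suc n\<close>.\<close>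
lemma ray_deriv_has_vector_derivative:
  "(ray_deriv j m \<omega> n has_vector_derivative ray_deriv (Suc j) m \<omega> n t) (at t)"
proof (induction j arbitrary: n t)
  case 0
  let ?W = "\<lambda>n m. wig1 n m (t * Re \<omega>) (t * Im \<omega>)"
  have "((\<lambda>t. wig1 n m (t * Re \<omega>) (t * Im \<omega>)) has_vector_derivative
     ladder n * \<omega> * ?W (n - 1) m - ladder m * cnj \<omega> * ?W n (m - 1)
     - 2 * of_real (t * Re \<omega> * Re \<omega> + t * Im \<omega> * Im \<omega>) * ?W n m) (at t)"
    using wig1_has_vector_derivative[of n m 0 "Re \<omega>" 0 "Im \<omega>" t] by simp
  moreover have "cnj \<omega> * (ladder (Suc n) * ?W (Suc n) m) =
      2 * of_real (t * Re \<omega> * Re \<omega> + t * Im \<omega> * Im \<omega>) * ?W n m + ladder m * cnj \<omega> * ?W n (m - 1)"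
  proof -
    have "of_real (t * Re \<omega> * Re \<omega> + t * Im \<omega> * Im \<omega>) = cnj \<omega> * Complex (t * Re \<omega>) (t * Im \<omega>)"
      by (simp add: complex_eq_iff algebra_simps)
    then show ?thesis unfolding wig1_raise_left by (simp add: algebra_simps)
  qed
  ultimately have "((\<lambda>t. wig1 n m (t * Re \<omega>) (t * Im \<omega>)) has_vector_derivative
     \<omega> * ladder n * ?W (n - 1) m - cnj \<omega> * (ladder (Suc n) * ?W (Suc n) m)) (at t)"
    by (simp add: algebra_simps)
  moreover have "ray_deriv 0 m \<omega> n = (\<lambda>t. wig1 n m (t * Re \<omega>) (t * Im \<omega>))" by (simp add: fun_eq_iff)
  ultimately show ?case by (simp add: mult.assoc)
next
  case (Suc j)
  have "ray_deriv (Suc j) m \<omega> n = (\<lambda>t. \<omega> * ladder n * ray_deriv j m \<omega> (n - 1) t - cnj \<omega> * ladder (Suc n) * ray_deriv j m \<omega> (Suc n) t)"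
    by (simp add: fun_eq_iff)
  then show ?case
    unfolding ray_deriv.simps(2)[of "Suc j"]
    by (simp only:) (intro has_vector_derivative_diff has_vector_derivative_mult_right Suc.IH)
qed

lemma norm_ray_deriv_le:
  "norm (ray_deriv j m \<omega> n t) \<le> (2 * norm \<omega> * sqrt (2 * (real n + 1) + 2 * real j)) ^ j"
proof (induction j arbitrary: n)
  case 0
  then show ?case by (simp add: norm_wig1_le_1)
next
  case (Suc j)
  define s where "s = sqrt (2 * (real n + 1) + 2 * real (Suc j))"
  have lad: "norm (ladder n) \<le> s" "norm (ladder (Suc n)) \<le> s"
    by (auto simp: ladder_def s_def)
  have IH: "norm (ray_deriv j m \<omega> k t) \<le> (2 * norm \<omega> * s) ^ j" if "k \<le> Suc n" for k
    by (rule order_trans[OF Suc.IH]) (use that in \<open>auto simp: s_def intro!: power_mono mult_left_mono\<close>)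
  have "norm (ray_deriv (Suc j) m \<omega> n t) \<le>
      norm (\<omega> * ladder n * ray_deriv j m \<omega> (n - 1) t) + norm (cnj \<omega> * ladder (Suc n) * ray_deriv j m \<omega> (Suc n) t)"
    by (simp only: ray_deriv.simps norm_triangle_ineq4)
  also have "\<dots> \<le> norm \<omega> * s * (2 * norm \<omega> * s) ^ j + norm \<omega> * s * (2 * norm \<omega> * s) ^ j"
    unfolding norm_mult complex_mod_cnj
    by (intro add_mono mult_mono lad IH order_refl) (auto simp: s_def)
  finally show ?case by (simp add: s_def algebra_simps)
qed

lemma ray_deriv_at_0:
  assumes "0 \<le> \<mu>"
  shows "ray_deriv j m (of_real (sqrt \<mu>) * \<zeta>) n 0 = tcoef j \<zeta> (\<mu> * (real n + real m)) \<mu> (int m - int n)"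
proof (induction j arbitrary: n)
  case 0
  then show ?case by (simp add: wig1_at_0)
next
  case (Suc j)
  have r1: "of_real (sqrt \<mu>) * ladder n = of_real (sqrt (\<mu> * (real n + real m) - \<mu> * of_int (int m - int n)))"
    using assms by (simp add: ladder_def algebra_simps flip: of_real_mult real_sqrt_mult)
  have r2: "of_real (sqrt \<mu>) * ladder (Suc n) = of_real (sqrt (\<mu> * (real n + real m) - \<mu> * of_int (int m - int n) + 2 * \<mu>))"
    using assms by (simp add: ladder_def algebra_simps flip: of_real_mult real_sqrt_mult)
  have t2: "tcoef j \<zeta> (\<mu> * (real n + real m) + \<mu>) \<mu> (int m - int n - 1) = ray_deriv j m (of_real (sqrt \<mu>) * \<zeta>) (Suc n) 0"
    unfolding Suc.IH by (simp add: algebra_simps)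
  have t1: "ladder n * tcoef j \<zeta> (\<mu> * (real n + real m) - \<mu>) \<mu> (int m - int n + 1) = ladder n * ray_deriv j m (of_real (sqrt \<mu>) * \<zeta>) (n - 1) 0"
    unfolding Suc.IH by (cases n) (simp_all add: algebra_simps)
  have "tcoef (Suc j) \<zeta> (\<mu> * (real n + real m)) \<mu> (int m - int n) =
     \<zeta> * of_real (sqrt \<mu>) * (ladder n * tcoef j \<zeta> (\<mu> * (real n + real m) - \<mu>) \<mu> (int m - int n + 1))
      - cnj \<zeta> * of_real (sqrt \<mu>) * ladder (Suc n) * tcoef j \<zeta> (\<mu> * (real n + real m) + \<mu>) \<mu> (int m - int n - 1)"
    unfolding tcoef.simps r1[symmetric] r2[symmetric] by (simp only: mult.assoc)
  also have "\<dots> = ray_deriv (Suc j) m (of_real (sqrt \<mu>) * \<zeta>) n 0"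
    unfolding t1 t2 by (simp add: mult_ac)
  finally show ?case ..
qed

lemma wig1_eq_phi:
  assumes "0 \<le> \<mu>"
  shows "wig1 n m (sqrt \<mu> * Re \<zeta>) (sqrt \<mu> * Im \<zeta>) = phi \<zeta> (\<mu> * (real n + real m)) \<mu> (int m - int n)"
proof -
  let ?\<omega> = "of_real (sqrt \<mu>) * \<zeta>"
  have "(\<lambda>j. ray_deriv j m ?\<omega> n 0 / fact j) sums ray_deriv 0 m ?\<omega> n 1"
  proof (rule complex_Taylor_sums[where M = "\<lambda>j. (2 * norm ?\<omega> * sqrt (2 * (real n + 1) + 2 * real j)) ^ j"])
    show "(\<lambda>j. (2 * norm ?\<omega> * sqrt (2 * (real n + 1) + 2 * real j)) ^ j / fact j) \<longlonglongrightarrow> 0"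
      by (rule taylor_majorant_tendsto_0) auto
  qed (rule ray_deriv_has_vector_derivative norm_ray_deriv_le)+
  then show ?thesis
    unfolding ray_deriv_at_0[OF assms] phi_def by (simp add: sums_iff)
qed

text \<open>Each step of the recursion enlarges \<open>\<bar>r\<bar> + \<mu> \<bar>k\<bar>\<close> by at most \<open>2 \<mu>\<close>, and there are two terms per step.\<close>
lemma norm_tcoef_le:
  assumes "0 \<le> \<mu>"
  shows "norm (tcoef j \<zeta> r \<mu> k) \<le> (2 * norm \<zeta> * sqrt (\<bar>r\<bar> + \<mu> * \<bar>of_int k\<bar> + 2 * \<mu> + 2 * \<mu> * j)) ^ j"
proof (induction j arbitrary: r k)
  case 0
  then show ?case by simp
next
  case (Suc j)
  define s where "s = sqrt (\<bar>r\<bar> + \<mu> * \<bar>of_int k\<bar> + 2 * \<mu> + 2 * \<mu> * real (Suc j))"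
  have mk: "\<bar>\<mu> * of_int k\<bar> = \<mu> * \<bar>of_int k\<bar>" using assms by (simp add: abs_mult)
  have j: "0 \<le> \<mu> * real j" using assms by simp
  have root: "\<bar>sqrt x\<bar> \<le> s" if "\<bar>x\<bar> \<le> \<bar>r\<bar> + \<mu> * \<bar>of_int k\<bar> + 2 * \<mu>" for x
  proof -
    have "\<bar>sqrt x\<bar> = sqrt \<bar>x\<bar>" by (auto simp: abs_if real_sqrt_minus)
    moreover have "0 \<le> 2 * \<mu> * real (Suc j)" using assms by simp
    then have "\<bar>x\<bar> \<le> \<bar>r\<bar> + \<mu> * \<bar>of_int k\<bar> + 2 * \<mu> + 2 * \<mu> * real (Suc j)"
      using that by linarith
    ultimately show ?thesis unfolding s_def by simp
  qed
  have "norm (tcoef (Suc j) \<zeta> r \<mu> k) \<le>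
      norm (\<zeta> * of_real (sqrt (r - \<mu> * of_int k)) * tcoef j \<zeta> (r - \<mu>) \<mu> (k + 1))
      + norm (cnj \<zeta> * of_real (sqrt (r - \<mu> * of_int k + 2 * \<mu>)) * tcoef j \<zeta> (r + \<mu>) \<mu> (k - 1))"
    by (simp only: tcoef.simps norm_triangle_ineq4)
  also have "\<dots> \<le> norm \<zeta> * s * (2 * norm \<zeta> * s) ^ j + norm \<zeta> * s * (2 * norm \<zeta> * s) ^ j"
  proof -
    have shift: "norm (tcoef j \<zeta> r' \<mu> k') \<le> (2 * norm \<zeta> * s) ^ j"
      if "\<bar>r'\<bar> \<le> \<bar>r\<bar> + \<mu>" "\<bar>k'\<bar> \<le> \<bar>k\<bar> + 1" for r' k'
    proof (rule order_trans[OF Suc.IH])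
      have "\<mu> * \<bar>real_of_int k'\<bar> \<le> \<mu> * (\<bar>real_of_int k\<bar> + 1)"
        using that(2) assms by (intro mult_left_mono) linarith+
      then show "(2 * norm \<zeta> * sqrt (\<bar>r'\<bar> + \<mu> * \<bar>of_int k'\<bar> + 2 * \<mu> + 2 * \<mu> * j)) ^ j \<le> (2 * norm \<zeta> * s) ^ j"
        using that(1) assms j
        by (intro power_mono mult_left_mono) (auto simp: s_def algebra_simps)
    qed
    show ?thesis
      unfolding norm_mult complex_mod_cnj norm_of_real
      by (intro add_mono mult_mono order_refl root shift) (use assms mk in \<open>auto simp: s_def\<close>)
  qed
  finally show ?case by (simp add: s_def algebra_simps)
qed

lemma norm_tcoef_div_fact_le:
  assumes "0 \<le> \<mu>" "\<mu> \<le> M" "\<bar>r\<bar> \<le> R"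
  shows "norm (tcoef j \<zeta> r \<mu> k / fact j)
    \<le> exp (2 * exp 1 * (2 * norm \<zeta>)\<^sup>2 * (R + M * \<bar>of_int k\<bar> + 4 * M)) / 2 ^ j"
proof -
  have "norm (tcoef j \<zeta> r \<mu> k / fact j) \<le> (2 * norm \<zeta> * sqrt ((\<bar>r\<bar> + \<mu> * \<bar>of_int k\<bar> + 2 * \<mu>) + 2 * \<mu> * j)) ^ j / fact j"
    unfolding norm_divide using norm_tcoef_le[OF assms(1)] by (auto intro!: divide_right_mono)
  also have "\<dots> \<le> exp (2 * exp 1 * (2 * norm \<zeta>)\<^sup>2 * ((\<bar>r\<bar> + \<mu> * \<bar>of_int k\<bar> + 2 * \<mu>) + 2 * \<mu>)) / 2 ^ j"
    by (rule taylor_majorant) (use assms in auto)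
  also have "\<dots> \<le> exp (2 * exp 1 * (2 * norm \<zeta>)\<^sup>2 * (R + M * \<bar>of_int k\<bar> + 4 * M)) / 2 ^ j"
  proof -
    have "\<mu> * \<bar>real_of_int k\<bar> \<le> M * \<bar>real_of_int k\<bar>" using assms by (intro mult_right_mono) auto
    then show ?thesis using assms
      by (intro divide_right_mono iffD2[OF exp_le_cancel_iff] mult_left_mono) auto
  qed
  finally show ?thesis .
qed

lemma tendsto_tcoef:
  assumes "(f \<longlongrightarrow> r) F" "(g \<longlongrightarrow> \<mu>) F"
  shows "((\<lambda>x. tcoef j \<zeta> (f x) (g x) k) \<longlongrightarrow> tcoef j \<zeta> r \<mu> k) F"
  using assms
proof (induction j arbitrary: f r k)
  case (Suc j)
  then show ?case
    unfolding tcoef.simps by (intro tendsto_intros Suc.IH) auto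
qed simp

lemma tendsto_phi:
  fixes r \<mu> :: "nat \<Rightarrow> real"
  assumes r: "r \<longlonglongrightarrow> r0" and mu: "\<mu> \<longlonglongrightarrow> \<mu>0" and pos: "\<And>p. 0 \<le> \<mu> p"
  shows "(\<lambda>p. phi \<zeta> (r p) (\<mu> p) k) \<longlonglongrightarrow> phi \<zeta> r0 \<mu>0 k"
proof -
  obtain R where R: "\<forall>p. \<bar>r p\<bar> \<le> R"
    using convergent_imp_Bseq[OF convergentI[OF r]] by (auto elim!: BseqE)
  obtain M where M: "\<forall>p. \<bar>\<mu> p\<bar> \<le> M"
    using convergent_imp_Bseq[OF convergentI[OF mu]] by (auto elim!: BseqE)
  \<comment> \<open>The bound of \<open>norm_tcoef_div_fact_le\<close> for all parameters of the convergent, hence bounded, sequences.\<close>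
  let ?B = "exp (2 * exp 1 * (2 * norm \<zeta>)\<^sup>2 * (R + M * \<bar>of_int k\<bar> + 4 * M))"
  have bound: "\<forall>\<^sub>F (j, p) in sequentially \<times>\<^sub>F sequentially. norm (tcoef j \<zeta> (r p) (\<mu> p) k / fact j) \<le> ?B / 2 ^ j"
  proof (intro always_eventually, clarify)
    fix j p
    show "norm (tcoef j \<zeta> (r p) (\<mu> p) k / fact j) \<le> ?B / 2 ^ j"
      by (rule norm_tcoef_div_fact_le) (use pos R M abs_le_D1 in blast)+
  qed
  have "summable (\<lambda>j. ?B * (1 / 2) ^ j)"
    by (intro summable_mult summable_geometric) simp
  then have "summable (\<lambda>j. ?B / 2 ^ j)" by (simp add: power_divide)
  then show ?thesis
    unfolding phi_def
    by (intro tannerys_theorem[OF _ bound, THEN conjunct2, THEN conjunct2])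
      (auto intro!: tendsto_intros tendsto_tcoef r mu)
qed

lemma cnj_measurable [measurable]: "cnj \<in> borel_measurable borel"
  by (intro borel_measurable_continuous_onI continuous_intros)

lemma phi_measurable [measurable]:
  assumes [measurable]: "f \<in> borel_measurable M"
  shows "(\<lambda>x. phi (f x) r \<mu> k) \<in> borel_measurable M"
proof -
  have [measurable]: "(\<lambda>x. tcoef j (f x) r \<mu> k) \<in> borel_measurable M" for j r k
    by (induction j arbitrary: r k) simp_all
  show ?thesis unfolding phi_def by measurable
qed

lemma cis_antiderivative:
  assumes "r \<noteq> 0"
  shows "((\<lambda>z. cis (r * z) / (\<i> * of_real r)) has_vector_derivative cis (r * z)) (at z within A)"
proof -
  have "((\<lambda>w. exp (\<i> * (of_real r * w)) / (\<i> * of_real r)) has_field_derivative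
      exp (\<i> * (of_real r * of_real z))) (at (of_real z))"
    using assms by (auto intro!: derivative_eq_intros simp: mult_ac)
  from has_vector_derivative_real_field[OF this] show ?thesis
    by (simp add: cis_conv_exp has_vector_derivative_at_within)
qed

lemma integral_cis_period:
  "(LINT z|lborel. indicator {- pi..pi} z *\<^sub>R cis (of_int k * z)) = (if k = 0 then 2 * of_real pi else 0)"
proof (cases "k = 0")
  case True
  then show ?thesis by (simp add: scaleR_conv_of_real)
next
  case False
  have deriv: "((\<lambda>z. cis (of_int k * z) / (\<i> * of_int k)) has_vector_derivative cis (of_int k * z)) (at z within A)" for z A
    using cis_antiderivative[of "of_int k"] False by simp
  have "(LINT z|lborel. indicator {- pi..pi} z *\<^sub>R cis (of_int k * z))
      = cis (of_int k * pi) / (\<i> * of_int k) - cis (of_int k * - pi) / (\<i> * of_int k)"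
    by (rule integral_FTC_atLeastAtMost[OF _ deriv]) (auto intro!: continuous_intros)
  moreover have "cis (of_int k * pi) = cis (of_int k * - pi)"
  proof -
    have "sin (of_int k * pi) = 0" by (simp add: sin_times_pi_eq_0)
    then show ?thesis by (simp add: complex_eq_iff)
  qed
  ultimately show ?thesis using False by simp
qed

lemma integrable_on_period:
  assumes "continuous_on UNIV f"
  shows "integrable lborel (\<lambda>z. indicator {- pi..pi} z *\<^sub>R (f z :: complex))"
  using borel_integrable_atLeastAtMost'[OF continuous_on_subset[OF assms subset_UNIV], of "-pi" pi]
  by (simp add: set_integrable_def)

text \<open>Multiplying by \<open>cis z\<close> or \<open>cis (- z)\<close> shifts the Fourier index, which is the recursion of \<open>tcoef\<close>
  at \<open>\<mu> = 0\<close>.\<close>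
lemma kernel1_coefficient:
  assumes "0 \<le> r"
  shows "(LINT z|lborel. indicator {- pi..pi} z *\<^sub>R
      ((of_real (sqrt r) * (\<zeta> * cis z - cnj \<zeta> * cis (- z))) ^ j * cis (of_int k * z)))
    = 2 * of_real pi * tcoef j \<zeta> r 0 k" (is "?I j k = _")
proof (induction j arbitrary: k)
  case 0
  then show ?case by (simp add: integral_cis_period)
next
  case (Suc j)
  let ?T = "\<lambda>z. of_real (sqrt r) * (\<zeta> * cis z - cnj \<zeta> * cis (- z))"
  let ?f = "\<lambda>k z. indicator {- pi..pi} z *\<^sub>R (?T z ^ j * cis (of_int k * z))"
  have int: "integrable lborel (?f k)" for k
    by (rule integrable_on_period) (intro continuous_intros)
  have split: "indicator {- pi..pi} z *\<^sub>R (?T z ^ Suc j * cis (of_int k * z))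
      = of_real (sqrt r) * \<zeta> * ?f (k + 1) z - of_real (sqrt r) * cnj \<zeta> * ?f (k - 1) z" for z
  proof -
    have "cis (of_int (k + 1) * z) = cis z * cis (of_int k * z)"
      "cis (of_int (k - 1) * z) = cis (- z) * cis (of_int k * z)"
      by (simp_all add: cis_mult algebra_simps)
    then show ?thesis by (simp add: algebra_simps scaleR_conv_of_real)
  qed
  have "?I (Suc j) k = (LINT z|lborel. of_real (sqrt r) * \<zeta> * ?f (k + 1) z) - (LINT z|lborel. of_real (sqrt r) * cnj \<zeta> * ?f (k - 1) z)"
    unfolding split by (intro Bochner_Integration.integral_diff integrable_mult_right int)
  then have "?I (Suc j) k = of_real (sqrt r) * \<zeta> * (LINT z|lborel. ?f (k + 1) z) - of_real (sqrt r) * cnj \<zeta> * (LINT z|lborel. ?f (k - 1) z)"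
    by (simp only: integral_mult_right_zero)
  then show ?case unfolding Suc.IH by (simp add: algebra_simps)
qed

text \<open>With \<open>\<zeta> = y + i sgn x \<eta>\<close> the exponent in the kernel is
  \<open>\<bar>x\<bar>\<^sup>1\<^sup>/\<^sup>2 (\<zeta> cis z - cnj \<zeta> cis (- z)) + i k z\<close>; the exponential series of its first part may be
  integrated term by term.\<close>
lemma kernel1_eq_phi: "kernel1 x k y \<eta> = phi (Complex y (sgn x * \<eta>)) \<bar>x\<bar> 0 k"
proof -
  define \<zeta> where "\<zeta> = Complex y (sgn x * \<eta>)"
  let ?T = "\<lambda>z. of_real (sqrt \<bar>x\<bar>) * (\<zeta> * cis z - cnj \<zeta> * cis (- z))"
  let ?f = "\<lambda>j z. indicator {- pi..pi} z *\<^sub>R (?T z ^ j / fact j * cis (of_int k * z))"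
  define B where "B = sqrt \<bar>x\<bar> * (norm \<zeta> + norm \<zeta>)"
  have T_le: "norm (?T z) \<le> B" for z
  proof -
    have "norm (\<zeta> * cis z - cnj \<zeta> * cis (- z)) \<le> norm \<zeta> + norm \<zeta>"
      by (rule order_trans[OF norm_triangle_ineq4]) (simp add: norm_mult)
    then show ?thesis unfolding B_def norm_mult norm_of_real
      by (intro mult_mono) auto
  qed
  have f_le: "norm (?f j z) \<le> indicator {- pi..pi} z * (B ^ j / fact j)" for j z
    using power_mono[OF T_le[of z] norm_ge_zero, of j]
    by (auto simp: norm_mult norm_divide norm_power divide_right_mono split: split_indicator)
  have int: "integrable lborel (?f j)" for j
    by (rule integrable_on_period) (intro continuous_intros, auto)
  have summable_B: "summable (\<lambda>j. B ^ j / fact j)"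
    using summable_exp[of B] by (simp add: divide_inverse mult.commute)
  have sum_f: "(\<Sum>j. ?f j z) = indicator {- pi..pi} z *\<^sub>R
      cis (2 * \<bar>x\<bar> powr (1 / 2) * (y * sin z + \<eta> * sgn x * cos z) + of_int k * z)" for z
  proof -
    have "?T z = \<i> * of_real (2 * \<bar>x\<bar> powr (1 / 2) * (y * sin z + \<eta> * sgn x * cos z))"
      by (simp add: complex_eq_iff \<zeta>_def powr_half_sqrt algebra_simps)
    then have "exp (?T z) = cis (2 * \<bar>x\<bar> powr (1 / 2) * (y * sin z + \<eta> * sgn x * cos z))"
      by (simp only: cis_conv_exp)
    moreover have "(\<lambda>j. ?T z ^ j / fact j) sums exp (?T z)"
      using exp_converges[of "?T z"] by (simp add: scaleR_conv_of_real divide_inverse mult.commute)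
    ultimately have "(\<lambda>j. ?f j z) sums (indicator {- pi..pi} z *\<^sub>R
        (cis (2 * \<bar>x\<bar> powr (1 / 2) * (y * sin z + \<eta> * sgn x * cos z)) * cis (of_int k * z)))"
      by (intro sums_scaleR_right sums_mult2) simp
    then show ?thesis by (simp add: sums_iff cis_mult)
  qed
  have "(\<lambda>j. (LINT z|lborel. ?f j z)) sums (LINT z|lborel. (\<Sum>j. ?f j z))"
  proof (rule sums_integral[OF int])
    show "AE z in lborel. summable (\<lambda>j. norm (?f j z))"
      by (intro AE_I2 summable_comparison_test'[OF summable_mult[OF summable_B], of 0]) (use f_le in simp)
    show "summable (\<lambda>j. LINT z|lborel. norm (?f j z))"
    proof (rule summable_comparison_test'[OF summable_mult[OF summable_B], of 0])
      fix j :: nat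
      have "integrable lborel (\<lambda>z. indicator {- pi..pi} z :: real)" by simp
      then have "(LINT z|lborel. norm (?f j z)) \<le> (LINT z|lborel. indicator {- pi..pi} z * (B ^ j / fact j))"
        by (intro integral_mono integrable_norm int integrable_mult_left f_le)
      then show "norm (LINT z|lborel. norm (?f j z)) \<le> 2 * pi * (B ^ j / fact j)"
        by simp
    qed
  qed
  moreover have "(LINT z|lborel. ?f j z) = 2 * of_real pi * (tcoef j \<zeta> \<bar>x\<bar> 0 k / fact j)" for j
  proof -
    have "(LINT z|lborel. ?f j z) = (LINT z|lborel. (indicator {- pi..pi} z *\<^sub>R (?T z ^ j * cis (of_int k * z))) / fact j)"
      by (intro Bochner_Integration.integral_cong) (auto simp: scaleR_conv_of_real)
    then show ?thesis using kernel1_coefficient[of "\<bar>x\<bar>" \<zeta> j k] by simp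
  qed
  ultimately have "(\<lambda>j. 2 * of_real pi * (tcoef j \<zeta> \<bar>x\<bar> 0 k / fact j)) sums (LINT z|lborel. (\<Sum>j. ?f j z))"
    by simp
  then have "(\<lambda>j. 1 / (2 * of_real pi) * (2 * of_real pi * (tcoef j \<zeta> \<bar>x\<bar> 0 k / fact j))) sums
      (1 / (2 * of_real pi) * (LINT z|lborel. (\<Sum>j. ?f j z)))"
    by (rule sums_mult)
  then have "phi \<zeta> \<bar>x\<bar> 0 k = 1 / (2 * of_real pi) * (LINT z|lborel. (\<Sum>j. ?f j z))"
    by (simp add: phi_def sums_iff)
  also have "\<dots> = kernel1 x k y \<eta>"
    unfolding kernel1_def sum_f set_lebesgue_integral_def
    by (subst integral_completion) (auto intro!: borel_measurable_continuous_onI continuous_intros borel_measurable_scaleR)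
  finally show ?thesis by (simp add: \<zeta>_def)
qed

lemma norm_kernel1_le_1: "norm (kernel1 x k y \<eta>) \<le> 1"
proof -
  let ?g = "\<lambda>z. cis (2 * \<bar>x\<bar> powr (1 / 2) * (y * sin z + \<eta> * sgn x * cos z) + of_int k * z)"
  have int: "integrable lborel (\<lambda>z. indicator {- pi..pi} z *\<^sub>R ?g z)"
    by (rule integrable_on_period) (intro continuous_intros)
  have eq: "(LINT z:{-pi..pi}|lebesgue. ?g z) = (LINT z|lborel. indicator {- pi..pi} z *\<^sub>R ?g z)"
    unfolding set_lebesgue_integral_def using int by (intro integral_completion) simp
  have "norm (LINT z|lborel. indicator {- pi..pi} z *\<^sub>R ?g z) \<le> (LINT z|lborel. indicator {- pi..pi} z)"
    by (rule order_trans[OF integral_norm_bound integral_mono[OF integrable_norm[OF int]]])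
      (auto split: split_indicator)
  then have "norm (LINT z:{-pi..pi}|lebesgue. ?g z) \<le> 2 * pi"
    unfolding eq by simp
  then show ?thesis unfolding kernel1_def norm_mult by (simp add: norm_divide)
qed

section \<open>The kernel on the completed frequency space\<close>

text \<open>Lebesgue measure on \<open>real ^ 'd\<close> is the image of the product measure indexed by the basis vectors
  \<open>axis j 1\<close>.\<close>
lemma vec_lborel_prod:
  fixes f :: "'d::finite \<Rightarrow> real \<Rightarrow> complex"
  assumes int: "\<And>j. integrable lborel (f j)"
  shows vec_lborel_integrable_prod: "integrable lborel (\<lambda>x :: real ^ 'd. \<Prod>j\<in>UNIV. f j (x $ j))"
    and vec_lborel_integral_prod:
      "(LINT x|(lborel :: (real ^ 'd) measure). (\<Prod>j\<in>UNIV. f j (x $ j))) = (\<Prod>j\<in>UNIV. LINT t|lborel. f j t)"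
proof -
  have [measurable]: "f j \<in> borel_measurable borel" for j
    using borel_measurable_integrable[OF int] by simp
  have [measurable]: "(\<lambda>x :: real ^ 'd. x $ j) \<in> borel_measurable borel" for j
    by (intro borel_measurable_continuous_onI continuous_intros)
  let ?e = "\<lambda>j::'d. axis j (1::real)"
  have bij: "bij_betw ?e UNIV (Basis :: (real ^ 'd) set)"
    by (auto simp: bij_betw_def inj_on_def axis_eq_axis Basis_vec_def)
  interpret product_sigma_finite "\<lambda>_ :: real ^ 'd. lborel :: real measure" ..
  let ?M = "Pi\<^sub>M (Basis :: (real ^ 'd) set) (\<lambda>_. lborel :: real measure)"
  let ?T = "\<lambda>F. \<Sum>b\<in>(Basis :: (real ^ 'd) set). F b *\<^sub>R b"
  define h where "h = (\<lambda>b. f (the_inv_into UNIV ?e b))"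
  have h: "h (?e j) = f j" for j
    unfolding h_def by (subst the_inv_into_f_f[OF bij_betw_imp_inj_on[OF bij]]) simp_all
  have T: "?T F $ j = F (?e j)" for F j
  proof -
    have "?T F = (\<Sum>i\<in>UNIV. F (?e i) *\<^sub>R ?e i)"
      by (rule sum.reindex_bij_betw[OF bij, symmetric])
    then show ?thesis
      by (simp add: axis_def if_distrib sum.delta' cong: if_cong)
  qed
  have prod: "(\<Prod>j\<in>UNIV. f j (?T F $ j)) = (\<Prod>b\<in>Basis. h b (F b))" for F
    unfolding T prod.reindex_bij_betw[OF bij, symmetric] h ..
  have int_h: "b \<in> Basis \<Longrightarrow> integrable lborel (h b)" for b
    unfolding h_def by (rule int)
  have T_meas: "?T \<in> measurable ?M borel" by measurable
  have f_meas: "(\<lambda>x :: real ^ 'd. \<Prod>j\<in>UNIV. f j (x $ j)) \<in> borel_measurable borel" by measurable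
  show "integrable lborel (\<lambda>x :: real ^ 'd. \<Prod>j\<in>UNIV. f j (x $ j))"
    unfolding lborel_eq[where 'a = "real ^ 'd"] integrable_distr_eq[OF T_meas f_meas] prod
    by (intro product_integrable_prod int_h) simp_all
  have "(LINT x|(lborel :: (real ^ 'd) measure). (\<Prod>j\<in>UNIV. f j (x $ j))) = (LINT F|?M. (\<Prod>b\<in>Basis. h b (F b)))"
    unfolding lborel_eq[where 'a = "real ^ 'd"] integral_distr[OF T_meas f_meas] prod ..
  also have "\<dots> = (\<Prod>b\<in>Basis. LINT t|lborel. h b t)"
    by (intro product_integral_prod int_h) simp
  also have "\<dots> = (\<Prod>j\<in>UNIV. LINT t|lborel. f j t)"
    unfolding prod.reindex_bij_betw[OF bij, symmetric] h ..
  finally show "(LINT x|(lborel :: (real ^ 'd) measure). (\<Prod>j\<in>UNIV. f j (x $ j))) = (\<Prod>j\<in>UNIV. LINT t|lborel. f j t)" .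
qed

lemma sqrt_prod: "sqrt (\<Prod>i\<in>A. f i) = (\<Prod>i\<in>A. sqrt (f i))"
  by (induction A rule: infinite_finite_induct) (simp_all add: real_sqrt_mult)

lemma hermite_eq_prod:
  fixes n :: "nat ^ 'd::finite"
  shows "hermite n x = (\<Prod>j\<in>UNIV. hermite_unit (n $ j) (x $ j))"
proof -
  have pi_root: "(\<Prod>j\<in>(UNIV :: 'd set). sqrt (sqrt pi)) = pi powr (real CARD('d) / 4)"
    by (simp add: powr_half_sqrt[symmetric] powr_powr powr_power)
  have norm: "sqrt (2 ^ (\<Sum>j\<in>UNIV. n $ j) * (\<Prod>j\<in>UNIV. fact (n $ j)))
      = (\<Prod>j\<in>UNIV. sqrt (2 ^ (n $ j) * fact (n $ j)))"
    unfolding power_sum prod.distrib[symmetric] sqrt_prod ..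
  have "hermite n x = (\<Prod>j\<in>UNIV. hermite1 (n $ j) (x $ j))
      / ((\<Prod>j\<in>UNIV. sqrt (2 ^ (n $ j) * fact (n $ j))) * (\<Prod>j\<in>(UNIV :: 'd set). sqrt (sqrt pi)))"
  proof -
    have "inverse c * P / N = P / (N * c)" for c P N :: real by (simp add: divide_inverse)
    then show ?thesis
      unfolding hermite_def creation_fold norm pi_root minus_divide_left[symmetric] powr_minus .
  qed
  also have "\<dots> = (\<Prod>j\<in>UNIV. hermite_unit (n $ j) (x $ j))"
    unfolding hermite_unit_def by (simp add: prod_dividef prod.distrib real_sqrt_mult)
  finally show ?thesis .
qed

lemma hermite_scaled_eq_prod:
  fixes n :: "nat ^ 'd::finite"
  shows "hermite_scaled n l x
    = (\<Prod>j\<in>UNIV. \<bar>l\<bar> powr (1 / 4) * hermite_unit (n $ j) (sqrt \<bar>l\<bar> * x $ j))"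
proof (cases "l = 0")
  case False
  then have "\<bar>l\<bar> powr (real CARD('d) / 4) = (\<bar>l\<bar> powr (1 / 4)) ^ CARD('d)"
    by (simp add: powr_power)
  then show ?thesis
    by (simp add: hermite_scaled_def hermite_eq_prod prod.distrib powr_half_sqrt)
qed (simp add: hermite_scaled_def)

text \<open>Each coordinate is rescaled by \<open>z \<mapsto> \<bar>l\<bar>\<^sup>1\<^sup>/\<^sup>2 z\<close>; the two factors \<open>\<bar>l\<bar>\<^sup>1\<^sup>/\<^sup>4\<close> of the scaled Hermite
  functions are the Jacobian.\<close>
lemma wigner_eq_prod:
  fixes n m :: "nat ^ 'd::finite"
  assumes l: "l \<noteq> 0"
  shows "wigner (n, m, l) (y, \<eta>)
    = (\<Prod>j\<in>UNIV. wig1 (n $ j) (m $ j) (sqrt \<bar>l\<bar> * y $ j) (sqrt \<bar>l\<bar> * (sgn l * \<eta> $ j)))"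
proof -
  let ?c = "sqrt \<bar>l\<bar>"
  let ?g = "\<lambda>j x. cis (2 * (?c * (sgn l * \<eta> $ j)) * x)
      * of_real (hermite_unit (n $ j) (?c * y $ j + x) * hermite_unit (m $ j) (x - ?c * y $ j))"
  have c: "?c > 0" using l by simp
  have cc: "?c * ?c * sgn l = l" using l by (simp add: sgn_if)
  define F where "F = (\<lambda>j t. of_real ?c * ?g j (?c * t))"
  have gint: "integrable lborel (?g j)" for j by (rule integrable_wig1)
  have Fint: "integrable lborel (F j)" for j
    unfolding F_def using lborel_integrable_real_affine[OF gint[of j], where c = ?c and t = 0] c
    by (intro integrable_mult_right) simp
  have F: "(LINT t|lborel. F j t) = wig1 (n $ j) (m $ j) (?c * y $ j) (?c * (sgn l * \<eta> $ j))" for j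
    unfolding F_def wig1_def
    using lborel_integral_real_affine[of ?c "?g j" 0] c by (simp add: scaleR_conv_of_real)
  have root: "\<bar>l\<bar> powr (1 / 4) * \<bar>l\<bar> powr (1 / 4) = ?c"
    using l by (simp add: powr_add[symmetric] powr_half_sqrt)
  have factor: "cis (2 * l * (\<eta> \<bullet> z)) * of_real (hermite_scaled n l (y + z)) * of_real (hermite_scaled m l (- y + z))
      = (\<Prod>j\<in>UNIV. F j (z $ j))" for z
  proof -
    have "cis (2 * l * (\<eta> \<bullet> z)) = (\<Prod>j\<in>UNIV. cis (2 * l * (\<eta> $ j * z $ j)))"
      by (simp add: cis_conv_exp inner_vec_def sum_distrib_left exp_sum)
    moreover have "F j t = cis (2 * l * (\<eta> $ j * t)) * of_real (\<bar>l\<bar> powr (1 / 4) * hermite_unit (n $ j) (?c * (y $ j + t)))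
        * of_real (\<bar>l\<bar> powr (1 / 4) * hermite_unit (m $ j) (?c * (- y $ j + t)))" for j t
    proof -
      have 1: "2 * (?c * (sgn l * \<eta> $ j)) * (?c * t) = 2 * l * (\<eta> $ j * t)"
        by (subst (3) cc[symmetric]) (simp only: mult_ac)
      have 2: "of_real (\<bar>l\<bar> powr (1 / 4) * a) * of_real (\<bar>l\<bar> powr (1 / 4) * b) = complex_of_real (?c * (a * b))" for a b
        unfolding root[symmetric] by simp
      show ?thesis unfolding F_def 1 unfolding mult.assoc 2 by (simp add: algebra_simps)
    qed
    ultimately show ?thesis
      by (simp add: hermite_scaled_eq_prod prod.distrib)
  qed
  have "(\<lambda>z. \<Prod>j\<in>UNIV. F j (z $ j)) \<in> borel_measurable lborel"
    by (rule borel_measurable_integrable[OF vec_lborel_integrable_prod[OF Fint]])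
  then have "wigner (n, m, l) (y, \<eta>) = (LINT z|lborel. (\<Prod>j\<in>UNIV. F j (z $ j)))"
    unfolding wigner.simps factor by (rule integral_completion)
  then show ?thesis unfolding vec_lborel_integral_prod[OF Fint] F .
qed

definition embed_x :: "'d::finite freq + 'd freq0 \<Rightarrow> real ^ 'd" where
  "embed_x p = fst (hat_embed p)"

definition embed_l :: "'d::finite freq + 'd freq0 \<Rightarrow> real" where
  "embed_l p = snd (snd (hat_embed p))"

fun embed_k :: "'d::finite freq + 'd freq0 \<Rightarrow> 'd \<Rightarrow> int" where
  "embed_k (Inl (n, m, l)) j = int (m $ j) - int (n $ j)"
| "embed_k (Inr (x, k)) j = k $ j"

lemma of_int_embed_k: "of_int (embed_k p j) = fst (snd (hat_embed p)) $ j"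
  by (cases "(p, j)" rule: embed_k.cases) (auto simp: vec_nat_def vec_int_def)

fun hat_kernel :: "'d::finite freq + 'd freq0 \<Rightarrow> (real ^ 'd) \<times> (real ^ 'd) \<Rightarrow> complex" where
  "hat_kernel (Inl w) Y = wigner w Y"
| "hat_kernel (Inr v) Y = heis_kernel v Y"

text \<open>For a regular point the coordinate \<open>x = \<lambda>(n + m)\<close> has the sign of \<open>\<lambda>\<close> unless it is 0, and for a
  boundary point the kernel contains \<open>sgn x\<close>. At \<open>x = 0\<close> one has \<open>n = m = 0\<close> or \<open>\<lambda> = 0\<close>, and then both
  signs give the same value by \<open>phi_ground_state\<close> and \<open>phi_origin\<close>.\<close>
definition side :: "real \<Rightarrow> real" where
  "side x = (if x < 0 then -1 else 1)"

definition phi_side :: "real \<Rightarrow> real \<Rightarrow> real \<Rightarrow> real \<Rightarrow> int \<Rightarrow> complex" where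
  "phi_side y \<eta> x \<mu> k = phi (Complex y (side x * \<eta>)) \<bar>x\<bar> \<mu> k"

lemma phi_ground_state:
  assumes "0 \<le> \<mu>"
  shows "phi \<zeta> 0 \<mu> 0 = of_real (exp (- (\<mu> * (cmod \<zeta>)\<^sup>2)))"
  using wig1_eq_phi[OF assms, of 0 0 \<zeta>] assms
  by (simp add: wig1_0_0 cmod_power2 power_mult_distrib algebra_simps)

lemma phi_origin: "phi \<zeta> 0 0 k = (if k = 0 then 1 else 0)"
proof -
  have "tcoef j \<zeta> 0 0 k / fact j = (if j = 0 then (if k = 0 then 1 else 0) else 0)" for j
    by (cases j) auto
  then show ?thesis
    using sums_unique[OF sums_single[of 0 "\<lambda>_. if k = 0 then 1 else 0 :: complex"]]
    unfolding phi_def by simp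
qed

text \<open>Regular and boundary points are described by one formula in the coordinates of \<open>hat_embed\<close>, so that
  continuity does not have to distinguish them.\<close>
lemma hat_kernel_eq_prod:
  assumes "p \<in> tilde_H <+> hat_H0"
  shows "hat_kernel p (y, \<eta>)
    = (\<Prod>j\<in>UNIV. phi_side (y $ j) (\<eta> $ j) (embed_x p $ j) \<bar>embed_l p\<bar> (embed_k p j))"
proof (cases p)
  case (Inl w)
  obtain n m l where w: "w = (n, m, l)" by (cases w) auto
  have l: "l \<noteq> 0" using assms Inl w by (auto simp: tilde_H_def)
  have "wig1 (n $ j) (m $ j) (sqrt \<bar>l\<bar> * y $ j) (sqrt \<bar>l\<bar> * (sgn l * \<eta> $ j))
      = phi_side (y $ j) (\<eta> $ j) (embed_x p $ j) \<bar>embed_l p\<bar> (embed_k p j)" for j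
  proof -
    let ?N = "real (n $ j) + real (m $ j)"
    have x: "embed_x p $ j = l * ?N" "embed_l p = l" "embed_k p j = int (m $ j) - int (n $ j)"
      by (simp_all add: embed_x_def embed_l_def Inl w vec_nat_def)
    have W: "wig1 (n $ j) (m $ j) (sqrt \<bar>l\<bar> * y $ j) (sqrt \<bar>l\<bar> * (sgn l * \<eta> $ j))
        = phi (Complex (y $ j) (sgn l * \<eta> $ j)) (\<bar>l\<bar> * ?N) \<bar>l\<bar> (int (m $ j) - int (n $ j))"
      using wig1_eq_phi[of "\<bar>l\<bar>" "n $ j" "m $ j" "Complex (y $ j) (sgn l * \<eta> $ j)"] by simp
    show ?thesis
    proof (cases "?N = 0")
      case True
      then have "n $ j = 0" "m $ j = 0" by linarith+
      then show ?thesis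
        unfolding W x phi_side_def using l
        by (simp add: phi_ground_state cmod_power2 side_def power_mult_distrib sgn_if)
    next
      case False
      then have "?N > 0" by linarith
      then have "side (l * ?N) = sgn l" "\<bar>l * ?N\<bar> = \<bar>l\<bar> * ?N"
        using l by (auto simp: side_def sgn_if mult_less_0_iff abs_mult)
      then show ?thesis unfolding W x phi_side_def by simp
    qed
  qed
  then show ?thesis unfolding Inl w hat_kernel.simps wigner_eq_prod[OF l] by simp
next
  case (Inr v)
  obtain x k where v: "v = (x, k)" by (cases v) auto
  have "kernel1 (x $ j) (k $ j) (y $ j) (\<eta> $ j) = phi_side (y $ j) (\<eta> $ j) (embed_x p $ j) \<bar>embed_l p\<bar> (embed_k p j)" for j
  proof (cases "x $ j = 0")
    case True
    then show ?thesis
      by (simp add: kernel1_eq_phi phi_side_def phi_origin embed_x_def embed_l_def Inr v)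
  next
    case False
    then have "side (x $ j) = sgn (x $ j)" by (simp add: side_def sgn_if)
    then show ?thesis
      by (simp add: kernel1_eq_phi phi_side_def embed_x_def embed_l_def Inr v)
  qed
  then show ?thesis by (simp add: Inr v)
qed

text \<open>If the limit \<open>x0\<close> is not 0, the side is eventually constant. If \<open>x0 = 0\<close>, the sequence may alternate
  between the two sides, but both limits agree.\<close>
lemma tendsto_phi_side:
  assumes x: "x \<longlonglongrightarrow> x0" and mu: "\<mu> \<longlonglongrightarrow> \<mu>0" and pos: "\<And>p. 0 \<le> \<mu> p"
    and compat: "x0 = 0 \<Longrightarrow> k = 0 \<or> \<mu>0 = 0"
  shows "(\<lambda>p. phi_side y \<eta> (x p) (\<mu> p) k) \<longlonglongrightarrow> phi_side y \<eta> x0 \<mu>0 k"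
proof -
  define A where "A = (\<lambda>s p. phi (Complex y (s * \<eta>)) \<bar>x p\<bar> (\<mu> p) k)"
  have lim: "A s \<longlonglongrightarrow> phi (Complex y (s * \<eta>)) \<bar>x0\<bar> \<mu>0 k" for s
    unfolding A_def by (intro tendsto_phi tendsto_rabs x mu pos)
  have val: "(\<lambda>p. phi_side y \<eta> (x p) (\<mu> p) k) = (\<lambda>p. if x p < 0 then A (-1) p else A 1 p)"
    by (auto simp: phi_side_def side_def A_def)
  consider "x0 < 0" | "x0 > 0" | "x0 = 0" by linarith
  then show ?thesis
  proof cases
    case 1
    have "\<forall>\<^sub>F p in sequentially. x p < 0" using order_tendstoD(2)[OF x 1] .
    then have "\<forall>\<^sub>F p in sequentially. A (-1) p = phi_side y \<eta> (x p) (\<mu> p) k"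
      by eventually_elim (simp add: phi_side_def side_def A_def)
    with lim[of "-1"] 1 show ?thesis
      by (simp add: phi_side_def side_def tendsto_cong)
  next
    case 2
    have "\<forall>\<^sub>F p in sequentially. 0 < x p" using order_tendstoD(1)[OF x 2] .
    then have "\<forall>\<^sub>F p in sequentially. A 1 p = phi_side y \<eta> (x p) (\<mu> p) k"
      by eventually_elim (simp add: phi_side_def side_def A_def)
    with lim[of 1] 2 show ?thesis
      by (simp add: phi_side_def side_def tendsto_cong)
  next
    case 3
    have "0 \<le> \<mu>0" using mu pos by (intro LIMSEQ_le_const) auto
    then have "phi (Complex y (- \<eta>)) 0 \<mu>0 k = phi (Complex y \<eta>) 0 \<mu>0 k"
      using compat[OF 3] by (auto simp: phi_origin phi_ground_state cmod_power2)
    then show ?thesis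
      using lim[of 1] lim[of "-1"] unfolding val 3
      by (intro filterlim_If tendsto_mono[OF inf_le1]) (simp_all add: phi_side_def side_def)
  qed
qed

text \<open>The second term of the distance is a sum of absolute values of integers, so the integer coordinates
  of a convergent sequence are eventually constant.\<close>
lemma hat_tendsto:
  fixes \<omega> :: "nat \<Rightarrow> 'd::finite hat_H"
  assumes "\<omega> \<longlonglongrightarrow> \<omega>0"
  shows "(\<lambda>p. embed_x (Rep_hat_H (\<omega> p)) $ j) \<longlonglongrightarrow> embed_x (Rep_hat_H \<omega>0) $ j"
    and "(\<lambda>p. embed_l (Rep_hat_H (\<omega> p))) \<longlonglongrightarrow> embed_l (Rep_hat_H \<omega>0)"
    and "\<forall>\<^sub>F p in sequentially. embed_k (Rep_hat_H (\<omega> p)) j = embed_k (Rep_hat_H \<omega>0) j"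
proof -
  have d: "(\<lambda>p. dist (\<omega> p) \<omega>0) \<longlonglongrightarrow> 0" using assms by (rule tendsto_dist_iff[THEN iffD1])
  have comp: "\<bar>v $ j\<bar> \<le> norm_l1 v" for v :: "real ^ 'd"
    unfolding norm_l1_def by (rule member_le_sum) auto
  have le: "\<bar>embed_x (Rep_hat_H \<xi>) $ j - embed_x (Rep_hat_H \<omega>0) $ j\<bar> \<le> dist \<xi> \<omega>0"
    "\<bar>embed_l (Rep_hat_H \<xi>) - embed_l (Rep_hat_H \<omega>0)\<bar> \<le> dist \<xi> \<omega>0"
    "\<bar>of_int (embed_k (Rep_hat_H \<xi>) j) - of_int (embed_k (Rep_hat_H \<omega>0) j)\<bar> \<le> dist \<xi> \<omega>0" for \<xi>
    unfolding dist_hat_H_def hat_dist_embed embed_x_def embed_l_def of_int_embed_k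
    using comp[of "fst (hat_embed (Rep_hat_H \<xi>)) - fst (hat_embed (Rep_hat_H \<omega>0))"]
      comp[of "fst (snd (hat_embed (Rep_hat_H \<xi>))) - fst (snd (hat_embed (Rep_hat_H \<omega>0)))"]
      norm_l1_nonneg[of "fst (hat_embed (Rep_hat_H \<xi>)) - fst (hat_embed (Rep_hat_H \<omega>0))"]
      norm_l1_nonneg[of "fst (snd (hat_embed (Rep_hat_H \<xi>))) - fst (snd (hat_embed (Rep_hat_H \<omega>0)))"]
    by simp_all
  show "(\<lambda>p. embed_x (Rep_hat_H (\<omega> p)) $ j) \<longlonglongrightarrow> embed_x (Rep_hat_H \<omega>0) $ j"
    by (rule LIM_zero_cancel, rule Lim_null_comparison[OF _ d]) (simp add: le)
  show "(\<lambda>p. embed_l (Rep_hat_H (\<omega> p))) \<longlonglongrightarrow> embed_l (Rep_hat_H \<omega>0)"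
    by (rule LIM_zero_cancel, rule Lim_null_comparison[OF _ d]) (simp add: le)
  have "\<forall>\<^sub>F p in sequentially. dist (\<omega> p) \<omega>0 < 1" using assms by (rule tendstoD) simp
  then show "\<forall>\<^sub>F p in sequentially. embed_k (Rep_hat_H (\<omega> p)) j = embed_k (Rep_hat_H \<omega>0) j"
  proof eventually_elim
    case (elim p)
    then have "\<bar>real_of_int (embed_k (Rep_hat_H (\<omega> p)) j) - of_int (embed_k (Rep_hat_H \<omega>0) j)\<bar> < 1"
      using le(3)[of "\<omega> p"] by linarith
    then show ?case by linarith
  qed
qed

lemma tendsto_hat_kernel:
  fixes \<omega> :: "nat \<Rightarrow> 'd::finite hat_H"
  assumes "\<omega> \<longlonglongrightarrow> \<omega>0"
  shows "(\<lambda>p. hat_kernel (Rep_hat_H (\<omega> p)) Y) \<longlonglongrightarrow> hat_kernel (Rep_hat_H \<omega>0) Y"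
proof -
  obtain y \<eta> where Y: "Y = (y, \<eta>)" by (cases Y) auto
  have compat: "embed_k (Rep_hat_H \<omega>0) j = 0 \<or> \<bar>embed_l (Rep_hat_H \<omega>0)\<bar> = 0"
    if "embed_x (Rep_hat_H \<omega>0) $ j = 0" for j
  proof (cases "(Rep_hat_H \<omega>0, j)" rule: embed_k.cases)
    case (1 n m l j)
    then have "l \<noteq> 0" using Rep_hat_H[of \<omega>0] by (auto simp: tilde_H_def)
    then show ?thesis
      using that 1 by (auto simp: embed_x_def vec_nat_def)
  qed (auto simp: embed_l_def)
  have "(\<lambda>p. phi_side (y $ j) (\<eta> $ j) (embed_x (Rep_hat_H (\<omega> p)) $ j) \<bar>embed_l (Rep_hat_H (\<omega> p))\<bar> (embed_k (Rep_hat_H (\<omega> p)) j))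
     \<longlonglongrightarrow> phi_side (y $ j) (\<eta> $ j) (embed_x (Rep_hat_H \<omega>0) $ j) \<bar>embed_l (Rep_hat_H \<omega>0)\<bar> (embed_k (Rep_hat_H \<omega>0) j)" for j
  proof -
    have "(\<lambda>p. phi_side (y $ j) (\<eta> $ j) (embed_x (Rep_hat_H (\<omega> p)) $ j) \<bar>embed_l (Rep_hat_H (\<omega> p))\<bar> (embed_k (Rep_hat_H \<omega>0) j))
     \<longlonglongrightarrow> phi_side (y $ j) (\<eta> $ j) (embed_x (Rep_hat_H \<omega>0) $ j) \<bar>embed_l (Rep_hat_H \<omega>0)\<bar> (embed_k (Rep_hat_H \<omega>0) j)"
      by (intro tendsto_phi_side tendsto_rabs hat_tendsto assms compat) auto
    moreover have "\<forall>\<^sub>F p in sequentially.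
        phi_side (y $ j) (\<eta> $ j) (embed_x (Rep_hat_H (\<omega> p)) $ j) \<bar>embed_l (Rep_hat_H (\<omega> p))\<bar> (embed_k (Rep_hat_H \<omega>0) j)
        = phi_side (y $ j) (\<eta> $ j) (embed_x (Rep_hat_H (\<omega> p)) $ j) \<bar>embed_l (Rep_hat_H (\<omega> p))\<bar> (embed_k (Rep_hat_H (\<omega> p)) j)"
      using hat_tendsto(3)[OF assms, of j] by eventually_elim simp
    ultimately show ?thesis by (rule Lim_transform_eventually)
  qed
  then show ?thesis
    unfolding Y hat_kernel_eq_prod[OF Rep_hat_H] by (intro tendsto_prod)
qed

lemma norm_hat_kernel_le_1:
  assumes "p \<in> tilde_H <+> hat_H0"
  shows "norm (hat_kernel p Y) \<le> 1"
proof -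
  obtain y \<eta> where Y: "Y = (y, \<eta>)" by (cases Y) auto
  show ?thesis
  proof (cases p)
    case (Inl w)
    obtain n m l where w: "w = (n, m, l)" by (cases w) auto
    have l: "l \<noteq> 0" using assms Inl w by (auto simp: tilde_H_def)
    show ?thesis
      unfolding Y Inl w hat_kernel.simps wigner_eq_prod[OF l] prod_norm[symmetric]
      by (intro prod_le_1 conjI norm_ge_zero norm_wig1_le_1)
  next
    case (Inr v)
    obtain x k where v: "v = (x, k)" by (cases v) auto
    show ?thesis
      unfolding Y Inr v hat_kernel.simps heis_kernel.simps prod_norm[symmetric]
      by (intro prod_le_1 conjI norm_ge_zero norm_kernel1_le_1)
  qed
qed

lemma hat_kernel_measurable:
  fixes p :: "'d::finite freq + 'd freq0"
  assumes "p \<in> tilde_H <+> hat_H0"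
  shows "hat_kernel p \<in> borel_measurable borel"
proof -
  have [measurable]: "(\<lambda>Y :: (real ^ 'd) \<times> (real ^ 'd). Complex (fst Y $ j) (s * snd Y $ j)) \<in> borel_measurable borel" for j s
    unfolding Complex_eq by (intro borel_measurable_continuous_onI continuous_intros)
  have "hat_kernel p = (\<lambda>Y. \<Prod>j\<in>UNIV. phi_side (fst Y $ j) (snd Y $ j) (embed_x p $ j) \<bar>embed_l p\<bar> (embed_k p j))"
    using hat_kernel_eq_prod[OF assms] by (auto simp: fun_eq_iff)
  then show ?thesis unfolding phi_side_def by simp
qed

text \<open>The Fourier transform and the boundary integral in one formula; \<open>embed_l p\<close> is \<open>\<lambda>\<close> at a regular
  point and 0 at a boundary point.\<close>
definition hat_transform :: "('d::finite heis \<Rightarrow> complex) \<Rightarrow> 'd freq + 'd freq0 \<Rightarrow> complex" where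
  "hat_transform f p = (LINT (Y, s)|lebesgue. cnj (cis (s * embed_l p) * hat_kernel p Y) * f (Y, s))"

lemma hat_transform_Inl: "hat_transform f (Inl w) = fourier_heis f w"
  by (cases w) (simp add: hat_transform_def embed_l_def)

lemma hat_transform_Inr:
  "hat_transform f (Inr (x, k)) = (LINT (Y, s)|lebesgue. cnj (heis_kernel (x, k) Y) * f (Y, s))"
  by (simp add: hat_transform_def embed_l_def)

lemma character_measurable:
  fixes p :: "'d::finite freq + 'd freq0"
  assumes "p \<in> tilde_H <+> hat_H0"
  shows "(\<lambda>w :: 'd heis. cnj (cis (snd w * embed_l p) * hat_kernel p (fst w))) \<in> borel_measurable borel"
proof -
  note [measurable] = hat_kernel_measurable[OF assms]
  have [measurable]: "(snd :: 'd heis \<Rightarrow> real) \<in> borel_measurable borel"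
    "(fst :: 'd heis \<Rightarrow> _) \<in> borel_measurable borel"
    by (intro borel_measurable_continuous_onI continuous_intros)+
  show ?thesis by measurable
qed

lemma norm_character_le_1:
  assumes "p \<in> tilde_H <+> hat_H0"
  shows "norm (cnj (cis (s * embed_l p) * hat_kernel p Y)) \<le> 1"
  using norm_hat_kernel_le_1[OF assms] by (simp add: norm_mult)

lemma character_integrable:
  fixes f :: "'d::finite heis \<Rightarrow> complex"
  assumes "p \<in> tilde_H <+> hat_H0" "integrable lebesgue f"
  shows "integrable lebesgue (\<lambda>w. cnj (cis (snd w * embed_l p) * hat_kernel p (fst w)) * f w)"
proof (rule Bochner_Integration.integrable_bound[OF assms(2)])
  have "(\<lambda>w :: 'd heis. cnj (cis (snd w * embed_l p) * hat_kernel p (fst w))) \<in> borel_measurable lebesgue"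
    using character_measurable[OF assms(1)] by (intro measurable_completion) simp
  then show "(\<lambda>w. cnj (cis (snd w * embed_l p) * hat_kernel p (fst w)) * f w) \<in> borel_measurable lebesgue"
    using borel_measurable_integrable[OF assms(2)] by (rule borel_measurable_times)
  show "AE w in lebesgue. norm (cnj (cis (snd w * embed_l p) * hat_kernel p (fst w)) * f w) \<le> norm (f w)"
    using norm_character_le_1[OF assms(1)] by (intro AE_I2) (metis mult_left_le_one_le norm_ge_zero norm_mult)
qed

lemma hat_transform_eq:
  "hat_transform f p = (LINT w|lebesgue. cnj (cis (snd w * embed_l p) * hat_kernel p (fst w)) * f w)"
  by (simp only: hat_transform_def case_prod_unfold prod.collapse)

lemma norm_hat_transform_le:
  assumes "p \<in> tilde_H <+> hat_H0" "integrable lebesgue f"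
  shows "norm (hat_transform f p) \<le> L1_norm f"
  unfolding hat_transform_eq L1_norm_def
  by (intro order_trans[OF integral_norm_bound integral_mono] integrable_norm character_integrable assms)
    (metis norm_character_le_1[OF assms(1)] mult_left_le_one_le norm_ge_zero norm_mult)

lemma hat_transform_linear:
  assumes "p \<in> tilde_H <+> hat_H0" "integrable lebesgue f" "integrable lebesgue g"
  shows "hat_transform (\<lambda>w. a * f w + b * g w) p = a * hat_transform f p + b * hat_transform g p"
proof -
  let ?c = "\<lambda>w. cnj (cis (snd w * embed_l p) * hat_kernel p (fst w))"
  have "hat_transform (\<lambda>w. a * f w + b * g w) p = (LINT w|lebesgue. a * (?c w * f w) + b * (?c w * g w))"
    unfolding hat_transform_eq by (simp add: algebra_simps)
  also have "\<dots> = (LINT w|lebesgue. a * (?c w * f w)) + (LINT w|lebesgue. b * (?c w * g w))"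
    by (intro Bochner_Integration.integral_add integrable_mult_right character_integrable assms)
  finally show ?thesis unfolding hat_transform_eq by (simp only: integral_mult_right_zero)
qed

lemma continuous_hat_transform:
  fixes f :: "'d::finite heis \<Rightarrow> complex"
  assumes f: "integrable lebesgue f"
  shows "continuous_on UNIV (\<lambda>\<omega>. hat_transform f (Rep_hat_H \<omega>))"
proof (rule continuous_at_imp_continuous_on, intro ballI)
  fix \<omega>0 :: "'d hat_H"
  show "isCont (\<lambda>\<omega>. hat_transform f (Rep_hat_H \<omega>)) \<omega>0"
    unfolding continuous_at_sequentially comp_def
  proof (intro allI impI)
    fix \<omega> :: "nat \<Rightarrow> 'd hat_H"
    assume lim: "\<omega> \<longlonglongrightarrow> \<omega>0"
    show "(\<lambda>p. hat_transform f (Rep_hat_H (\<omega> p))) \<longlonglongrightarrow> hat_transform f (Rep_hat_H \<omega>0)"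
      unfolding hat_transform_eq
    proof (rule integral_dominated_convergence[where w = "\<lambda>w. norm (f w)"])
      show "AE w in lebesgue. (\<lambda>p. cnj (cis (snd w * embed_l (Rep_hat_H (\<omega> p))) * hat_kernel (Rep_hat_H (\<omega> p)) (fst w)) * f w)
          \<longlonglongrightarrow> cnj (cis (snd w * embed_l (Rep_hat_H \<omega>0)) * hat_kernel (Rep_hat_H \<omega>0) (fst w)) * f w"
        by (intro AE_I2 tendsto_intros tendsto_hat_kernel hat_tendsto lim isCont_tendsto_compose[where g = cis])
      show "AE w in lebesgue. norm (cnj (cis (snd w * embed_l (Rep_hat_H (\<omega> p))) * hat_kernel (Rep_hat_H (\<omega> p)) (fst w)) * f w) \<le> norm (f w)" for p
        by (intro AE_I2) (metis norm_character_le_1[OF Rep_hat_H] mult_left_le_one_le norm_ge_zero norm_mult)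
    qed (use f character_integrable[OF Rep_hat_H f] in \<open>auto intro: borel_measurable_integrable\<close>)
  qed
qed

section \<open>The completed frequency space\<close>

lemma Rep_reg: "w \<in> tilde_H \<Longrightarrow> Rep_hat_H (reg w) = Inl w"
  and Rep_bdry: "v \<in> hat_H0 \<Longrightarrow> Rep_hat_H (bdry v) = Inr v"
  unfolding reg_def bdry_def by (auto intro!: Abs_hat_H_inverse)

lemma hat_H_cases:
  obtains (reg) w where "w \<in> tilde_H" "\<omega> = reg w" | (bdry) x k where "(x, k) \<in> hat_H0" "\<omega> = bdry (x, k)"
proof (cases "Rep_hat_H \<omega>")
  case (Inl w)
  then show thesis
    using Rep_hat_H[of \<omega>] Rep_hat_H_inverse[of \<omega>] reg by (auto simp: reg_def)
next
  case (Inr v)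
  then show thesis
    using Rep_hat_H[of \<omega>] Rep_hat_H_inverse[of \<omega>] bdry by (cases v) (auto simp: bdry_def)
qed

text \<open>A boundary point \<open>(x, k)\<close> is approximated by \<open>\<lambda> = s t\<close> with \<open>t\<close> small, where \<open>s\<close> is the common sign of
  the coordinates of \<open>x\<close>, and by indices with difference exactly \<open>k\<close> and sum close to \<open>x / \<lambda>\<close>.\<close>
lemma reg_dense:
  fixes \<omega> :: "'d::finite hat_H"
  assumes "0 < \<epsilon>"
  shows "\<exists>w\<in>tilde_H. dist (reg w) \<omega> < \<epsilon>"
proof (cases \<omega> rule: hat_H_cases)
  case (reg w)
  then show ?thesis using assms by (intro bexI[of _ w]) auto
next
  case (bdry x k)
  obtain s :: real where s: "s = 1 \<or> s = -1" "\<And>j. 0 \<le> s * x $ j"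
  proof (cases "\<forall>j. 0 \<le> x $ j")
    case True
    then show thesis by (intro that[of 1]) auto
  next
    case False
    then show thesis using bdry by (intro that[of "-1"]) (auto simp: hat_H0_def)
  qed
  have ss: "s * s = 1" "\<bar>s\<bar> = 1" "s \<noteq> 0" using s(1) by auto
  \<comment> \<open>With \<open>\<bar>\<lambda>\<bar> = t\<close> the distance is at most \<open>C t\<close>: rounding \<open>x\<^sub>j / \<lambda>\<close> to an even number costs \<open>2 t\<close>, the
    difference \<open>k\<^sub>j\<close> of the indices costs \<open>t \<bar>k\<^sub>j\<bar>\<close>, and \<open>\<lambda>\<close> itself costs \<open>t\<close>.\<close>
  define C where "C = (\<Sum>j\<in>(UNIV :: 'd set). 2 + \<bar>real_of_int (k $ j)\<bar>) + 1"
  have "0 \<le> (\<Sum>j\<in>(UNIV :: 'd set). 2 + \<bar>real_of_int (k $ j)\<bar>)" by (intro sum_nonneg) auto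
  then have C: "0 < C" by (simp add: C_def)
  define t where "t = \<epsilon> / (2 * C)"
  have t: "0 < t" using assms C by (simp add: t_def)
  define N where "N = (\<lambda>j. nat \<lfloor>s * x $ j / (2 * t)\<rfloor>)"
  have N: "\<bar>s * t * (2 * real (N j)) - x $ j\<bar> \<le> 2 * t" for j
  proof -
    have pos: "0 \<le> s * x $ j / (2 * t)" using s t by simp
    then have "real (N j) \<le> s * x $ j / (2 * t)" "s * x $ j / (2 * t) < real (N j) + 1"
      unfolding N_def by linarith+
    then have "\<bar>t * (2 * real (N j)) - s * x $ j\<bar> \<le> 2 * t"
      using t by (simp add: field_simps abs_le_iff)
    moreover have "s * t * (2 * real (N j)) - x $ j = s * (t * (2 * real (N j)) - s * x $ j)"
      using ss(1) by (simp add: right_diff_distrib mult.assoc[symmetric])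
    ultimately show ?thesis using ss(2) by (simp add: abs_mult)
  qed
  define n :: "nat ^ 'd" where "n = (\<chi> j. N j + nat (- k $ j))"
  define m :: "nat ^ 'd" where "m = (\<chi> j. N j + nat (k $ j))"
  have nm: "real (m $ j) - real (n $ j) = of_int (k $ j)"
    "real (n $ j) + real (m $ j) = 2 * real (N j) + \<bar>real_of_int (k $ j)\<bar>" for j
    by (auto simp: n_def m_def of_nat_nat)
  have mem: "(n, m, s * t) \<in> tilde_H" using t ss by (auto simp: tilde_H_def)
  have x_part: "norm_l1 ((s * t) *\<^sub>R vec_nat (n + m) - x) \<le> (\<Sum>j\<in>UNIV. t * (2 + \<bar>real_of_int (k $ j)\<bar>))"
    unfolding norm_l1_def
  proof (rule sum_mono)
    fix j
    have "((s * t) *\<^sub>R vec_nat (n + m) - x) $ j = (s * t * (2 * real (N j)) - x $ j) + s * t * \<bar>real_of_int (k $ j)\<bar>"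
    proof -
      have "((s * t) *\<^sub>R vec_nat (n + m) - x) $ j = s * t * (real (n $ j) + real (m $ j)) - x $ j"
        by (simp add: vec_nat_def)
      then show ?thesis unfolding nm(2) by (simp only: distrib_left)
    qed
    moreover have "\<bar>s * t * \<bar>real_of_int (k $ j)\<bar>\<bar> = t * \<bar>real_of_int (k $ j)\<bar>"
      using ss t by (simp add: abs_mult)
    ultimately show "\<bar>((s * t) *\<^sub>R vec_nat (n + m) - x) $ j\<bar> \<le> t * (2 + \<bar>real_of_int (k $ j)\<bar>)"
      using N[of j] by (simp add: distrib_left)
  qed
  have k_part: "norm_l1 (vec_nat m - vec_nat n - vec_int k) = 0"
    using nm(1) by (simp add: norm_l1_def vec_nat_def vec_int_def)
  have "dist (reg (n, m, s * t)) \<omega> \<le> (\<Sum>j\<in>UNIV. t * (2 + \<bar>real_of_int (k $ j)\<bar>)) + t"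
    using x_part k_part t ss bdry by (simp add: dist_hat_H_def Rep_reg[OF mem] Rep_bdry abs_mult)
  also have "\<dots> = t * C" unfolding C_def sum_distrib_left[symmetric] by (simp only: distrib_left mult_1_right)
  also have "\<dots> < \<epsilon>" using assms C by (simp add: t_def)
  finally show ?thesis using mem by blast
qed

lemma norm_le_norm_l1: "norm x \<le> norm_l1 x"
  unfolding norm_l1_def by (rule norm_le_l1_cart)

lemma tendsto_norm_l1_diff:
  assumes "(f \<longlongrightarrow> a) F"
  shows "((\<lambda>p. norm_l1 (f p - a)) \<longlongrightarrow> 0) F"
proof -
  have "((\<lambda>p. norm_l1 (f p - a)) \<longlongrightarrow> norm_l1 (a - a)) F"
    unfolding norm_l1_def by (intro tendsto_intros assms)
  then show ?thesis by (simp add: norm_l1_def)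
qed

text \<open>The image of the frequency space is closed. If the limit has \<open>l \<noteq> 0\<close>, the indices are recovered as
  \<open>n = (x / l - \<kappa>) / 2\<close> and \<open>m = (x / l + \<kappa>) / 2\<close>, which stay natural numbers in the limit; if
  \<open>l = 0\<close>, the products \<open>x\<^sub>i x\<^sub>j\<close> stay nonnegative, which says that all coordinates of \<open>x\<close> have the
  same sign.\<close>
lemma hat_embed_limit:
  fixes \<omega> :: "nat \<Rightarrow> 'd::finite hat_H"
  assumes lim: "(\<lambda>p. hat_embed (Rep_hat_H (\<omega> p))) \<longlonglongrightarrow> (x, \<kappa>, l)"
  shows "\<exists>\<omega>0. hat_embed (Rep_hat_H \<omega>0) = (x, \<kappa>, l)"
proof -
  let ?E = "\<lambda>p. hat_embed (Rep_hat_H (\<omega> p))"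
  have X: "(\<lambda>p. fst (?E p) $ j) \<longlonglongrightarrow> x $ j" for j
    using tendsto_vec_nth[OF tendsto_fst[OF lim]] by simp
  have K: "(\<lambda>p. fst (snd (?E p)) $ j) \<longlonglongrightarrow> \<kappa> $ j" for j
    using tendsto_vec_nth[OF tendsto_fst[OF tendsto_snd[OF lim]]] by simp
  have L: "(\<lambda>p. snd (snd (?E p))) \<longlonglongrightarrow> l"
    using tendsto_snd[OF tendsto_snd[OF lim]] by simp
  show ?thesis
  proof (cases "l = 0")
    case False
    have ev: "\<forall>\<^sub>F p in sequentially. snd (snd (?E p)) \<noteq> 0"
      by (rule tendsto_imp_eventually_ne[OF L False])
    have nat: "(fst (?E p) $ j / snd (snd (?E p)) - fst (snd (?E p)) $ j) / 2 \<in> \<nat> \<and>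
       (fst (?E p) $ j / snd (snd (?E p)) + fst (snd (?E p)) $ j) / 2 \<in> \<nat>"
      if ne: "snd (snd (?E p)) \<noteq> 0" for p j
    proof (cases "Rep_hat_H (\<omega> p)" rule: hat_embed.cases)
      case (1 n m l')
      then have l': "l' \<noteq> 0" using ne by simp
      have "(fst (?E p) $ j / snd (snd (?E p)) - fst (snd (?E p)) $ j) / 2 = real (n $ j)"
        "(fst (?E p) $ j / snd (snd (?E p)) + fst (snd (?E p)) $ j) / 2 = real (m $ j)"
        unfolding 1 using l' by (simp_all add: vec_nat_def)
      then show ?thesis by simp
    qed (use ne in simp)
    have "(x $ j / l - \<kappa> $ j) / 2 \<in> \<nat> \<and> (x $ j / l + \<kappa> $ j) / 2 \<in> \<nat>" for j
    proof
      show "(x $ j / l - \<kappa> $ j) / 2 \<in> \<nat>"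
        by (rule Lim_in_closed_set[OF closed_Nats _ _ tendsto_divide[OF tendsto_diff[OF tendsto_divide[OF X L False] K] tendsto_const]])
          (use ev nat in \<open>auto elim!: eventually_mono\<close>)
      show "(x $ j / l + \<kappa> $ j) / 2 \<in> \<nat>"
        by (rule Lim_in_closed_set[OF closed_Nats _ _ tendsto_divide[OF tendsto_add[OF tendsto_divide[OF X L False] K] tendsto_const]])
          (use ev nat in \<open>auto elim!: eventually_mono\<close>)
    qed
    then have "\<exists>nm. (x $ j / l - \<kappa> $ j) / 2 = real (fst nm) \<and> (x $ j / l + \<kappa> $ j) / 2 = real (snd nm)" for j
      by (metis Nats_cases fst_conv snd_conv)
    then obtain nm where nm: "\<And>j. (x $ j / l - \<kappa> $ j) / 2 = real (fst (nm j))" "\<And>j. (x $ j / l + \<kappa> $ j) / 2 = real (snd (nm j))"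
      by metis
    define n :: "nat ^ 'd" where "n = (\<chi> j. fst (nm j))"
    define m :: "nat ^ 'd" where "m = (\<chi> j. snd (nm j))"
    have 1: "real (n $ j) + real (m $ j) = x $ j / l" "real (m $ j) - real (n $ j) = \<kappa> $ j" for j
      unfolding n_def m_def using nm[of j] by (simp_all add: field_simps)
    have mem: "(n, m, l) \<in> tilde_H" using False by (auto simp: tilde_H_def)
    have "hat_embed (Rep_hat_H (reg (n, m, l))) = (x, \<kappa>, l)"
      using 1 False unfolding Rep_reg[OF mem] by (simp add: vec_eq_iff vec_nat_def)
    then show ?thesis by blast
  next
    case True
    have sgn: "0 \<le> fst (?E p) $ i * fst (?E p) $ j" for p i j
    proof (cases "Rep_hat_H (\<omega> p)" rule: hat_embed.cases)
      case (1 n m l')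
      have "fst (?E p) $ i * fst (?E p) $ j = l' * l' * (real (n $ i + m $ i) * real (n $ j + m $ j))"
        by (simp add: 1 vec_nat_def)
      then show ?thesis by simp
    next
      case (2 y k)
      then show ?thesis
        using Rep_hat_H[of "\<omega> p"] by (auto simp: hat_H0_def intro: mult_nonneg_nonneg mult_nonpos_nonpos)
    qed
    have "0 \<le> x $ i * x $ j" for i j
      by (rule LIMSEQ_le_const[OF tendsto_mult[OF X[of i] X[of j]]]) (use sgn in auto)
    then have sign: "(\<forall>j. x $ j \<le> 0) \<or> (\<forall>j. 0 \<le> x $ j)"
      by (metis linorder_le_cases mult_less_0_iff not_le)
    have int: "fst (snd (?E p)) $ j \<in> \<int>" for p j
      by (subst of_int_embed_k[symmetric]) simp
    have "\<kappa> $ j \<in> \<int>" for j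
      by (rule Lim_in_closed_set[OF closed_Ints _ _ K]) (use int in auto)
    then have "\<exists>k. \<kappa> $ j = of_int k" for j by (metis Ints_cases)
    then obtain k where k: "\<And>j. \<kappa> $ j = of_int (k j)" by metis
    have mem: "(x, \<chi> j. k j) \<in> hat_H0" using sign by (simp add: hat_H0_def)
    have "hat_embed (Rep_hat_H (bdry (x, \<chi> j. k j))) = (x, \<kappa>, l)"
      unfolding Rep_bdry[OF mem] by (simp add: True vec_eq_iff vec_int_def k)
    then show ?thesis by blast
  qed
qed

lemma compact_cball_hat_H: "compact (cball (\<omega>0 :: 'd::finite hat_H) R)"
  unfolding compact_eq_seq_compact_metric seq_compact_def
proof (intro allI impI)
  fix f :: "nat \<Rightarrow> 'd hat_H"
  assume f: "\<forall>p. f p \<in> cball \<omega>0 R"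
  let ?E = "\<lambda>\<omega> :: 'd hat_H. hat_embed (Rep_hat_H \<omega>)"
  have bounded: "bounded (range (\<lambda>p. ?E (f p)))"
    unfolding bounded_def
  proof (intro exI ballI)
    fix e assume "e \<in> range (\<lambda>p. ?E (f p))"
    then obtain p where p: "e = ?E (f p)" by auto
    obtain x k l where 0: "?E \<omega>0 = (x, k, l)" by (metis prod_cases3)
    obtain x' k' l' where 1: "?E (f p) = (x', k', l')" by (metis prod_cases3)
    have "dist (?E \<omega>0) e \<le> norm (x - x') + norm (k - k') + \<bar>l - l'\<bar>"
      unfolding p 0 1 dist_norm
      by (simp add: order_trans[OF norm_Pair_le] order_trans[OF norm_Pair_le[of "k - k'" "l - l'"]] add.assoc)
    also have "\<dots> \<le> norm_l1 (x - x') + norm_l1 (k - k') + \<bar>l - l'\<bar>"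
      by (intro add_mono norm_le_norm_l1 order_refl)
    also have "\<dots> = dist \<omega>0 (f p)"
      unfolding dist_hat_H_def hat_dist_embed 0 1 by simp
    also have "\<dots> \<le> R" using f by simp
    finally show "dist (?E \<omega>0) e \<le> R" .
  qed
  obtain e r where r: "strict_mono r" "((\<lambda>p. ?E (f p)) \<circ> r) \<longlonglongrightarrow> e"
    using bounded_imp_convergent_subsequence[OF bounded] by blast
  obtain x k l where e: "e = (x, k, l)" by (metis prod_cases3)
  have lim: "(\<lambda>p. ?E (f (r p))) \<longlonglongrightarrow> (x, k, l)" using r(2) by (simp add: e comp_def)
  obtain \<omega> where \<omega>: "?E \<omega> = (x, k, l)" using hat_embed_limit[OF lim] by blast
  have "(\<lambda>p. norm_l1 (fst (?E (f (r p))) - x) + norm_l1 (fst (snd (?E (f (r p)))) - k)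
      + \<bar>snd (snd (?E (f (r p)))) - l\<bar>) \<longlonglongrightarrow> 0 + 0 + 0"
    using tendsto_fst[OF lim] tendsto_fst[OF tendsto_snd[OF lim]] tendsto_snd[OF tendsto_snd[OF lim]]
    by (intro tendsto_add tendsto_norm_l1_diff tendsto_rabs_zero LIM_zero) simp_all
  then have "(\<lambda>p. dist (f (r p)) \<omega>) \<longlonglongrightarrow> 0"
    unfolding dist_hat_H_def hat_dist_embed \<omega> by simp
  then have conv: "(f \<circ> r) \<longlonglongrightarrow> \<omega>" by (simp add: tendsto_dist_iff[of "f \<circ> r"])
  moreover have "\<omega> \<in> cball \<omega>0 R"
    by (rule Lim_in_closed_set[OF closed_cball _ _ conv]) (use f in auto)
  ultimately show "\<exists>\<omega>\<in>cball \<omega>0 R. \<exists>r. strict_mono r \<and> (f \<circ> r) \<longlonglongrightarrow> \<omega>"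
    using r(1) by blast
qed

section \<open>Decay of the transform of a box\<close>

definition rect :: "real \<Rightarrow> real \<Rightarrow> real \<Rightarrow> real \<Rightarrow> (real \<Rightarrow> real \<Rightarrow> complex) \<Rightarrow> complex" where
  "rect a b a' b' f = (LINT z|lborel. indicator ({a..b} \<times> {a'..b'}) z *\<^sub>R f (fst z) (snd z))"

abbreviation jointly_continuous :: "(real \<Rightarrow> real \<Rightarrow> complex) \<Rightarrow> bool" where
  "jointly_continuous f \<equiv> continuous_on UNIV (\<lambda>z. f (fst z) (snd z))"

lemma rect_integrable:
  assumes "jointly_continuous f"
  shows "integrable lborel (\<lambda>z. indicator ({a..b} \<times> {a'..b'}) z *\<^sub>R f (fst z) (snd z))"
  by (intro borel_integrable_compact compact_Times compact_Icc continuous_on_subset[OF assms]) simp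

lemma rect_add:
  assumes "jointly_continuous f" "jointly_continuous g"
  shows "rect a b a' b' (\<lambda>y \<eta>. f y \<eta> + g y \<eta>) = rect a b a' b' f + rect a b a' b' g"
  unfolding rect_def scaleR_add_right
  by (intro Bochner_Integration.integral_add rect_integrable assms)

lemma rect_cmult: "rect a b a' b' (\<lambda>y \<eta>. c * f y \<eta>) = c * rect a b a' b' f"
  unfolding rect_def by (simp add: mult_scaleR_right[symmetric] del: mult_scaleR_right)

lemma indicator_Times_scaleR:
  "indicator (A \<times> B) (x, y) *\<^sub>R c = indicator A x *\<^sub>R indicator B y *\<^sub>R (c :: complex)"
  by (simp split: split_indicator)

lemma rect_iterated:
  assumes "jointly_continuous f"
  shows "rect a b a' b' f
    = (LINT y|lborel. indicator {a..b} y *\<^sub>R (LINT \<eta>|lborel. indicator {a'..b'} \<eta> *\<^sub>R f y \<eta>))"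
proof -
  have int: "integrable (lborel \<Otimes>\<^sub>M lborel) (\<lambda>z. indicator ({a..b} \<times> {a'..b'}) z *\<^sub>R f (fst z) (snd z))"
    using rect_integrable[OF assms] by (simp add: lborel_prod)
  show ?thesis
    using lborel_pair.integral_fst'[OF int]
    by (simp add: rect_def lborel_prod indicator_Times_scaleR del: scaleR_scaleR)
qed

lemma rect_iterated_swap:
  assumes "jointly_continuous f"
  shows "rect a b a' b' f
    = (LINT \<eta>|lborel. indicator {a'..b'} \<eta> *\<^sub>R (LINT y|lborel. indicator {a..b} y *\<^sub>R f y \<eta>))"
proof -
  have int: "integrable (lborel \<Otimes>\<^sub>M lborel) (case_prod (\<lambda>y \<eta>. indicator ({a..b} \<times> {a'..b'}) (y, \<eta>) *\<^sub>R f y \<eta>))"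
    using rect_integrable[OF assms] by (simp add: lborel_prod case_prod_beta')
  have "(LINT \<eta>|lborel. (LINT y|lborel. indicator ({a..b} \<times> {a'..b'}) (y, \<eta>) *\<^sub>R f y \<eta>)) = rect a b a' b' f"
    using lborel_pair.integral_snd[OF int] by (simp add: rect_def lborel_prod case_prod_beta')
  moreover have "indicator ({a..b} \<times> {a'..b'}) (y, \<eta>) *\<^sub>R f y \<eta> = indicator {a'..b'} \<eta> *\<^sub>R indicator {a..b} y *\<^sub>R f y \<eta>" for y \<eta>
    by (simp split: split_indicator)
  ultimately show ?thesis by (simp del: scaleR_scaleR)
qed

lemma norm_integral_Icc_le:
  fixes f :: "real \<Rightarrow> complex"
  assumes "a \<le> b" "0 \<le> B" "\<And>x. x \<in> {a..b} \<Longrightarrow> norm (f x) \<le> B"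
  shows "norm (LINT x|lborel. indicator {a..b} x *\<^sub>R f x) \<le> B * (b - a)"
proof -
  have "norm (LINT x|lborel. indicator {a..b} x *\<^sub>R f x) \<le> (LINT x|lborel. B * indicator {a..b} x)"
    by (rule order_trans[OF integral_norm_bound integral_mono'])
      (use assms in \<open>auto split: split_indicator\<close>)
  then show ?thesis using assms(1) by simp
qed

lemma norm_rect_le:
  assumes "jointly_continuous f" "a \<le> b" "a' \<le> b'" "0 \<le> B"
    "\<And>y \<eta>. y \<in> {a..b} \<Longrightarrow> \<eta> \<in> {a'..b'} \<Longrightarrow> norm (f y \<eta>) \<le> B"
  shows "norm (rect a b a' b' f) \<le> B * (b' - a') * (b - a)"
  unfolding rect_iterated[OF assms(1)]
  by (intro norm_integral_Icc_le mult_nonneg_nonneg) (use assms in auto)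

text \<open>The inner integral of a derivative is a difference of two values of \<open>G\<close>.\<close>
lemma norm_rect_derivative_snd_le:
  assumes "jointly_continuous G'" "a \<le> b" "a' \<le> b'" "0 \<le> B"
    and deriv: "\<And>y \<eta>. ((\<lambda>\<eta>. G y \<eta>) has_vector_derivative G' y \<eta>) (at \<eta>)"
    and bound: "\<And>y \<eta>. y \<in> {a..b} \<Longrightarrow> \<eta> \<in> {a'..b'} \<Longrightarrow> norm (G y \<eta>) \<le> B"
  shows "norm (rect a b a' b' G') \<le> 2 * B * (b - a)"
proof -
  have "(LINT \<eta>|lborel. indicator {a'..b'} \<eta> *\<^sub>R G' y \<eta>) = G y b' - G y a'" for y
  proof (rule integral_FTC_atLeastAtMost)
    show "continuous_on {a'..b'} (G' y)"
      using continuous_on_compose2[OF assms(1), of "{a'..b'}" "\<lambda>\<eta>. (y, \<eta>)"]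
      by (simp add: continuous_intros)
  qed (use assms(3) deriv in \<open>auto intro: has_vector_derivative_at_within\<close>)
  moreover have "norm (G y b' - G y a') \<le> 2 * B" if "y \<in> {a..b}" for y
    using norm_triangle_ineq4[of "G y b'" "G y a'"] bound[OF that, of b'] bound[OF that, of a'] assms(3)
    by simp
  ultimately show ?thesis
    unfolding rect_iterated[OF assms(1)] using assms by (intro norm_integral_Icc_le) auto
qed

lemma norm_rect_derivative_fst_le:
  assumes "jointly_continuous G'" "a \<le> b" "a' \<le> b'" "0 \<le> B"
    and deriv: "\<And>y \<eta>. ((\<lambda>y. G y \<eta>) has_vector_derivative G' y \<eta>) (at y)"
    and bound: "\<And>y \<eta>. y \<in> {a..b} \<Longrightarrow> \<eta> \<in> {a'..b'} \<Longrightarrow> norm (G y \<eta>) \<le> B"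
  shows "norm (rect a b a' b' G') \<le> 2 * B * (b' - a')"
proof -
  have "(LINT y|lborel. indicator {a..b} y *\<^sub>R G' y \<eta>) = G b \<eta> - G a \<eta>" for \<eta>
  proof (rule integral_FTC_atLeastAtMost)
    show "continuous_on {a..b} (\<lambda>y. G' y \<eta>)"
      using continuous_on_compose2[OF assms(1), of "{a..b}" "\<lambda>y. (y, \<eta>)"]
      by (simp add: continuous_intros)
  qed (use assms(2) deriv in \<open>auto intro: has_vector_derivative_at_within\<close>)
  moreover have "norm (G b \<eta> - G a \<eta>) \<le> 2 * B" if "\<eta> \<in> {a'..b'}" for \<eta>
    using norm_triangle_ineq4[of "G b \<eta>" "G a \<eta>"] bound[OF _ that, of b] bound[OF _ that, of a] assms(2)
    by simp
  ultimately show ?thesis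
    unfolding rect_iterated_swap[OF assms(1)] using assms by (intro norm_integral_Icc_le) auto
qed

text \<open>With \<open>\<zeta> = y + i s \<eta>\<close> the derivative formula and the ladder relations give
  \<open>2 c (2n + 2)\<^sup>1\<^sup>/\<^sup>2 W n m = (\<partial>\<^sub>y - i s \<partial>\<^sub>\<eta>) W (n + 1) m + 2 c\<^sup>2 cnj \<zeta> W (n + 1) m\<close>, similarly in \<open>m\<close>, and
  \<open>(n - m) W n m = i s (\<eta> \<partial>\<^sub>y - y \<partial>\<^sub>\<eta>) W n m\<close>. Each derivative falls on a function that is
  bounded on the rectangle, so its integral is bounded by the boundary values.\<close>
lemma wig1_rect_decay:
  fixes a b a' b' c s :: real
  assumes ab: "a \<le> b" "a' \<le> b'" and c: "0 \<le> c" and s: "s * s = 1"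
  defines "W \<equiv> \<lambda>n m y \<eta>. wig1 n m (c * y) (c * (s * \<eta>))"
  defines "Y \<equiv> \<bar>a\<bar> + \<bar>b\<bar> + \<bar>a'\<bar> + \<bar>b'\<bar>"
  shows "norm (rect a b a' b' (W n m)) * (2 * c * norm (ladder (Suc n)))
           \<le> 2 * (b' - a') + 2 * (b - a) + 2 * c\<^sup>2 * Y * (b' - a') * (b - a)" (is ?left)
    and "norm (rect a b a' b' (W n m)) * (2 * c * norm (ladder (Suc m)))
           \<le> 2 * (b' - a') + 2 * (b - a) + 2 * c\<^sup>2 * Y * (b' - a') * (b - a)" (is ?right)
    and "norm (rect a b a' b' (W n m)) * \<bar>real n - real m\<bar> \<le> 2 * Y * (b' - a') + 2 * Y * (b - a)" (is ?diff)
proof -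
  let ?I = "rect a b a' b'"
  define Dy where "Dy = (\<lambda>n m y \<eta>. of_real c * (ladder n * W (n - 1) m y \<eta> - ladder m * W n (m - 1) y \<eta> - 2 * of_real (c * y) * W n m y \<eta>))"
  define De where "De = (\<lambda>n m y \<eta>. of_real (c * s) * (\<i> * ladder n * W (n - 1) m y \<eta> + \<i> * ladder m * W n (m - 1) y \<eta> - 2 * of_real (c * (s * \<eta>)) * W n m y \<eta>))"
  have contW: "jointly_continuous (W n m)" for n m
    unfolding W_def by (intro continuous_intros)
  have contD: "jointly_continuous (Dy n m)" "jointly_continuous (De n m)" for n m
    unfolding Dy_def De_def by (intro continuous_intros contW)+
  have normW: "norm (W n m y \<eta>) \<le> 1" for n m y \<eta>
    unfolding W_def by (rule norm_wig1_le_1)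
  have deriv_y: "((\<lambda>y. W n m y \<eta>) has_vector_derivative Dy n m y \<eta>) (at y)" for n m y \<eta>
  proof -
    have "Complex c 0 = of_real c" by (simp add: complex_eq_iff)
    then show ?thesis
      using wig1_has_vector_derivative[of n m 0 c "c * (s * \<eta>)" 0 y]
      by (simp add: W_def Dy_def algebra_simps)
  qed
  have deriv_eta: "((\<lambda>\<eta>. W n m y \<eta>) has_vector_derivative De n m y \<eta>) (at \<eta>)" for n m y \<eta>
  proof -
    have "Complex 0 (c * s) = \<i> * of_real (c * s)" by (simp add: complex_eq_iff)
    moreover have "\<eta> * (c * s) = c * (s * \<eta>)" for \<eta> by simp
    ultimately show ?thesis
      using wig1_has_vector_derivative[of n m "c * y" 0 0 "c * s" \<eta>]
      by (simp add: W_def De_def algebra_simps)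
  qed
  have Y: "0 \<le> Y" by (simp add: Y_def)
  have in_rect: "\<bar>y\<bar> \<le> Y" "\<bar>\<eta>\<bar> \<le> Y" "\<bar>y\<bar> + \<bar>\<eta>\<bar> \<le> Y" if "y \<in> {a..b}" "\<eta> \<in> {a'..b'}" for y \<eta>
    using that by (auto simp: Y_def)
  have Iy: "norm (?I (Dy n m)) \<le> 2 * (b' - a')" for n m
    using norm_rect_derivative_fst_le[OF contD(1) ab _ deriv_y normW, of n m] by simp
  have Ie: "norm (?I (De n m)) \<le> 2 * (b - a)" for n m
    using norm_rect_derivative_snd_le[OF contD(2) ab _ deriv_eta normW, of n m] by simp
  have ss: "complex_of_real s * (of_real s * x) = x" for x
    unfolding mult.assoc[symmetric] of_real_mult[symmetric] s by simp
  have norm_s: "\<bar>s\<bar> = 1" using s by (metis abs_mult_self_eq abs_1 mult_eq_0_iff power2_eq_1_iff power2_eq_square abs_square_eq_1)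
  define \<zeta> where "\<zeta> = (\<lambda>y \<eta>. complex_of_real y + \<i> * of_real (s * \<eta>))"
  have cont_zeta: "jointly_continuous \<zeta>" "jointly_continuous (\<lambda>y \<eta>. cnj (\<zeta> y \<eta>))"
    unfolding \<zeta>_def by (intro continuous_intros)+
  have norm_zeta: "norm (\<zeta> y \<eta>) \<le> Y" if "y \<in> {a..b}" "\<eta> \<in> {a'..b'}" for y \<eta>
  proof -
    have "norm (\<zeta> y \<eta>) \<le> \<bar>y\<bar> + \<bar>\<eta>\<bar>"
      unfolding \<zeta>_def by (rule order_trans[OF norm_triangle_ineq]) (simp add: norm_mult abs_mult norm_s)
    then show ?thesis using in_rect(3)[OF that] by linarith
  qed
  have remainder: "norm (?I (\<lambda>y \<eta>. g y \<eta> * W n m y \<eta>)) \<le> Y * (b' - a') * (b - a)"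
    if "jointly_continuous g" "\<And>y \<eta>. y \<in> {a..b} \<Longrightarrow> \<eta> \<in> {a'..b'} \<Longrightarrow> norm (g y \<eta>) \<le> Y" for g n m
  proof (rule norm_rect_le[OF _ ab Y])
    show "jointly_continuous (\<lambda>y \<eta>. g y \<eta> * W n m y \<eta>)"
      by (intro continuous_intros that contW)
    show "norm (g y \<eta> * W n m y \<eta>) \<le> Y" if "y \<in> {a..b}" "\<eta> \<in> {a'..b'}" for y \<eta>
      using mult_mono[OF \<open>\<And>y \<eta>. y \<in> {a..b} \<Longrightarrow> \<eta> \<in> {a'..b'} \<Longrightarrow> norm (g y \<eta>) \<le> Y\<close>[OF that] normW Y norm_ge_zero]
      by (simp add: norm_mult)
  qed
  show ?left
  proof -
    have id: "(2 * of_real c * ladder (Suc n)) * W n m y \<eta> = (Dy (Suc n) m y \<eta> + (- \<i> * of_real s) * De (Suc n) m y \<eta>)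
        + of_real (2 * c\<^sup>2) * (cnj (\<zeta> y \<eta>) * W (Suc n) m y \<eta>)" for y \<eta>
      unfolding Dy_def De_def \<zeta>_def by (simp add: ss algebra_simps power2_eq_square)
    have "(2 * of_real c * ladder (Suc n)) * ?I (W n m) = (?I (Dy (Suc n) m) + (- \<i> * of_real s) * ?I (De (Suc n) m))
        + of_real (2 * c\<^sup>2) * ?I (\<lambda>y \<eta>. cnj (\<zeta> y \<eta>) * W (Suc n) m y \<eta>)"
      unfolding rect_cmult[symmetric] id
      by (subst rect_add, (intro continuous_intros contD contW cont_zeta)+)
        (subst rect_add, (intro continuous_intros contD contW cont_zeta)+, simp add: rect_cmult)
    also have "norm \<dots> \<le> (norm (?I (Dy (Suc n) m)) + norm (?I (De (Suc n) m)))
        + 2 * c\<^sup>2 * norm (?I (\<lambda>y \<eta>. cnj (\<zeta> y \<eta>) * W (Suc n) m y \<eta>))"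
      by (intro order_trans[OF norm_triangle_ineq] add_mono) (auto simp: norm_mult norm_s norm_power)
    also have "\<dots> \<le> (2 * (b' - a') + 2 * (b - a)) + 2 * c\<^sup>2 * (Y * (b' - a') * (b - a))"
      by (intro add_mono Iy Ie mult_left_mono remainder cont_zeta) (auto intro: norm_zeta)
    finally show ?thesis using c by (simp add: norm_mult mult_ac)
  qed
  show ?right
  proof -
    have id: "(- 2 * of_real c * ladder (Suc m)) * W n m y \<eta> = (Dy n (Suc m) y \<eta> + (\<i> * of_real s) * De n (Suc m) y \<eta>)
        + of_real (2 * c\<^sup>2) * (\<zeta> y \<eta> * W n (Suc m) y \<eta>)" for y \<eta>
      unfolding Dy_def De_def \<zeta>_def by (simp add: ss algebra_simps power2_eq_square)
    have "(- 2 * of_real c * ladder (Suc m)) * ?I (W n m) = (?I (Dy n (Suc m)) + (\<i> * of_real s) * ?I (De n (Suc m)))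
        + of_real (2 * c\<^sup>2) * ?I (\<lambda>y \<eta>. \<zeta> y \<eta> * W n (Suc m) y \<eta>)"
      unfolding rect_cmult[symmetric] id
      by (subst rect_add, (intro continuous_intros contD contW cont_zeta)+)
        (subst rect_add, (intro continuous_intros contD contW cont_zeta)+, simp add: rect_cmult)
    also have "norm \<dots> \<le> (norm (?I (Dy n (Suc m))) + norm (?I (De n (Suc m))))
        + 2 * c\<^sup>2 * norm (?I (\<lambda>y \<eta>. \<zeta> y \<eta> * W n (Suc m) y \<eta>))"
      by (intro order_trans[OF norm_triangle_ineq] add_mono) (auto simp: norm_mult norm_s norm_power)
    also have "\<dots> \<le> (2 * (b' - a') + 2 * (b - a)) + 2 * c\<^sup>2 * (Y * (b' - a') * (b - a))"
      by (intro add_mono Iy Ie mult_left_mono remainder cont_zeta) (auto intro: norm_zeta)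
    finally show ?thesis using c by (simp add: norm_mult mult_ac)
  qed
  show ?diff
  proof -
    have id: "(of_nat n - of_nat m) * W n m y \<eta> = \<i> * of_real s * (of_real \<eta> * Dy n m y \<eta>) + (- \<i> * of_real s) * (of_real y * De n m y \<eta>)" for y \<eta>
    proof -
      let ?z = "Complex (c * y) (c * (s * \<eta>))"
      have "2 * ((of_nat n - of_nat m) * W n m y \<eta>) = 2 * of_nat n * W n m y \<eta> - 2 * of_nat m * W n m y \<eta>"
        by (simp add: algebra_simps)
      also have "\<dots> = 2 * (?z * ladder n * W (n - 1) m y \<eta> + cnj ?z * ladder m * W n (m - 1) y \<eta>)"
        unfolding W_def wig1_lower_left[symmetric] wig1_lower_right[symmetric] by (simp add: algebra_simps)
      finally have "(of_nat n - of_nat m) * W n m y \<eta> = ?z * ladder n * W (n - 1) m y \<eta> + cnj ?z * ladder m * W n (m - 1) y \<eta>"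
        by (simp only: mult_cancel_left) simp
      moreover have "?z = of_real c * (of_real y + \<i> * (of_real s * of_real \<eta>))" "cnj ?z = of_real c * (of_real y - \<i> * (of_real s * of_real \<eta>))"
        by (simp_all add: complex_eq_iff)
      ultimately show ?thesis
        unfolding Dy_def De_def by (simp add: ss algebra_simps)
    qed
    have "(of_nat n - of_nat m) * ?I (W n m) = (\<i> * of_real s) * ?I (\<lambda>y \<eta>. of_real \<eta> * Dy n m y \<eta>) + (- \<i> * of_real s) * ?I (\<lambda>y \<eta>. of_real y * De n m y \<eta>)"
      unfolding rect_cmult[symmetric] id
      by (subst rect_add, (intro continuous_intros contD)+) simp
    then have "norm ((of_nat n - of_nat m) * ?I (W n m)) \<le> norm (?I (\<lambda>y \<eta>. of_real \<eta> * Dy n m y \<eta>)) + norm (?I (\<lambda>y \<eta>. of_real y * De n m y \<eta>))"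
      by (simp only:, intro order_trans[OF norm_triangle_ineq] add_mono) (auto simp: norm_mult norm_s norm_power)
    also have "\<dots> \<le> 2 * Y * (b' - a') + 2 * Y * (b - a)"
    proof (intro add_mono)
      have mono: "\<bar>x\<bar> * norm (W n m y \<eta>) \<le> Y" if "\<bar>x\<bar> \<le> Y" for x y \<eta>
        using mult_mono[OF that normW Y norm_ge_zero] by simp
      show "norm (?I (\<lambda>y \<eta>. of_real \<eta> * Dy n m y \<eta>)) \<le> 2 * Y * (b' - a')"
        by (rule norm_rect_derivative_fst_le[OF _ ab Y, where G = "\<lambda>y \<eta>. of_real \<eta> * W n m y \<eta>"])
          (auto intro!: continuous_intros contD has_vector_derivative_mult_right deriv_y simp: norm_mult mono in_rect)
      show "norm (?I (\<lambda>y \<eta>. of_real y * De n m y \<eta>)) \<le> 2 * Y * (b - a)"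
        by (rule norm_rect_derivative_snd_le[OF _ ab Y, where G = "\<lambda>y \<eta>. of_real y * W n m y \<eta>"])
          (auto intro!: continuous_intros contD has_vector_derivative_mult_right deriv_eta simp: norm_mult mono in_rect)
    qed
    also have "norm ((of_nat n - of_nat m) * ?I (W n m)) = norm (?I (W n m)) * \<bar>real n - real m\<bar>"
    proof -
      have "(of_nat n - of_nat m :: complex) = of_real (real n - real m)" by simp
      then show ?thesis unfolding norm_mult by (simp only: norm_of_real mult.commute)
    qed
    finally show ?thesis .
  qed
qed

lemma hat_transform_eq_lborel:
  fixes f :: "'d::finite heis \<Rightarrow> complex"
  assumes "p \<in> tilde_H <+> hat_H0" "f \<in> borel_measurable borel"
  shows "hat_transform f p = (LINT w|lborel. cnj (cis (snd w * embed_l p) * hat_kernel p (fst w)) * f w)"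
  unfolding hat_transform_eq
  by (rule integral_completion) (use character_measurable[OF assms(1)] assms(2) in simp)

text \<open>The kernel and the indicator of a box both factor over the coordinate pairs \<open>(y\<^sub>j, \<eta>\<^sub>j)\<close> and \<open>s\<close>.\<close>
lemma fourier_heis_cbox:
  fixes n m :: "nat ^ 'd::finite" and a b a' b' :: "real ^ 'd"
  assumes l: "l \<noteq> 0"
  shows "fourier_heis (indicator (cbox ((a, a'), s0) ((b, b'), s1))) (n, m, l)
    = (LINT s|lborel. indicator {s0..s1} s *\<^sub>R cnj (cis (s * l)))
      * (\<Prod>j\<in>UNIV. cnj (rect (a $ j) (b $ j) (a' $ j) (b' $ j)
          (\<lambda>y \<eta>. wig1 (n $ j) (m $ j) (sqrt \<bar>l\<bar> * y) (sqrt \<bar>l\<bar> * (sgn l * \<eta>)))))"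
proof -
  let ?W = "\<lambda>j y \<eta>. wig1 (n $ j) (m $ j) (sqrt \<bar>l\<bar> * y) (sqrt \<bar>l\<bar> * (sgn l * \<eta>))"
  let ?B = "cbox (a, a') (b, b')"
  define G where "G = (\<lambda>Y :: (real ^ 'd) \<times> (real ^ 'd). \<Prod>j\<in>UNIV. cnj (?W j (fst Y $ j) (snd Y $ j)))"
  define F where "F = (\<lambda>j u t. indicator ({a $ j..b $ j} \<times> {a' $ j..b' $ j}) (u, t) *\<^sub>R cnj (?W j u t))"
  have contG: "continuous_on UNIV G"
    unfolding G_def by (intro continuous_intros)
  have contW: "jointly_continuous (\<lambda>u t. cnj (?W j u t))" for j
    by (intro continuous_intros)
  have kernel: "hat_kernel (Inl (n, m, l)) Y = cnj (G Y)" for Y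
    by (cases Y) (simp add: G_def wigner_eq_prod[OF l] del: wigner.simps)
  let ?H = "\<lambda>w :: 'd heis. cnj (cis (snd w * l)) * G (fst w)"
  have contH: "continuous_on UNIV ?H"
    by (intro continuous_intros continuous_on_compose2[OF contG]) auto
  have intH: "integrable (lborel \<Otimes>\<^sub>M lborel) (\<lambda>w. indicator (cbox ((a, a'), s0) ((b, b'), s1)) w *\<^sub>R ?H w)"
    unfolding lborel_prod
    by (intro borel_integrable_compact compact_cbox continuous_on_subset[OF contH]) simp
  have ind: "indicator (cbox ((a, a'), s0) ((b, b'), s1)) (Y, s) *\<^sub>R ?H (Y, s)
      = (indicator ?B Y *\<^sub>R G Y) * (indicator {s0..s1} s *\<^sub>R cnj (cis (s * l)))" for Y s
    by (simp add: cbox_Pair_eq[of "(a, a')" s0 "(b, b')" s1] split: split_indicator)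
  have "fourier_heis (indicator (cbox ((a, a'), s0) ((b, b'), s1))) (n, m, l)
      = hat_transform (indicator (cbox ((a, a'), s0) ((b, b'), s1))) (Inl (n, m, l))"
    by (simp only: hat_transform_Inl)
  also have "\<dots> = (LINT w|lborel. indicator (cbox ((a, a'), s0) ((b, b'), s1)) w *\<^sub>R ?H w)"
    using l by (subst hat_transform_eq_lborel)
      (auto simp: tilde_H_def embed_l_def kernel scaleR_conv_of_real of_real_indicator mult_ac simp del: hat_kernel.simps
        intro!: Bochner_Integration.integral_cong split: split_indicator)
  also have "\<dots> = (LINT Y|lborel. (LINT s|lborel. (indicator ?B Y *\<^sub>R G Y) * (indicator {s0..s1} s *\<^sub>R cnj (cis (s * l)))))"
    using lborel_pair.integral_fst'[OF intH] unfolding ind lborel_prod by simp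
  also have "\<dots> = (LINT s|lborel. indicator {s0..s1} s *\<^sub>R cnj (cis (s * l))) * (LINT Y|lborel. indicator ?B Y *\<^sub>R G Y)"
    unfolding integral_mult_right_zero integral_mult_left_zero by (rule mult.commute)
  also have "(LINT Y|lborel. indicator ?B Y *\<^sub>R G Y) = (\<Prod>j\<in>UNIV. (LINT u|lborel. (LINT t|lborel. F j u t)))"
  proof -
    have intG: "integrable (lborel \<Otimes>\<^sub>M lborel) (\<lambda>Y. indicator ?B Y *\<^sub>R G Y)"
      unfolding lborel_prod
      by (intro borel_integrable_compact compact_cbox continuous_on_subset[OF contG]) simp
    have prodF: "indicator ?B (y, \<eta>) *\<^sub>R G (y, \<eta>) = (\<Prod>j\<in>UNIV. F j (y $ j) (\<eta> $ j))" for y \<eta>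
    proof (cases "(y, \<eta>) \<in> ?B")
      case True
      then have "F j (y $ j) (\<eta> $ j) = cnj (?W j (y $ j) (\<eta> $ j))" for j
        by (simp add: F_def cbox_Pair_eq mem_box_cart)
      then show ?thesis using True by (simp add: G_def)
    next
      case False
      then obtain j where "(y $ j, \<eta> $ j) \<notin> {a $ j..b $ j} \<times> {a' $ j..b' $ j}"
        by (auto simp: cbox_Pair_eq mem_box_cart)
      then have "F j (y $ j) (\<eta> $ j) = 0" by (simp add: F_def)
      then have "(\<Prod>j\<in>UNIV. F j (y $ j) (\<eta> $ j)) = 0" by (intro prod_zero) auto
      then show ?thesis using False by simp
    qed
    have intF2: "integrable (lborel \<Otimes>\<^sub>M lborel) (\<lambda>z. F j (fst z) (snd z))" for j
      unfolding F_def lborel_prod using rect_integrable[OF contW, of "a $ j" "b $ j" "a' $ j" "b' $ j" j] by simp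
    have intF: "integrable lborel (F j u)" for j u
    proof -
      have "continuous_on {a' $ j..b' $ j} (\<lambda>t. indicator {a $ j..b $ j} u *\<^sub>R cnj (?W j u t))"
        by (intro continuous_intros)
      from borel_integrable_compact[OF compact_Icc this]
      show ?thesis unfolding F_def indicator_Times_scaleR by (simp add: mult.commute)
    qed
    have intF1: "integrable lborel (\<lambda>u. (LINT t|lborel. F j u t))" for j
      using lborel_pair.integrable_fst'[OF intF2] by simp
    have "(LINT Y|lborel. indicator ?B Y *\<^sub>R G Y) = (LINT y|lborel. (LINT \<eta>|lborel. indicator ?B (y, \<eta>) *\<^sub>R G (y, \<eta>)))"
      using lborel_pair.integral_fst'[OF intG] by (simp add: lborel_prod)
    also have "\<dots> = (LINT y|lborel. (\<Prod>j\<in>UNIV. (LINT t|lborel. F j (y $ j) t)))"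
      unfolding prodF vec_lborel_integral_prod[OF intF] ..
    also have "\<dots> = (\<Prod>j\<in>UNIV. (LINT u|lborel. (LINT t|lborel. F j u t)))"
      by (rule vec_lborel_integral_prod[OF intF1])
    finally show ?thesis .
  qed
  finally have product: "fourier_heis (indicator (cbox ((a, a'), s0) ((b, b'), s1))) (n, m, l)
    = (LINT s|lborel. indicator {s0..s1} s *\<^sub>R cnj (cis (s * l)))
      * (\<Prod>j\<in>UNIV. (LINT u|lborel. (LINT t|lborel. F j u t)))" .
  have "(LINT u|lborel. (LINT t|lborel. F j u t)) = cnj (rect (a $ j) (b $ j) (a' $ j) (b' $ j) (?W j))" for j
  proof -
    have "(LINT u|lborel. (LINT t|lborel. F j u t)) = rect (a $ j) (b $ j) (a' $ j) (b' $ j) (\<lambda>u t. cnj (?W j u t))"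
      unfolding rect_iterated[OF contW] F_def indicator_Times_scaleR by (simp del: scaleR_scaleR)
    also have "\<dots> = cnj (rect (a $ j) (b $ j) (a' $ j) (b' $ j) (?W j))"
      unfolding rect_def Bochner_Integration.integral_cnj[symmetric] by simp
    finally show ?thesis .
  qed
  then show ?thesis unfolding product by simp
qed

text \<open>Decay over the regular points only, measured by the distance to the boundary point \<open>(0, 0)\<close>.\<close>
definition vanishes_at_infinity :: "('d::finite heis \<Rightarrow> complex) \<Rightarrow> bool" where
  "vanishes_at_infinity f \<longleftrightarrow> (\<forall>\<epsilon>>0. \<exists>R. \<forall>w\<in>tilde_H.
     \<epsilon> \<le> norm (fourier_heis f w) \<longrightarrow> hat_dist (Inl w) (Inr (0, 0)) \<le> R)"

lemma norm_integral_phase_le: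
  assumes "s0 \<le> s1" "l \<noteq> 0"
  shows "norm (LINT s|lborel. indicator {s0..s1} s *\<^sub>R cnj (cis (s * l))) * \<bar>l\<bar> \<le> 2"
proof -
  have "(LINT s|lborel. indicator {s0..s1} s *\<^sub>R cis (- l * s))
      = cis (- l * s1) / (\<i> * of_real (- l)) - cis (- l * s0) / (\<i> * of_real (- l))"
    using assms by (intro integral_FTC_atLeastAtMost cis_antiderivative) (auto intro!: continuous_intros)
  also have "norm \<dots> \<le> 1 / \<bar>l\<bar> + 1 / \<bar>l\<bar>"
    by (rule order_trans[OF norm_triangle_ineq4]) (simp add: norm_divide norm_mult)
  finally show ?thesis using assms(2) by (simp add: cis_cnj mult.commute field_simps)
qed

text \<open>All factors in \<open>fourier_heis_cbox\<close> are bounded by one constant \<open>C\<close>; in each estimate the decay of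
  one factor is kept and the others are replaced by \<open>C\<close>.\<close>
lemma box_decay:
  fixes a b a' b' :: "real ^ 'd::finite"
  assumes ab: "\<And>j. a $ j \<le> b $ j" "\<And>j. a' $ j \<le> b' $ j" and s: "s0 \<le> s1"
  shows "\<exists>D. \<forall>n m l. l \<noteq> 0 \<longrightarrow>
     (let A = norm (fourier_heis (indicator (cbox ((a, a'), s0) ((b, b'), s1))) (n, m, l)) in
      A * \<bar>l\<bar> \<le> D \<and>
      (\<forall>j. A * \<bar>real (n $ j) - real (m $ j)\<bar> \<le> D
         \<and> A * (sqrt \<bar>l\<bar> * sqrt (real (n $ j))) \<le> D * (1 + \<bar>l\<bar>)
         \<and> A * (sqrt \<bar>l\<bar> * sqrt (real (m $ j))) \<le> D * (1 + \<bar>l\<bar>)))"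
proof -
  define Y where "Y = (\<lambda>j. \<bar>a $ j\<bar> + \<bar>b $ j\<bar> + \<bar>a' $ j\<bar> + \<bar>b' $ j\<bar>)"
  define p where "p = (\<lambda>j. (b' $ j - a' $ j) * (b $ j - a $ j))"
  define q where "q = (\<lambda>j. 2 * (b' $ j - a' $ j) + 2 * (b $ j - a $ j))"
  \<comment> \<open>One constant above every single bound: \<open>p\<close> is the area of a rectangle, and the other summands
    are the right-hand sides of \<open>wig1_rect_decay\<close>.\<close>
  define C where "C = 2 + (s1 - s0) + (\<Sum>j\<in>UNIV. p j + q j + Y j * q j + 2 * (Y j * p j))"
  have nonneg: "0 \<le> p j" "0 \<le> q j" "0 \<le> Y j" "0 \<le> Y j * p j" "0 \<le> Y j * q j" for j
    using ab[of j] by (auto simp: p_def q_def Y_def)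
  have "0 \<le> p j + q j + Y j * q j + 2 * (Y j * p j)" for j
    using nonneg[of j] by linarith
  then have "0 \<le> (\<Sum>j\<in>UNIV. p j + q j + Y j * q j + 2 * (Y j * p j))" by (rule sum_nonneg)
  then have Cs: "1 \<le> C" "s1 - s0 \<le> C" "2 \<le> C" using s unfolding C_def by linarith+
  note C1 = Cs(1)
  have Cj: "p j + q j + Y j * q j + 2 * (Y j * p j) \<le> C" for j
  proof -
    have "p j + q j + Y j * q j + 2 * (Y j * p j) \<le> (\<Sum>j\<in>UNIV. p j + q j + Y j * q j + 2 * (Y j * p j))"
      by (rule member_le_sum) (use nonneg in auto)
    then show ?thesis using s by (simp add: C_def)
  qed
  define D where "D = C ^ (CARD('d) + 1)"
  have "let A = norm (fourier_heis (indicator (cbox ((a, a'), s0) ((b, b'), s1))) (n, m, l)) in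
      A * \<bar>l\<bar> \<le> D \<and>
      (\<forall>j. A * \<bar>real (n $ j) - real (m $ j)\<bar> \<le> D
         \<and> A * (sqrt \<bar>l\<bar> * sqrt (real (n $ j))) \<le> D * (1 + \<bar>l\<bar>)
         \<and> A * (sqrt \<bar>l\<bar> * sqrt (real (m $ j))) \<le> D * (1 + \<bar>l\<bar>))" if l: "l \<noteq> 0" for n m :: "nat ^ 'd" and l
  proof -
    define S where "S = norm (LINT s|lborel. indicator {s0..s1} s *\<^sub>R cnj (cis (s * l)))"
    define J where "J = (\<lambda>j. norm (rect (a $ j) (b $ j) (a' $ j) (b' $ j)
          (\<lambda>y \<eta>. wig1 (n $ j) (m $ j) (sqrt \<bar>l\<bar> * y) (sqrt \<bar>l\<bar> * (sgn l * \<eta>)))))"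
    define A where "A = norm (fourier_heis (indicator (cbox ((a, a'), s0) ((b, b'), s1))) (n, m, l))"
    have A: "A = S * (\<Prod>j\<in>UNIV. J j)"
      unfolding A_def fourier_heis_cbox[OF l] S_def J_def by (simp add: norm_mult prod_norm[symmetric])
    have pos: "0 \<le> S" "0 \<le> J j" for j by (simp_all add: S_def J_def)
    have S: "S \<le> C" "S * \<bar>l\<bar> \<le> C"
    proof -
      have "S \<le> 1 * (s1 - s0)"
        unfolding S_def by (rule norm_integral_Icc_le[OF s]) auto
      then show "S \<le> C" using Cs by simp
      show "S * \<bar>l\<bar> \<le> C" unfolding S_def using norm_integral_phase_le[OF s l] Cs by linarith
    qed
    have J: "J j \<le> C" for j
    proof -
      have "J j \<le> 1 * (b' $ j - a' $ j) * (b $ j - a $ j)"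
        unfolding J_def by (rule norm_rect_le[OF _ ab]) (auto intro!: continuous_intros norm_wig1_le_1)
      then have "J j \<le> p j" by (simp add: p_def)
      then show ?thesis using Cj[of j] nonneg[of j] by linarith
    qed
    have others: "(\<Prod>i\<in>X. J i) \<le> C ^ card X" for X
      using prod_mono[of X J "\<lambda>_. C"] pos J by simp
    have one: "A * t \<le> D * r" if "J j * t \<le> C * r" "0 \<le> t" "0 \<le> r" for j t r
    proof -
      have "A * t = S * (\<Prod>i\<in>UNIV - {j}. J i) * (J j * t)"
        unfolding A by (simp add: prod.remove[of UNIV j])
      also have "\<dots> \<le> C * C ^ card (UNIV - {j} :: 'd set) * (C * r)"
        by (rule mult_mono[OF mult_mono[OF S(1) others] that(1)])
          (use that(2) pos C1 in \<open>auto intro!: mult_nonneg_nonneg prod_nonneg\<close>)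
      also have "\<dots> = D * r"
      proof -
        have "CARD('d) = Suc (card (UNIV - {j} :: 'd set))" by (rule card_Suc_Diff1[symmetric]) simp_all
        then show ?thesis unfolding D_def by (simp only: power_add power_Suc power_one_right mult_ac)
      qed
      finally show ?thesis .
    qed
    have ss: "sgn l * sgn l = 1" using l by (simp add: sgn_if)
    have diff: "J j * \<bar>real (n $ j) - real (m $ j)\<bar> \<le> C" for j
    proof -
      have "J j * \<bar>real (n $ j) - real (m $ j)\<bar> \<le> Y j * q j"
        using wig1_rect_decay(3)[OF ab[of j] _ ss, of "sqrt \<bar>l\<bar>" "n $ j" "m $ j"]
        by (simp add: J_def Y_def q_def algebra_simps)
      then show ?thesis using Cj[of j] nonneg[of j] by linarith
    qed
    have root: "J j * (sqrt \<bar>l\<bar> * sqrt (real N)) \<le> C * (1 + \<bar>l\<bar>)"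
      if "J j * (2 * sqrt \<bar>l\<bar> * norm (ladder (Suc N))) \<le> q j + 2 * \<bar>l\<bar> * (Y j * p j)" for j N
    proof -
      have "sqrt (real N) \<le> norm (ladder (Suc N))" by (simp add: ladder_def)
      then have "sqrt \<bar>l\<bar> * sqrt (real N) \<le> sqrt \<bar>l\<bar> * (2 * norm (ladder (Suc N)))"
        by (intro mult_left_mono) (use norm_ge_zero[of "ladder (Suc N)"] in \<open>linarith, simp\<close>)
      then have "J j * (sqrt \<bar>l\<bar> * sqrt (real N)) \<le> J j * (sqrt \<bar>l\<bar> * (2 * norm (ladder (Suc N))))"
        by (rule mult_left_mono) (rule pos)
      also have "\<dots> \<le> q j + 2 * \<bar>l\<bar> * (Y j * p j)" using that by (simp add: mult_ac)
      also have "\<dots> \<le> C + C * \<bar>l\<bar>"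
      proof (rule add_mono)
        show "q j \<le> C" using Cj[of j] nonneg[of j] by linarith
        have "2 * (Y j * p j) \<le> C" using Cj[of j] nonneg[of j] by linarith
        from mult_right_mono[OF this, of "\<bar>l\<bar>"] show "2 * \<bar>l\<bar> * (Y j * p j) \<le> C * \<bar>l\<bar>" by (simp add: mult_ac)
      qed
      finally show ?thesis by (simp add: distrib_left)
    qed
    have left: "J j * (sqrt \<bar>l\<bar> * sqrt (real (n $ j))) \<le> C * (1 + \<bar>l\<bar>)" for j
    proof (rule root)
      have "J j * (2 * sqrt \<bar>l\<bar> * norm (ladder (Suc (n $ j))))
          \<le> 2 * (b' $ j - a' $ j) + 2 * (b $ j - a $ j) + 2 * (sqrt \<bar>l\<bar>)\<^sup>2 * Y j * (b' $ j - a' $ j) * (b $ j - a $ j)"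
        unfolding J_def Y_def by (rule wig1_rect_decay(1)[OF ab[of j] _ ss]) simp
      then show "J j * (2 * sqrt \<bar>l\<bar> * norm (ladder (Suc (n $ j)))) \<le> q j + 2 * \<bar>l\<bar> * (Y j * p j)"
        by (simp only: q_def p_def real_sqrt_pow2[OF abs_ge_zero] mult.assoc)
    qed
    have right: "J j * (sqrt \<bar>l\<bar> * sqrt (real (m $ j))) \<le> C * (1 + \<bar>l\<bar>)" for j
    proof (rule root)
      have "J j * (2 * sqrt \<bar>l\<bar> * norm (ladder (Suc (m $ j))))
          \<le> 2 * (b' $ j - a' $ j) + 2 * (b $ j - a $ j) + 2 * (sqrt \<bar>l\<bar>)\<^sup>2 * Y j * (b' $ j - a' $ j) * (b $ j - a $ j)"
        unfolding J_def Y_def by (rule wig1_rect_decay(2)[OF ab[of j] _ ss]) simp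
      then show "J j * (2 * sqrt \<bar>l\<bar> * norm (ladder (Suc (m $ j)))) \<le> q j + 2 * \<bar>l\<bar> * (Y j * p j)"
        by (simp only: q_def p_def real_sqrt_pow2[OF abs_ge_zero] mult.assoc)
    qed
    have "A * \<bar>l\<bar> = (S * \<bar>l\<bar>) * (\<Prod>j\<in>UNIV. J j)" unfolding A by simp
    also have "\<dots> \<le> C * C ^ CARD('d)"
      using others[of UNIV] S(2) pos C1 by (intro mult_mono) (auto intro!: prod_nonneg)
    finally have "A * \<bar>l\<bar> \<le> D" by (simp add: D_def)
    moreover have "A * \<bar>real (n $ j) - real (m $ j)\<bar> \<le> D" for j
      using one[of j "\<bar>real (n $ j) - real (m $ j)\<bar>" 1] diff by simp
    moreover have "A * (sqrt \<bar>l\<bar> * sqrt (real (n $ j))) \<le> D * (1 + \<bar>l\<bar>)"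
      "A * (sqrt \<bar>l\<bar> * sqrt (real (m $ j))) \<le> D * (1 + \<bar>l\<bar>)" for j
      by (rule one[OF left], simp, simp) (rule one[OF right], simp, simp)
    ultimately show ?thesis
      unfolding Let_def A_def[symmetric] by simp
  qed
  then show ?thesis by blast
qed

text \<open>Where the transform is at least \<open>\<epsilon>\<close>, \<open>box_decay\<close> first bounds \<open>\<lambda>\<close>, and then, with this bound, the
  products \<open>\<bar>\<lambda>\<bar> n\<^sub>j\<close> and \<open>\<bar>\<lambda>\<bar> m\<^sub>j\<close>.\<close>
lemma vanishes_cbox:
  fixes a b a' b' :: "real ^ 'd::finite"
  assumes "\<And>j. a $ j \<le> b $ j" "\<And>j. a' $ j \<le> b' $ j" "s0 \<le> s1"
  shows "vanishes_at_infinity (indicator (cbox ((a, a'), s0) ((b, b'), s1)))"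
  unfolding vanishes_at_infinity_def
proof (intro allI impI)
  fix \<epsilon> :: real assume \<epsilon>: "0 < \<epsilon>"
  let ?f = "indicator (cbox ((a, a'), s0) ((b, b'), s1)) :: 'd heis \<Rightarrow> complex"
  obtain D where D: "\<And>n m l. l \<noteq> 0 \<Longrightarrow>
     (let A = norm (fourier_heis ?f (n, m, l)) in
      A * \<bar>l\<bar> \<le> D \<and>
      (\<forall>j. A * \<bar>real (n $ j) - real (m $ j)\<bar> \<le> D
         \<and> A * (sqrt \<bar>l\<bar> * sqrt (real (n $ j))) \<le> D * (1 + \<bar>l\<bar>)
         \<and> A * (sqrt \<bar>l\<bar> * sqrt (real (m $ j))) \<le> D * (1 + \<bar>l\<bar>)))"
    using box_decay[OF assms] by metis
  \<comment> \<open>\<open>E\<close> bounds \<open>(\<bar>l\<bar> n\<^sub>j)\<^sup>1\<^sup>/\<^sup>2\<close> once \<open>\<bar>l\<bar> \<le> D / \<epsilon>\<close> is known.\<close>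
  define E where "E = D * (1 + D / \<epsilon>) / \<epsilon>"
  define R where "R = real CARD('d) * (2 * E\<^sup>2) + real CARD('d) * (D / \<epsilon>) + D / \<epsilon>"
  have "hat_dist (Inl w) (Inr (0, 0)) \<le> R" if w: "w \<in> tilde_H" "\<epsilon> \<le> norm (fourier_heis ?f w)" for w
  proof -
    obtain n m l where nml: "w = (n, m, l)" by (cases w) auto
    have l: "l \<noteq> 0" using w nml by (auto simp: tilde_H_def)
    define A where "A = norm (fourier_heis ?f (n, m, l))"
    have A: "\<epsilon> \<le> A" using w nml by (simp add: A_def)
    have DA: "A * \<bar>l\<bar> \<le> D" "A * \<bar>real (n $ j) - real (m $ j)\<bar> \<le> D"
      "A * (sqrt \<bar>l\<bar> * sqrt (real (n $ j))) \<le> D * (1 + \<bar>l\<bar>)"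
      "A * (sqrt \<bar>l\<bar> * sqrt (real (m $ j))) \<le> D * (1 + \<bar>l\<bar>)" for j
      using D[OF l, of n m] unfolding Let_def A_def[symmetric] by auto
    have div: "t \<le> u / \<epsilon>" if "A * t \<le> u" "0 \<le> t" for t u
    proof -
      have "\<epsilon> * t \<le> A * t" using A that by (intro mult_right_mono)
      then show ?thesis using that \<epsilon> by (simp add: field_simps)
    qed
    have l_le: "\<bar>l\<bar> \<le> D / \<epsilon>" using div[OF DA(1)] by simp
    have "0 \<le> D" using DA(1) A \<epsilon> by (smt (verit) abs_ge_zero mult_nonneg_nonneg)
    have E: "t \<le> E" if "A * t \<le> D * (1 + \<bar>l\<bar>)" "0 \<le> t" for t
    proof -
      have "t \<le> D * (1 + \<bar>l\<bar>) / \<epsilon>" using div that by blast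
      also have "\<dots> \<le> E" unfolding E_def using l_le \<open>0 \<le> D\<close> \<epsilon>
        by (intro divide_right_mono mult_left_mono) auto
      finally show ?thesis .
    qed
    have sq: "\<bar>l\<bar> * real N \<le> E\<^sup>2" if "sqrt \<bar>l\<bar> * sqrt (real N) \<le> E" for N
      using power_mono[OF that, of 2] by (simp add: power_mult_distrib)
    have "norm_l1 (l *\<^sub>R vec_nat (n + m) - 0) \<le> (\<Sum>j\<in>(UNIV :: 'd set). 2 * E\<^sup>2)"
      unfolding norm_l1_def
    proof (rule sum_mono)
      fix j
      have "(l *\<^sub>R vec_nat (n + m) - 0) $ j = l * (real (n $ j) + real (m $ j))"
        by (simp add: vec_nat_def)
      then have "\<bar>(l *\<^sub>R vec_nat (n + m) - 0) $ j\<bar> = \<bar>l\<bar> * real (n $ j) + \<bar>l\<bar> * real (m $ j)"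
        by (simp only: abs_mult) (simp add: distrib_left)
      also have "\<dots> \<le> E\<^sup>2 + E\<^sup>2" by (intro add_mono sq E DA) auto
      finally show "\<bar>(l *\<^sub>R vec_nat (n + m) - 0) $ j\<bar> \<le> 2 * E\<^sup>2" by simp
    qed
    moreover have "norm_l1 (vec_nat m - vec_nat n - vec_int 0) \<le> (\<Sum>j\<in>(UNIV :: 'd set). D / \<epsilon>)"
      unfolding norm_l1_def
    proof (rule sum_mono)
      fix j
      show "\<bar>(vec_nat m - vec_nat n - vec_int 0) $ j\<bar> \<le> D / \<epsilon>"
        using div[OF DA(2)[of j]] by (simp add: vec_nat_def vec_int_def abs_minus_commute)
    qed
    ultimately show ?thesis using l_le by (simp add: nml R_def)
  qed
  then show "\<exists>R. \<forall>w\<in>tilde_H. \<epsilon> \<le> norm (fourier_heis ?f w) \<longrightarrow> hat_dist (Inl w) (Inr (0, 0)) \<le> R" by blast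
qed

section \<open>Decay of the transform of an integrable function\<close>

lemma fourier_heis_linear:
  assumes "w \<in> tilde_H" "integrable lebesgue f" "integrable lebesgue g"
  shows "fourier_heis (\<lambda>v. a * f v + b * g v) w = a * fourier_heis f w + b * fourier_heis g w"
  using hat_transform_linear[of "Inl w" f g a b] assms by (simp add: hat_transform_Inl InlI)

lemma norm_fourier_heis_le:
  assumes "w \<in> tilde_H" "integrable lebesgue f"
  shows "norm (fourier_heis f w) \<le> L1_norm f"
  using norm_hat_transform_le[of "Inl w" f] assms by (simp add: hat_transform_Inl InlI)

lemma vanishes_linear:
  assumes "integrable lebesgue f" "vanishes_at_infinity f" "integrable lebesgue g" "vanishes_at_infinity g"
  shows "vanishes_at_infinity (\<lambda>v. a * f v + b * g v)"
  unfolding vanishes_at_infinity_def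
proof (intro allI impI)
  fix \<epsilon> :: real assume \<epsilon>: "0 < \<epsilon>"
  define \<delta> where "\<delta> = \<epsilon> / (norm a + norm b + 1)"
  have pos: "0 < norm a + norm b + 1" by (simp add: add_nonneg_pos)
  have \<delta>: "0 < \<delta>" using \<epsilon> pos by (simp add: \<delta>_def)
  obtain R1 where R1: "\<And>w. w \<in> tilde_H \<Longrightarrow> \<delta> \<le> norm (fourier_heis f w) \<Longrightarrow> hat_dist (Inl w) (Inr (0, 0)) \<le> R1"
    using assms(2) \<delta> unfolding vanishes_at_infinity_def by blast
  obtain R2 where R2: "\<And>w. w \<in> tilde_H \<Longrightarrow> \<delta> \<le> norm (fourier_heis g w) \<Longrightarrow> hat_dist (Inl w) (Inr (0, 0)) \<le> R2"
    using assms(4) \<delta> unfolding vanishes_at_infinity_def by blast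
  have "hat_dist (Inl w) (Inr (0, 0)) \<le> max R1 R2"
    if w: "w \<in> tilde_H" "\<epsilon> \<le> norm (fourier_heis (\<lambda>v. a * f v + b * g v) w)" for w
  proof (rule ccontr)
    assume "\<not> hat_dist (Inl w) (Inr (0, 0)) \<le> max R1 R2"
    then have small: "norm (fourier_heis f w) \<le> \<delta>" "norm (fourier_heis g w) \<le> \<delta>"
      using R1[OF w(1)] R2[OF w(1)] by linarith+
    have "norm (fourier_heis (\<lambda>v. a * f v + b * g v) w) \<le> norm a * norm (fourier_heis f w) + norm b * norm (fourier_heis g w)"
      unfolding fourier_heis_linear[OF w(1) assms(1,3)] by (simp add: norm_triangle_le norm_mult)
    also have "\<dots> \<le> norm a * \<delta> + norm b * \<delta>"
      by (intro add_mono mult_left_mono small norm_ge_zero)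
    also have "\<dots> < (norm a + norm b + 1) * \<delta>" using \<delta> by (simp add: algebra_simps)
    also have "\<dots> = \<epsilon>" using pos by (simp add: \<delta>_def)
    finally show False using w(2) by linarith
  qed
  then show "\<exists>R. \<forall>w\<in>tilde_H. \<epsilon> \<le> norm (fourier_heis (\<lambda>v. a * f v + b * g v) w) \<longrightarrow> hat_dist (Inl w) (Inr (0, 0)) \<le> R"
    by blast
qed

text \<open>Dominated convergence gives convergence in \<open>L\<^sup>1\<close>, and the transform is bounded by the \<open>L\<^sup>1\<close> norm.\<close>
lemma vanishes_dominated:
  fixes f :: "'d::finite heis \<Rightarrow> complex"
  assumes f: "integrable lebesgue f" and s: "\<And>i. integrable lebesgue (s i)" "\<And>i. vanishes_at_infinity (s i)"
    and lim: "AE x in lebesgue. (\<lambda>i. s i x) \<longlonglongrightarrow> f x"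
    and bound: "\<And>i. AE x in lebesgue. norm (s i x) \<le> h x" and h: "integrable lebesgue h"
  shows "vanishes_at_infinity f"
  unfolding vanishes_at_infinity_def
proof (intro allI impI)
  fix \<epsilon> :: real assume \<epsilon>: "0 < \<epsilon>"
  have "(\<lambda>i. LINT x|lebesgue. norm (f x - s i x)) \<longlonglongrightarrow> (LINT x|(lebesgue :: 'd heis measure). 0)"
  proof (rule integral_dominated_convergence[where w = "\<lambda>x. norm (f x) + h x"])
    show "AE x in lebesgue. (\<lambda>i. norm (f x - s i x)) \<longlonglongrightarrow> 0"
      using lim
    proof eventually_elim
      case (elim x)
      then have "(\<lambda>i. f x - s i x) \<longlonglongrightarrow> f x - f x" by (intro tendsto_intros)
      from tendsto_norm[OF this] show ?case by simp
    qed
    show "AE x in lebesgue. norm (norm (f x - s i x)) \<le> norm (f x) + h x" for i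
      using bound[of i]
    proof eventually_elim
      case (elim x)
      then show ?case using norm_triangle_ineq4[of "f x" "s i x"] by simp
    qed
  qed (use f s h in auto)
  then have "\<forall>\<^sub>F i in sequentially. (LINT x|lebesgue. norm (f x - s i x)) < \<epsilon> / 2"
    using \<epsilon> by (intro order_tendstoD(2)) auto
  then obtain i where i: "L1_norm (\<lambda>x. f x - s i x) < \<epsilon> / 2"
    by (auto simp: eventually_sequentially L1_norm_def)
  obtain R where R: "\<And>w. w \<in> tilde_H \<Longrightarrow> \<epsilon> / 2 \<le> norm (fourier_heis (s i) w) \<Longrightarrow> hat_dist (Inl w) (Inr (0, 0)) \<le> R"
    using s(2)[of i] \<epsilon> unfolding vanishes_at_infinity_def by (metis half_gt_zero)
  have "hat_dist (Inl w) (Inr (0, 0)) \<le> R" if w: "w \<in> tilde_H" "\<epsilon> \<le> norm (fourier_heis f w)" for w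
  proof (rule R[OF w(1)])
    have "fourier_heis (\<lambda>x. f x - s i x) w = fourier_heis f w - fourier_heis (s i) w"
      using fourier_heis_linear[OF w(1) f s(1)[of i], of 1 "-1"] by simp
    moreover have "norm (fourier_heis (\<lambda>x. f x - s i x) w) < \<epsilon> / 2"
      using norm_fourier_heis_le[OF w(1), of "\<lambda>x. f x - s i x"] f s i by simp
    ultimately show "\<epsilon> / 2 \<le> norm (fourier_heis (s i) w)"
      using w(2) norm_triangle_sub[of "fourier_heis f w" "fourier_heis (s i) w"] by simp
  qed
  then show "\<exists>R. \<forall>w\<in>tilde_H. \<epsilon> \<le> norm (fourier_heis f w) \<longrightarrow> hat_dist (Inl w) (Inr (0, 0)) \<le> R"
    by blast
qed

lemma integrable_indicator_complex:
  assumes "A \<in> sets M" "emeasure M A < \<infinity>"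
  shows "integrable M (indicator A :: _ \<Rightarrow> complex)"
proof -
  have "integrable M (\<lambda>x. complex_of_real (indicator A x))"
    using assms by (intro integrable_of_real integrable_real_indicator)
  then show ?thesis by (simp add: of_real_indicator)
qed

lemma box_integrable:
  "integrable lebesgue (indicator (box A B) :: 'd::finite heis \<Rightarrow> complex)"
  "integrable lebesgue (indicator (cbox A B) :: 'd::finite heis \<Rightarrow> complex)"
proof -
  show "integrable lebesgue (indicator (box A B) :: 'd heis \<Rightarrow> complex)"
    by (rule integrable_indicator_complex) (use emeasure_lborel_box_finite[of A B] in simp_all)
  show "integrable lebesgue (indicator (cbox A B) :: 'd heis \<Rightarrow> complex)"
    by (rule integrable_indicator_complex) (use emeasure_lborel_cbox_finite[of A B] in simp_all)
qed

lemma vanishes_zero: "vanishes_at_infinity (\<lambda>_ :: 'd::finite heis. 0)"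
proof -
  have "fourier_heis (\<lambda>_ :: 'd heis. 0) w = 0" for w
    by (cases w) (simp add: case_prod_unfold)
  then show ?thesis by (simp add: vanishes_at_infinity_def)
qed

lemma vanishes_empty: "vanishes_at_infinity (indicator {} :: 'd::finite heis \<Rightarrow> complex)"
proof -
  have "(indicator {} :: 'd heis \<Rightarrow> complex) = (\<lambda>_. 0)" by (simp add: fun_eq_iff)
  then show ?thesis using vanishes_zero by simp
qed

lemma vanishes_box: "vanishes_at_infinity (indicator (box A B) :: 'd::finite heis \<Rightarrow> complex)"
proof (cases "box A B = {}")
  case True
  then show ?thesis using vanishes_empty by simp
next
  case False
  obtain a a' s0 where A: "A = ((a, a'), s0)" by (metis prod_cases3 surj_pair)
  obtain b b' s1 where B: "B = ((b, b'), s1)" by (metis prod_cases3 surj_pair)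
  obtain x x' s where x: "((x, x'), s) \<in> box A B" using False by auto
  then have "((x, x'), s) \<in> cbox ((a, a'), s0) ((b, b'), s1)"
    using box_subset_cbox unfolding A B by blast
  then have "\<And>j. a $ j \<le> x $ j \<and> x $ j \<le> b $ j" "\<And>j. a' $ j \<le> x' $ j \<and> x' $ j \<le> b' $ j" "s0 \<le> s \<and> s \<le> s1"
    by (simp_all add: cbox_Pair_eq mem_box_cart)
  then have "vanishes_at_infinity (indicator (cbox ((a, a'), s0) ((b, b'), s1)))"
    by (intro vanishes_cbox) (meson order_trans)+
  then have V: "vanishes_at_infinity (indicator (cbox A B) :: 'd heis \<Rightarrow> complex)" by (simp add: A B)
  have "cbox A B - box A B \<in> null_sets lebesgue"
    using negligible_frontier_interval negligible_iff_null_sets by blast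
  then have "AE w in lebesgue. w \<notin> cbox A B - box A B" by (rule AE_not_in)
  then have "AE w in lebesgue. (\<lambda>_::nat. indicator (cbox A B) w) \<longlonglongrightarrow> (indicator (box A B) w :: complex)"
  proof eventually_elim
    case (elim w)
    then have "indicator (cbox A B) w = (indicator (box A B) w :: complex)"
      using box_subset_cbox[of A B] by (auto split: split_indicator)
    then show ?case by simp
  qed
  then show ?thesis
    by (rule vanishes_dominated[OF box_integrable(1) box_integrable(2) V _ _ integrable_norm[OF box_integrable(2)[of A B]]]) simp
qed

text \<open>Open boxes form an intersection-stable generator of the Borel sets. Cutting with a fixed box keeps
  complements and unions integrable.\<close>
lemma vanishes_bounded_borel:
  fixes A :: "'d::finite heis set"
  assumes "A \<in> sets borel"
  shows "vanishes_at_infinity (indicator (A \<inter> box L U) :: 'd heis \<Rightarrow> complex)"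
proof -
  let ?G = "range (\<lambda>(a, b). box a b :: 'd heis set)"
  have gen: "sigma_sets UNIV ?G = sets borel" by (simp add: borel_eq_box)
  have int: "integrable lebesgue (indicator (A \<inter> box L U) :: 'd heis \<Rightarrow> complex)" if "A \<in> sigma_sets UNIV ?G" for A
  proof (rule integrable_indicator_complex)
    have A: "A \<in> sets borel" using that gen by simp
    then show "A \<inter> box L U \<in> sets lebesgue" by auto
    have "emeasure lborel (A \<inter> box L U) \<le> emeasure lborel (box L U)"
      by (rule emeasure_mono) auto
    also have "\<dots> < \<infinity>" by (rule emeasure_lborel_box_finite)
    finally show "emeasure lebesgue (A \<inter> box L U) < \<infinity>" using A by simp
  qed
  have "Int_stable ?G" by (auto simp: Int_stable_def box_Int_box)
  moreover have "?G \<subseteq> Pow UNIV" by simp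
  moreover have "A \<in> sigma_sets UNIV ?G" using assms gen by simp
  ultimately show ?thesis
  proof (induction rule: sigma_sets_induct_disjoint)
    case (basic A)
    then obtain a b where "A = box a b" by auto
    then show ?case using vanishes_box by (simp add: box_Int_box)
  next
    case empty
    show ?case using vanishes_empty by (simp only: Int_empty_left)
  next
    case (compl A)
    have "(indicator ((UNIV - A) \<inter> box L U) :: 'd heis \<Rightarrow> complex)
        = (\<lambda>w. 1 * indicator (box L U) w + (-1) * indicator (A \<inter> box L U) w)"
      by (auto simp: fun_eq_iff split: split_indicator)
    then show ?case
      using vanishes_linear[OF box_integrable(1) vanishes_box int[OF compl(1)] compl(2), of 1 L U "-1"] by simp
  next
    case (union A)
    have A: "A i \<in> sigma_sets UNIV ?G" for i using union(2) by auto
    then have Un: "(\<Union>i<k. A i) \<in> sigma_sets UNIV ?G" "(\<Union>i. A i) \<in> sigma_sets UNIV ?G" for k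
      unfolding gen by auto
    have partial: "vanishes_at_infinity (indicator ((\<Union>i<k. A i) \<inter> box L U) :: 'd heis \<Rightarrow> complex)" for k
    proof (induction k)
      case 0
      show ?case using vanishes_empty by (simp only: lessThan_0 UN_empty Int_empty_left)
    next
      case (Suc k)
      have "w \<notin> A k" if "w \<in> A i" "i < k" for i w
        using disjoint_family_onD[OF union(1), of i k] that by auto
      then have "(indicator ((\<Union>i<Suc k. A i) \<inter> box L U) :: 'd heis \<Rightarrow> complex)
        = (\<lambda>w. 1 * indicator ((\<Union>i<k. A i) \<inter> box L U) w + 1 * indicator (A k \<inter> box L U) w)"
        by (auto simp: fun_eq_iff lessThan_Suc split: split_indicator)
      then show ?case
        using vanishes_linear[OF int[OF Un(1)] Suc.IH int[OF A] union(3), of 1 1] by simp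
    qed
    have "(\<lambda>k. indicator ((\<Union>i<k. A i) \<inter> box L U) w) \<longlonglongrightarrow> (indicator ((\<Union>i. A i) \<inter> box L U) w :: complex)" for w
      unfolding indicator_inter_arith by (intro tendsto_mult tendsto_const LIMSEQ_indicator_UN)
    then have lim: "AE w in lebesgue. (\<lambda>k. indicator ((\<Union>i<k. A i) \<inter> box L U) w)
        \<longlonglongrightarrow> (indicator ((\<Union>i. A i) \<inter> box L U) w :: complex)" by (intro AE_I2)
    show ?case
      by (rule vanishes_dominated[OF int[OF Un(2)] int[OF Un(1)] partial lim _
            integrable_norm[OF box_integrable(1)[of L U]]])
        (auto split: split_indicator)
  qed
qed

lemma vanishes_finite_measure:
  fixes A :: "'d::finite heis set"
  assumes A: "A \<in> sets lebesgue" "emeasure lebesgue A < \<infinity>"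
  shows "vanishes_at_infinity (indicator A :: 'd heis \<Rightarrow> complex)"
proof -
  obtain S N N' where S: "A = S \<union> N" "N \<subseteq> N'" "N' \<in> null_sets lborel" "S \<in> sets lborel"
    using A(1) by (rule sets_completionE)
  let ?B = "\<lambda>k::nat. box (- (real k *\<^sub>R One)) (real k *\<^sub>R One) :: 'd heis set"
  have UN: "(\<Union>k. ?B k) = UNIV" by (rule UN_box_eq_UNIV)
  have inc: "incseq (\<lambda>k. S \<inter> ?B k)"
    unfolding incseq_def
  proof (intro allI impI)
    fix i j :: nat assume "i \<le> j"
    then have "?B i \<subseteq> ?B j" by (intro subset_box_imp) (auto simp: inner_sum_left_Basis)
    then show "S \<inter> ?B i \<subseteq> S \<inter> ?B j" by blast
  qed
  have intA: "integrable lebesgue (indicator A :: 'd heis \<Rightarrow> complex)"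
    by (rule integrable_indicator_complex[OF A])
  have int: "integrable lebesgue (indicator (S \<inter> ?B k) :: 'd heis \<Rightarrow> complex)" for k
  proof (rule integrable_indicator_complex)
    show "S \<inter> ?B k \<in> sets lebesgue" using S(4) by auto
    have "emeasure lebesgue (S \<inter> ?B k) \<le> emeasure lebesgue A"
      using S(1) A(1) by (intro emeasure_mono) auto
    then show "emeasure lebesgue (S \<inter> ?B k) < \<infinity>" using A(2) by (rule le_less_trans)
  qed
  have V: "vanishes_at_infinity (indicator (S \<inter> ?B k) :: 'd heis \<Rightarrow> complex)" for k
    using S(4) by (intro vanishes_bounded_borel) simp
  have "AE w in lebesgue. w \<notin> N'"
    using S(3) by (intro AE_not_in) (rule null_sets_completionI)
  then have lim: "AE w in lebesgue. (\<lambda>k. indicator (S \<inter> ?B k) w) \<longlonglongrightarrow> (indicator A w :: complex)"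
  proof eventually_elim
    case (elim w)
    have exhaust: "(\<Union>k. S \<inter> ?B k) = S" unfolding Int_UN_distrib[symmetric] UN by simp
    have "(\<lambda>k. indicator (S \<inter> ?B k) w) \<longlonglongrightarrow> (indicator (\<Union>k. S \<inter> ?B k) w :: complex)"
      by (rule LIMSEQ_indicator_incseq[OF inc])
    then have "(\<lambda>k. indicator (S \<inter> ?B k) w) \<longlonglongrightarrow> (indicator S w :: complex)"
      unfolding exhaust .
    moreover have "indicator S w = (indicator A w :: complex)"
      using elim S(1,2) by (auto split: split_indicator)
    ultimately show ?case by simp
  qed
  show ?thesis
    by (rule vanishes_dominated[OF intA int V lim _ integrable_norm[OF intA]])
      (use S(1) in \<open>auto split: split_indicator\<close>)
qed

lemma vanishes_integrable:
  fixes f :: "'d::finite heis \<Rightarrow> complex"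
  assumes "integrable lebesgue f"
  shows "vanishes_at_infinity f"
  using assms
proof (induction rule: integrable_induct)
  case (base A c)
  have int: "integrable lebesgue (indicator A :: 'd heis \<Rightarrow> complex)"
    by (rule integrable_indicator_complex[OF base])
  have "(\<lambda>x. indicator A x *\<^sub>R c) = (\<lambda>x. c * indicator A x + 0 * indicator A x)"
    by (auto simp: fun_eq_iff split: split_indicator)
  then show ?case
    using vanishes_linear[OF int vanishes_finite_measure[OF base] int vanishes_finite_measure[OF base], of c 0] by simp
next
  case (add f g)
  then show ?case using vanishes_linear[of f g 1 1] by simp
next
  case (lim f s)
  show ?case
  proof (rule vanishes_dominated[where s = s and h = "\<lambda>x. 2 * norm (f x)"])
  qed (use lim in auto)
qed

section \<open>The extended Fourier transform\<close>

text \<open>Two continuous functions that agree on the dense set of regular points are equal.\<close>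
lemma continuous_extension_iff:
  assumes f: "integrable lebesgue f"
  shows "continuous_extension f F \<longleftrightarrow> F = (\<lambda>\<omega>. hat_transform f (Rep_hat_H \<omega>))"
proof
  let ?F = "\<lambda>\<omega>. hat_transform f (Rep_hat_H \<omega>)"
  have reg: "?F (reg w) = fourier_heis f w" if "w \<in> tilde_H" for w
    by (simp add: Rep_reg[OF that] hat_transform_Inl)
  {
    assume "F = ?F"
    then show "continuous_extension f F"
      using continuous_hat_transform[OF f] reg by (simp add: continuous_extension_def)
  }
  assume F: "continuous_extension f F"
  have "open {\<omega>. F \<omega> \<noteq> ?F \<omega>}"
    using F continuous_hat_transform[OF f] by (intro open_Collect_neq) (auto simp: continuous_extension_def)
  moreover have "{\<omega>. F \<omega> \<noteq> ?F \<omega>} \<inter> reg ` tilde_H = {}"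
    using F reg by (auto simp: continuous_extension_def)
  ultimately have "{\<omega>. F \<omega> \<noteq> ?F \<omega>} = {}"
    using reg_dense unfolding open_dist by (metis (no_types, lifting) IntI all_not_in_conv image_eqI)
  then show "F = ?F" by auto
qed

lemma fourier_ext_eq:
  assumes "integrable lebesgue f"
  shows "fourier_ext f = (\<lambda>\<omega>. hat_transform f (Rep_hat_H \<omega>))"
  unfolding fourier_ext_def continuous_extension_iff[OF assms] by simp

text \<open>A boundary point outside the ball at which the transform is large would have regular points
  nearby with the same properties, contrary to the decay over regular points.\<close>
lemma fourier_ext_C0:
  fixes f :: "'d::finite heis \<Rightarrow> complex"
  assumes f: "integrable lebesgue f"
  shows "fourier_ext f \<in> C0"
proof -
  let ?F = "\<lambda>\<omega>. hat_transform f (Rep_hat_H \<omega>)"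
  let ?o = "bdry (0, 0) :: 'd hat_H"
  have cont: "continuous_on UNIV ?F" by (rule continuous_hat_transform[OF f])
  have "\<exists>K. compact K \<and> (\<forall>\<omega>. \<omega> \<notin> K \<longrightarrow> norm (?F \<omega>) < \<epsilon>)" if \<epsilon>: "0 < \<epsilon>" for \<epsilon>
  proof -
    obtain R where R: "\<And>w. w \<in> tilde_H \<Longrightarrow> \<epsilon> / 2 \<le> norm (fourier_heis f w) \<Longrightarrow> hat_dist (Inl w) (Inr (0, 0)) \<le> R"
      using vanishes_integrable[OF f] \<epsilon> unfolding vanishes_at_infinity_def by (metis half_gt_zero)
    have "norm (?F \<omega>) < \<epsilon>" if \<omega>: "\<omega> \<notin> cball ?o R" for \<omega>
    proof (rule ccontr)
      assume "\<not> norm (?F \<omega>) < \<epsilon>"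
      then have mem: "\<omega> \<in> {\<omega>. \<epsilon> / 2 < norm (?F \<omega>)} \<inter> - cball ?o R" using \<epsilon> \<omega> by simp
      have "open ({\<omega>. \<epsilon> / 2 < norm (?F \<omega>)} \<inter> - cball ?o R)"
        by (intro open_Int open_Collect_less continuous_intros cont) auto
      then obtain e where e: "0 < e" "\<And>\<xi>. dist \<xi> \<omega> < e \<Longrightarrow> \<xi> \<in> {\<omega>. \<epsilon> / 2 < norm (?F \<omega>)} \<inter> - cball ?o R"
        using mem unfolding open_dist by blast
      obtain w where w: "w \<in> tilde_H" "dist (reg w) \<omega> < e" using reg_dense[OF e(1)] by blast
      have "\<epsilon> / 2 < norm (fourier_heis f w)" "R < dist (reg w) ?o"
        using e(2)[OF w(2)] by (auto simp: Rep_reg[OF w(1)] hat_transform_Inl dist_commute)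
      moreover have "(0, 0) \<in> (hat_H0 :: 'd freq0 set)" by (simp add: hat_H0_def)
      ultimately show False
        using R[OF w(1)] by (simp add: dist_hat_H_def Rep_reg[OF w(1)] Rep_bdry)
    qed
    then show ?thesis using compact_cball_hat_H by blast
  qed
  then show ?thesis unfolding fourier_ext_eq[OF f] C0_def using cont by blast
qed

theorem theorem1p3:
  shows "(\<forall>(f::'d::finite heis \<Rightarrow> complex)\<in>L1_heis. \<exists>!F. continuous_extension f F)
    \<and> (\<forall>(f::'d heis \<Rightarrow> complex)\<in>L1_heis. fourier_ext f \<in> C0)
    \<and> (\<forall>(f::'d heis \<Rightarrow> complex)\<in>L1_heis. \<forall>g\<in>L1_heis. \<forall>a b.
         fourier_ext (\<lambda>w. a * f w + b * g w) = (\<lambda>\<omega>. a * fourier_ext f \<omega> + b * fourier_ext g \<omega>))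
    \<and> (\<forall>(f::'d heis \<Rightarrow> complex)\<in>L1_heis. \<forall>\<epsilon>>0. \<exists>\<delta>>0. \<forall>g\<in>L1_heis.
         L1_norm (\<lambda>w. g w - f w) < \<delta> \<longrightarrow> sup_norm (\<lambda>\<omega>. fourier_ext g \<omega> - fourier_ext f \<omega>) < \<epsilon>)
    \<and> (\<forall>(f::'d heis \<Rightarrow> complex)\<in>L1_heis. \<forall>(x, k)\<in>hat_H0.
         fourier_ext f (bdry (x, k)) = (LINT (Y, s)|lebesgue. cnj (heis_kernel (x, k) Y) * f (Y, s)))"
proof (intro conjI ballI allI impI)
  fix f :: "'d heis \<Rightarrow> complex" assume "f \<in> L1_heis"
  then have f: "integrable lebesgue f" by (simp add: L1_heis_def)
  show "\<exists>!F. continuous_extension f F" unfolding continuous_extension_iff[OF f] by simp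
  show "fourier_ext f \<in> C0" by (rule fourier_ext_C0[OF f])
  show "case v of (x, k) \<Rightarrow> fourier_ext f (bdry (x, k)) = (LINT (Y, s)|lebesgue. cnj (heis_kernel (x, k) Y) * f (Y, s))"
    if "v \<in> hat_H0" for v
    using that by (cases v) (simp add: fourier_ext_eq[OF f] Rep_bdry hat_transform_Inr)
  {
    fix g :: "'d heis \<Rightarrow> complex" and a b :: complex assume "g \<in> L1_heis"
    then have g: "integrable lebesgue g" by (simp add: L1_heis_def)
    have fg: "integrable lebesgue (\<lambda>w. a * f w + b * g w)" using f g by simp
    show "fourier_ext (\<lambda>w. a * f w + b * g w) = (\<lambda>\<omega>. a * fourier_ext f \<omega> + b * fourier_ext g \<omega>)"
      unfolding fourier_ext_eq[OF f] fourier_ext_eq[OF g] fourier_ext_eq[OF fg] hat_transform_linear[OF Rep_hat_H f g] ..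
  }
  fix \<epsilon> :: real assume \<epsilon>: "0 < \<epsilon>"
  have "sup_norm (\<lambda>\<omega>. fourier_ext g \<omega> - fourier_ext f \<omega>) < \<epsilon>"
    if "g \<in> L1_heis" and close: "L1_norm (\<lambda>w. g w - f w) < \<epsilon>" for g
  proof -
    have g: "integrable lebesgue g" using that by (simp add: L1_heis_def)
    have "norm (fourier_ext g \<omega> - fourier_ext f \<omega>) \<le> L1_norm (\<lambda>w. g w - f w)" for \<omega>
      using hat_transform_linear[OF Rep_hat_H[of \<omega>] g f, of 1 "-1"]
        norm_hat_transform_le[OF Rep_hat_H[of \<omega>], of "\<lambda>w. g w - f w"] f g
      by (simp add: fourier_ext_eq[OF f] fourier_ext_eq[OF g])
    then have "sup_norm (\<lambda>\<omega>. fourier_ext g \<omega> - fourier_ext f \<omega>) \<le> L1_norm (\<lambda>w. g w - f w)"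
      unfolding sup_norm_def by (intro cSUP_least) auto
    then show ?thesis using close by linarith
  qed
  then show "\<exists>\<delta>>0. \<forall>g\<in>L1_heis. L1_norm (\<lambda>w. g w - f w) < \<delta> \<longrightarrow> sup_norm (\<lambda>\<omega>. fourier_ext g \<omega> - fourier_ext f \<omega>) < \<epsilon>"
    using \<epsilon> by blast
qed

end
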